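(* There is an algorithm running in $O(n^3)$ time which, given a connected cubic graph $G=(V,E)$ on $n$ vertices with chromatic number $3$, $G$ not the prism $P$ (the $6$-vertex graph $K_3\square K_2$), together with machine speeds $s_1>s_2=s_3>0$, returns a partition of $V$ into three independent sets $I_1,I_2,I_3$ whose schedule length $\max\{|I_1|/s_1,|I_2|/s_2,|I_3|/s_3\}$ is less than $\frac{4}{3}C^*_{\max}(G)$, where $C^*_{\max}(G)$ is the minimum of this quantity over all partitions of $V$ into three independent sets.
   Context: Scheduling setting: $n$ identical unit-length jobs are the vertices of a cubic incompatibility graph $G$; adjacent jobs may not share a machine. Three uniform machines $M_1,M_2,M_3$ with speeds $s_1,s_2,s_3$; a job on $M_i$ takes $1/s_i$ time units. A schedule is a partition of $V(G)$ into independent sets $I_1,I_2,I_3$ (possibly empty), $I_i$ processed on $M_i$, of length $C_{\max}=\max_i|I_i|/s_i$. *)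

theory Defs
  imports Complex_Main "HOL-Library.Landau_Symbols"
begin

section \<open>Simple graphs\<close>

definition simple_graph :: "'a set \<Rightarrow> 'a set set \<Rightarrow> bool" where
  "simple_graph V E \<longleftrightarrow> finite V \<and> (\<forall>e\<in>E. e \<subseteq> V \<and> card e = 2)"

definition vertex_degree :: "'a set set \<Rightarrow> 'a \<Rightarrow> nat" where
  "vertex_degree E v = card {e \<in> E. v \<in> e}"

definition cubic_graph :: "'a set \<Rightarrow> 'a set set \<Rightarrow> bool" where
  "cubic_graph V E \<longleftrightarrow> simple_graph V E \<and> (\<forall>v\<in>V. vertex_degree E v = 3)"

definition connected_graph :: "'a set \<Rightarrow> 'a set set \<Rightarrow> bool" where
  "connected_graph V E \<longleftrightarrow>
     V \<noteq> {} \<and> (\<forall>u\<in>V. \<forall>v\<in>V. (u, v) \<in> {(x, y). {x, y} \<in> E}\<^sup>*)"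

definition proper_colouring :: "'a set set \<Rightarrow> ('a \<Rightarrow> nat) \<Rightarrow> bool" where
  "proper_colouring E c \<longleftrightarrow> (\<forall>u v. {u, v} \<in> E \<longrightarrow> c u \<noteq> c v)"

definition chromatic_number :: "'a set \<Rightarrow> 'a set set \<Rightarrow> nat" where
  "chromatic_number V E = (LEAST k. \<exists>c. c ` V \<subseteq> {..<k} \<and> proper_colouring E c)"

definition independent_set :: "'a set \<Rightarrow> 'a set set \<Rightarrow> 'a set \<Rightarrow> bool" where
  "independent_set V E I \<longleftrightarrow> I \<subseteq> V \<and> (\<forall>u\<in>I. \<forall>v\<in>I. {u, v} \<notin> E)"

definition graph_isomorphic ::
    "'a set \<Rightarrow> 'a set set \<Rightarrow> 'b set \<Rightarrow> 'b set set \<Rightarrow> bool" where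
  "graph_isomorphic V E V' E' \<longleftrightarrow>
     (\<exists>f. bij_betw f V V' \<and> (\<forall>u\<in>V. \<forall>v\<in>V. {u, v} \<in> E \<longleftrightarrow> {f u, f v} \<in> E'))"

definition complete_edges :: "'a set \<Rightarrow> 'a set set" where
  "complete_edges A = {e. e \<subseteq> A \<and> card e = 2}"

definition box_edges ::
    "'a set \<Rightarrow> 'a set set \<Rightarrow> 'b set \<Rightarrow> 'b set set \<Rightarrow> ('a \<times> 'b) set set" where
  "box_edges V E W F =
     {{(u, x), (u, y)} |u x y. u \<in> V \<and> {x, y} \<in> F} \<union>
     {{(u, x), (v, x)} |u v x. {u, v} \<in> E \<and> x \<in> W}"

definition prism_vertices :: "(nat \<times> nat) set" where
  "prism_vertices = {..<3} \<times> {..<2}"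

definition prism_edges :: "(nat \<times> nat) set set" where
  "prism_edges =
     box_edges {..<3} (complete_edges {..<3}) {..<2} (complete_edges {..<2})"


section \<open>Schedules on three uniform machines\<close>

definition is_schedule :: "'a set \<Rightarrow> 'a set set \<Rightarrow> 'a set \<Rightarrow> 'a set \<Rightarrow> 'a set \<Rightarrow> bool" where
  "is_schedule V E I\<^sub>1 I\<^sub>2 I\<^sub>3 \<longleftrightarrow>
     I\<^sub>1 \<union> I\<^sub>2 \<union> I\<^sub>3 = V \<and> I\<^sub>1 \<inter> I\<^sub>2 = {} \<and> I\<^sub>1 \<inter> I\<^sub>3 = {} \<and> I\<^sub>2 \<inter> I\<^sub>3 = {} \<and>
     independent_set V E I\<^sub>1 \<and> independent_set V E I\<^sub>2 \<and> independent_set V E I\<^sub>3"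

definition schedule_length ::
    "real \<Rightarrow> real \<Rightarrow> real \<Rightarrow> 'a set \<Rightarrow> 'a set \<Rightarrow> 'a set \<Rightarrow> real" where
  "schedule_length s\<^sub>1 s\<^sub>2 s\<^sub>3 I\<^sub>1 I\<^sub>2 I\<^sub>3 =
     Max {real (card I\<^sub>1) / s\<^sub>1, real (card I\<^sub>2) / s\<^sub>2, real (card I\<^sub>3) / s\<^sub>3}"

definition optimal_length :: "'a set \<Rightarrow> 'a set set \<Rightarrow> real \<Rightarrow> real \<Rightarrow> real \<Rightarrow> real" where
  "optimal_length V E s\<^sub>1 s\<^sub>2 s\<^sub>3 =
     Min {schedule_length s\<^sub>1 s\<^sub>2 s\<^sub>3 I\<^sub>1 I\<^sub>2 I\<^sub>3 |I\<^sub>1 I\<^sub>2 I\<^sub>3. is_schedule V E I\<^sub>1 I\<^sub>2 I\<^sub>3}"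


section \<open>Algorithms and their running time\<close>

text \<open>
  Algorithms are programs of a structured random access machine with uniform cost. It has
  natural-number registers and arrays, and real registers as in the real RAM, because the
  machine speeds are arbitrary positive reals. Every operation costs one time unit. To keep
  this cost measure reasonable, the naturals have only addition and truncated subtraction,
  and there is no rounding from reals to naturals. The only constants of a program are
  naturals, so that no real number can be used as an advice string.
\<close>

type_synonym vname = string

record ram_state =
  nreg :: "vname \<Rightarrow> nat"
  narr :: "vname \<Rightarrow> nat \<Rightarrow> nat"
  rreg :: "vname \<Rightarrow> real"

datatype nexp =
    NConst nat
  | NReg vname
  | NArr vname nexp
  | NAdd nexp nexp
  | NSub nexp nexp

datatype rexp =
    RNat nexp
  | RReg vname
  | RAdd rexp rexp
  | RSub rexp rexp
  | RMul rexp rexp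
  | RDiv rexp rexp

datatype bexp =
    NLess nexp nexp
  | NEq nexp nexp
  | RLess rexp rexp
  | BNot bexp
  | BAnd bexp bexp

datatype com =
    Skip
  | NAssign vname nexp
  | NStore vname nexp nexp
  | RAssign vname rexp
  | Seq com com
  | Cond bexp com com
  | While bexp com

primrec nval :: "nexp \<Rightarrow> ram_state \<Rightarrow> nat" where
  "nval (NConst k) s = k"
| "nval (NReg x) s = nreg s x"
| "nval (NArr a e) s = narr s a (nval e s)"
| "nval (NAdd e f) s = nval e s + nval f s"
| "nval (NSub e f) s = nval e s - nval f s"

primrec rval :: "rexp \<Rightarrow> ram_state \<Rightarrow> real" where
  "rval (RNat e) s = real (nval e s)"
| "rval (RReg x) s = rreg s x"
| "rval (RAdd e f) s = rval e s + rval f s"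
| "rval (RSub e f) s = rval e s - rval f s"
| "rval (RMul e f) s = rval e s * rval f s"
| "rval (RDiv e f) s = rval e s / rval f s"

primrec bval :: "bexp \<Rightarrow> ram_state \<Rightarrow> bool" where
  "bval (NLess e f) s \<longleftrightarrow> nval e s < nval f s"
| "bval (NEq e f) s \<longleftrightarrow> nval e s = nval f s"
| "bval (RLess e f) s \<longleftrightarrow> rval e s < rval f s"
| "bval (BNot b) s \<longleftrightarrow> \<not> bval b s"
| "bval (BAnd b c) s \<longleftrightarrow> bval b s \<and> bval c s"

primrec ncost :: "nexp \<Rightarrow> nat" where
  "ncost (NConst k) = 1"
| "ncost (NReg x) = 1"
| "ncost (NArr a e) = ncost e + 1"
| "ncost (NAdd e f) = ncost e + ncost f + 1"
| "ncost (NSub e f) = ncost e + ncost f + 1"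

primrec rcost :: "rexp \<Rightarrow> nat" where
  "rcost (RNat e) = ncost e + 1"
| "rcost (RReg x) = 1"
| "rcost (RAdd e f) = rcost e + rcost f + 1"
| "rcost (RSub e f) = rcost e + rcost f + 1"
| "rcost (RMul e f) = rcost e + rcost f + 1"
| "rcost (RDiv e f) = rcost e + rcost f + 1"

primrec bcost :: "bexp \<Rightarrow> nat" where
  "bcost (NLess e f) = ncost e + ncost f + 1"
| "bcost (NEq e f) = ncost e + ncost f + 1"
| "bcost (RLess e f) = rcost e + rcost f + 1"
| "bcost (BNot b) = bcost b + 1"
| "bcost (BAnd b c) = bcost b + bcost c + 1"

text \<open>
  \<open>exec c s t s'\<close>: started in state \<open>s\<close>, the program \<open>c\<close> halts after \<open>t\<close> time units in
  state \<open>s'\<close>.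
\<close>

inductive exec :: "com \<Rightarrow> ram_state \<Rightarrow> nat \<Rightarrow> ram_state \<Rightarrow> bool" where
  Skip: "exec Skip s 1 s"
| NAssign: "exec (NAssign x e) s (ncost e + 1) (s\<lparr>nreg := (nreg s)(x := nval e s)\<rparr>)"
| NStore: "exec (NStore a i e) s (ncost i + ncost e + 1)
     (s\<lparr>narr := (narr s)(a := (narr s a)(nval i s := nval e s))\<rparr>)"
| RAssign: "exec (RAssign x e) s (rcost e + 1) (s\<lparr>rreg := (rreg s)(x := rval e s)\<rparr>)"
| Seq: "exec c s t s' \<Longrightarrow> exec d s' u s'' \<Longrightarrow> exec (Seq c d) s (t + u) s''"
| CondTrue: "bval b s \<Longrightarrow> exec c s t s' \<Longrightarrow> exec (Cond b c d) s (bcost b + 1 + t) s'"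
| CondFalse: "\<not> bval b s \<Longrightarrow> exec d s t s' \<Longrightarrow> exec (Cond b c d) s (bcost b + 1 + t) s'"
| WhileFalse: "\<not> bval b s \<Longrightarrow> exec (While b c) s (bcost b + 1) s"
| WhileTrue: "bval b s \<Longrightarrow> exec c s t s' \<Longrightarrow> exec (While b c) s' u s'' \<Longrightarrow>
     exec (While b c) s (bcost b + 1 + t + u) s''"

inductive_cases SkipE: "exec Skip s t s'"
  and NAssignE: "exec (NAssign x e) s t s'"
  and NStoreE: "exec (NStore a i e) s t s'"
  and RAssignE: "exec (RAssign x e) s t s'"
  and SeqE: "exec (Seq c d) s t s'"
  and CondE: "exec (Cond b c d) s t s'"
  and WhileE: "exec (While b c) s t s'"

lemma exec_deterministic: "exec c s t s' \<Longrightarrow> exec c s u s'' \<Longrightarrow> t = u \<and> s' = s''"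
proof (induction arbitrary: u s'' rule: exec.induct)
  case (Seq c s t s' d v r)
  from Seq.prems show ?case
  proof (rule SeqE)
    fix t' q v' assume "u = t' + v'" and c: "exec c s t' q" and d: "exec d q v' s''"
    moreover from Seq.IH(1)[OF c] have "t = t'" "s' = q" by simp_all
    ultimately show ?thesis using Seq.IH(2) by simp
  qed
next
  case (CondTrue b s c t s' d)
  from CondTrue.prems show ?case
    by (rule CondE) (use CondTrue.hyps(1) CondTrue.IH in simp_all)
next
  case (CondFalse b s d t s' c)
  from CondFalse.prems show ?case
    by (rule CondE) (use CondFalse.hyps(1) CondFalse.IH in simp_all)
next
  case (WhileTrue b s c t s' v r)
  from WhileTrue.prems show ?case
  proof (rule WhileE)
    fix t' q v'
    assume "u = Suc (bcost b + t' + v')" and c: "exec c s t' q" and d: "exec (While b c) q v' s''"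
    moreover from WhileTrue.IH(1)[OF c] have "t = t'" "s' = q" by simp_all
    ultimately show ?thesis using WhileTrue.IH(2) by simp
  qed (use WhileTrue.hyps(1) in simp_all)
next
  case (WhileFalse b s c)
  from WhileFalse.prems show ?case
    by (rule WhileE) (use WhileFalse.hyps(1) in simp_all)
next
  case (Skip s)
  then show ?case by (auto elim: SkipE)
next
  case (NAssign x e s)
  then show ?case by (rule NAssignE) simp
next
  case (NStore a i e s)
  then show ?case by (rule NStoreE) simp
next
  case (RAssign x e s)
  then show ?case by (rule RAssignE) simp
qed

text \<open>
  Input format: the vertices of the graph are numbered \<open>0, \<dots>, n - 1\<close>, and the array cells
  \<open>3 * v\<close>, \<open>3 * v + 1\<close>, \<open>3 * v + 2\<close> hold the three neighbours of \<open>v\<close> in arbitrary order.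
  All other cells and registers are initially zero. Output format: cell \<open>v\<close> of the array
  \<open>machine\<close> holds the number of the machine that processes \<open>v\<close>.
\<close>

definition adjacency_array :: "nat \<Rightarrow> nat set set \<Rightarrow> (nat \<Rightarrow> nat) \<Rightarrow> bool" where
  "adjacency_array n E adj \<longleftrightarrow>
     (\<forall>v<n. {adj (3 * v), adj (3 * v + 1), adj (3 * v + 2)} = {u. {u, v} \<in> E})"

definition input_state ::
    "nat \<Rightarrow> (nat \<Rightarrow> nat) \<Rightarrow> real \<Rightarrow> real \<Rightarrow> real \<Rightarrow> ram_state" where
  "input_state n adj s\<^sub>1 s\<^sub>2 s\<^sub>3 =
     \<lparr>nreg = (\<lambda>_. 0)(''n'' := n),
      narr = (\<lambda>_ _. 0)(''adj'' := (\<lambda>i. if i < 3 * n then adj i else 0)),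
      rreg = (\<lambda>_. 0)(''s1'' := s\<^sub>1, ''s2'' := s\<^sub>2, ''s3'' := s\<^sub>3)\<rparr>"

definition output_class :: "nat \<Rightarrow> ram_state \<Rightarrow> nat \<Rightarrow> nat set" where
  "output_class n s i = {v. v < n \<and> narr s ''machine'' v = i}"

end

theory Submission
  imports Defs
begin

text \<open>
  The speeds are irrelevant to the algorithm. In any schedule of a nonbipartite cubic graph the
  fast machine gets at most \<open>n / 2 - 1\<close> jobs, because \<open>3 (b + c - a)\<close> is twice the number of edges
  between the second and third class; hence the optimum is at least \<open>(n + 2) / (4 s\<^sub>2)\<close>, and it is at
  least \<open>n / (s\<^sub>1 + 2 s\<^sub>2)\<close> anyway. So every proper colouring with class sizes \<open>a \<le> 4 n / 9\<close> and
  \<open>b, c \<le> (n + 1) / 3\<close> is good enough.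

  Such a colouring arises as follows. Colour the vertices one by one as in the Kempe chain proof of
  Brooks' theorem, make the largest class maximal independent, and balance the other two classes by
  swapping colours along the paths that they induce. As long as \<open>a > 4 n / 9\<close>, counting edges yields
  a vertex of the largest class that has two neighbours without neighbours outside this class; these
  two can take the colour of the third neighbour, which frees a colour for the vertex. Finally \<open>b\<close>
  and \<open>c\<close> are evened out by recolouring vertices whose neighbours are all in the largest class.
\<close>

section \<open>Walks of an uncoloured vertex\<close>

text \<open>The thresholds are what the two lower bounds leave after the factor 4/3. As
  \<open>s\<^sub>1 > s\<^sub>2\<close>, the length n / (\<open>s\<^sub>1\<close> + 2
  \<open>s\<^sub>2\<close>) exceeds n / (3 \<open>s\<^sub>1\<close>), so 4 n / 9 jobs on the fast
  machine are strictly within the ratio; and 4/3 times (n + 2) / 4 is (n + 2) / 3, so an integer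
  below it is at most (n + 1) / 3. The time bound shapes the rest. Every phase is a single sweep
  over the vertices with at most linear work per vertex, so the treatment of a vertex must not spoil
  those already passed: dominated vertices stay dominated, treated components stay settled, no
  vertex becomes movable, and evening out keeps the set of free vertices. Kempe chains are neither
  searched for nor stored. An uncoloured vertex is pushed along the chain with a constant number of
  registers, and a walk that comes back to its start has performed the swap. The same loop swaps the
  colours on a path of classes 2 and 3 once an end of the path is uncoloured.\<close>

definition nbrs :: "(nat \<Rightarrow> nat \<Rightarrow> nat) \<Rightarrow> nat \<Rightarrow> nat set" where
  "nbrs nb v = {nb v 0, nb v 1, nb v 2}"

locale cubic_lists =
  fixes n :: nat and nb :: "nat \<Rightarrow> nat \<Rightarrow> nat"
  assumes N_less: "v < n \<Longrightarrow> nbrs nb v \<subseteq> {..<n}"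
    and N_card: "v < n \<Longrightarrow> card (nbrs nb v) = 3"
    and N_irrefl: "v < n \<Longrightarrow> v \<notin> nbrs nb v"
    and N_sym: "u < n \<Longrightarrow> w < n \<Longrightarrow> u \<in> nbrs nb w \<Longrightarrow> w \<in> nbrs nb u"
begin

abbreviation N :: "nat \<Rightarrow> nat set" where
  "N \<equiv> nbrs nb"

lemmas N_def = nbrs_def[of nb]

lemma N_ltD: "v < n \<Longrightarrow> w \<in> N v \<Longrightarrow> w < n"
  using N_less by blast

lemma finite_N [simp]: "finite (N v)"
  by (simp add: N_def)

lemma N_eqI:
  assumes "v < n" "x \<in> N v" "y \<in> N v" "z \<in> N v" "x \<noteq> y" "x \<noteq> z" "y \<noteq> z"
  shows "N v = {x, y, z}"
proof -
  have "card {x, y, z} = 3" using assms by simp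
  moreover have "{x, y, z} \<subseteq> N v" using assms by blast
  ultimately show ?thesis using N_card[OF assms(1)] by (metis card_subset_eq finite_N)
qed

text \<open>Colour 0 stands for uncoloured, so these are partial colourings; two adjacent vertices
  may both be uncoloured.\<close>

definition proper :: "(nat \<Rightarrow> nat) \<Rightarrow> bool" where
  "proper c \<longleftrightarrow> (\<forall>u<n. c u \<le> 3 \<and> (c u \<noteq> 0 \<longrightarrow> c u \<notin> c ` N u))"

definition alt :: "nat \<Rightarrow> nat \<Rightarrow> nat \<Rightarrow> nat" where
  "alt \<alpha> \<beta> i = (if odd i then \<alpha> else \<beta>)"

lemma alt_Suc_Suc [simp]: "alt \<alpha> \<beta> (Suc (Suc i)) = alt \<alpha> \<beta> i"
  by (simp add: alt_def)

definition two_colours :: "nat \<Rightarrow> nat \<Rightarrow> bool" where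
  "two_colours \<alpha> \<beta> \<longleftrightarrow> \<alpha> \<in> {1, 2, 3} \<and> \<beta> \<in> {1, 2, 3} \<and> \<alpha> \<noteq> \<beta>"

lemma alt_colours:
  assumes "two_colours \<alpha> \<beta>"
  shows "alt \<alpha> \<beta> i \<noteq> 0" "alt \<alpha> \<beta> i \<le> 3" "alt \<alpha> \<beta> i \<noteq> 6 - \<alpha> - \<beta>"
    "alt \<alpha> \<beta> (Suc i) \<noteq> alt \<alpha> \<beta> i" "6 - \<alpha> - \<beta> \<noteq> 0" "6 - \<alpha> - \<beta> \<le> 3"
  using assms by (auto simp: two_colours_def alt_def)

text \<open>
  An uncoloured vertex travels from \<open>v\<close> along \<open>p\<close>: each vertex takes over the colour of its successor,
  which is alternately \<open>\<alpha>\<close> and \<open>\<beta>\<close>. Here \<open>c\<close> is the colouring before the walk. In \<open>shifted\<close>, \<open>c'\<close> is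
  the colouring after \<open>k\<close> steps, with \<open>x\<close> as the colour of \<open>p k\<close>; \<open>6 - \<alpha> - \<beta>\<close> is the third colour.
\<close>

definition track :: "(nat \<Rightarrow> nat) \<Rightarrow> nat \<Rightarrow> nat \<Rightarrow> nat \<Rightarrow> (nat \<Rightarrow> nat) \<Rightarrow> nat \<Rightarrow> bool" where
  "track c \<alpha> \<beta> v p k \<longleftrightarrow>
     p 0 = v \<and> inj_on p {..k} \<and> (\<forall>i\<le>k. p i < n) \<and> (\<forall>i<k. p (Suc i) \<in> N (p i)) \<and>
     (\<forall>i. 0 < i \<and> i \<le> k \<longrightarrow> c (p i) = alt \<alpha> \<beta> i) \<and>
     (\<forall>i. 0 < i \<and> i < k \<longrightarrow> (\<exists>g\<in>N (p i). c g = 6 - \<alpha> - \<beta>))"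

definition shifted ::
    "(nat \<Rightarrow> nat) \<Rightarrow> nat \<Rightarrow> nat \<Rightarrow> (nat \<Rightarrow> nat) \<Rightarrow> nat \<Rightarrow> nat \<Rightarrow> (nat \<Rightarrow> nat) \<Rightarrow> bool" where
  "shifted c \<alpha> \<beta> p k x c' \<longleftrightarrow>
     (\<forall>i<k. c' (p i) = alt \<alpha> \<beta> (Suc i)) \<and> c' (p k) = x \<and> (\<forall>u. u \<notin> p ` {..k} \<longrightarrow> c' u = c u)"

lemma track_0: "v < n \<Longrightarrow> track c \<alpha> \<beta> v (\<lambda>_. v) 0"
  by (auto simp: track_def)

lemma shifted_0: "c v = 0 \<Longrightarrow> shifted c \<alpha> \<beta> (\<lambda>_. v) 0 0 c"
  by (auto simp: shifted_def)

text \<open>Vertices of the track have colour 0, \<alpha> or \<beta>, so a neighbour of the third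
  colour differs from predecessor and successor, and these three exhaust the degree. Hence inner
  vertices have no chords, which keeps a walk from running into its own track.\<close>

lemma track_nbrs:
  assumes tc: "two_colours \<alpha> \<beta>" and tr: "track c \<alpha> \<beta> v p k" and v0: "c v = 0" and i: "0 < i" "i < k"
    obtains g where "N (p i) = {p (i - 1), p (Suc i), g}" "c g = 6 - \<alpha> - \<beta>"
proof -
  obtain g where g: "g \<in> N (p i)" "c g = 6 - \<alpha> - \<beta>" using tr i unfolding track_def by blast
  have lt: "p i < n" "p (i - 1) < n" using tr i unfolding track_def by auto
  have "p (Suc i) \<in> N (p i)" using tr i unfolding track_def by auto
  moreover have "\<forall>j<k. p (Suc j) \<in> N (p j)" using tr unfolding track_def by auto
  hence "i - 1 < k \<longrightarrow> p (Suc (i - 1)) \<in> N (p (i - 1))" by blast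
  hence "p i \<in> N (p (i - 1))" using i by simp
  hence "p (i - 1) \<in> N (p i)" using N_sym lt i by simp
  moreover have "inj_on p {..k}" using tr unfolding track_def by auto
  hence "p (i - 1) = p (Suc i) \<longleftrightarrow> i - 1 = Suc i"
    by (rule inj_on_eq_iff) (use i in auto)
  hence "p (i - 1) \<noteq> p (Suc i)" by simp
  moreover have "c (p j) \<noteq> 6 - \<alpha> - \<beta>" if "j \<le> k" for j
    using tr that alt_colours[OF tc] v0 unfolding track_def by (cases "j = 0") auto
  hence "g \<noteq> p (i - 1)" "g \<noteq> p (Suc i)" using g i by auto
  ultimately show thesis using N_eqI[OF lt(1), of "p (i-1)" "p (Suc i)" g] g that by blast
qed

text \<open>This serves twice. It makes the first step of a walk from \<open>w\<close> unambiguous;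
  and in a colouring with \<open>w\<close> in class 2 or 3 and \<alpha> the other one of these
  colours, it says that \<open>w\<close> has degree at most 1 in the graph induced by the two
  classes.\<close>

definition endpoint :: "(nat \<Rightarrow> nat) \<Rightarrow> nat \<Rightarrow> nat \<Rightarrow> bool" where
  "endpoint c \<alpha> w \<longleftrightarrow> (\<forall>y\<in>N w. \<forall>z\<in>N w. c y = \<alpha> \<longrightarrow> c z = \<alpha> \<longrightarrow> y = z)"

text \<open>For \<open>k > 0\<close> the vertex \<open>p k\<close> sees its predecessor, a vertex of
  the third colour and just one vertex \<open>w\<close> of the wanted colour, so taking over the
  colour of \<open>w\<close> and uncolouring \<open>w\<close> creates no conflict. Since
  \<open>track_nbrs\<close> accounts for all edges at inner vertices, \<open>w\<close> is new unless
  the walk has closed up at \<open>v\<close>.\<close>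

lemma track_step:
  assumes tc: "two_colours \<alpha> \<beta>" and tr: "track c \<alpha> \<beta> v p k" and v0: "c v = 0"
    and sh: "shifted c \<alpha> \<beta> p k 0 c'" and pr: "proper c'"
    and uniq: "endpoint c \<alpha> v"
    and w: "w \<in> N (p k)" "c' w = alt \<alpha> \<beta> (Suc k)"
    and g: "g \<in> N (p k)" "c' g = 6 - \<alpha> - \<beta>"
    and c'': "c'' = c'(p k := alt \<alpha> \<beta> (Suc k), w := 0)"
  shows "proper c''"
    and "w = v \<Longrightarrow> 2 \<le> k \<and> even k \<and> (\<exists>g\<in>N (p k). c g = 6 - \<alpha> - \<beta>) \<and> v \<in> N (p k)"
    and "w \<noteq> v \<Longrightarrow> w \<notin> p ` {..k} \<and> track c \<alpha> \<beta> v (p(Suc k := w)) (Suc k) \<and>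
           shifted c \<alpha> \<beta> (p(Suc k := w)) (Suc k) 0 c''"
proof -
  note ac = alt_colours[OF tc]
  have pk: "p k < n" using tr unfolding track_def by auto
  have wn: "w < n" and gn: "g < n" using N_ltD pk w g by auto
  have inj: "inj_on p {..k}" and p0: "p 0 = v" using tr unfolding track_def by auto
  have c'p: "c' (p i) = alt \<alpha> \<beta> (Suc i)" if "i < k" for i using sh that unfolding shifted_def by blast
  have c'k: "c' (p k) = 0" and c'o: "\<And>u. u \<notin> p ` {..k} \<Longrightarrow> c' u = c u"
    using sh unfolding shifted_def by auto
  have gp: "g \<notin> p ` {..k}"
  proof
    assume "g \<in> p ` {..k}"
    then obtain i where "i \<le> k" "g = p i" by auto
    thus False using g c'p[of i] c'k ac by (cases "i = k") auto
  qed
  hence cg: "c g = 6 - \<alpha> - \<beta>" using c'o g by auto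
  have wk: "w \<noteq> p k" using w N_irrefl pk by auto
  have prev: "p (k - 1) \<in> N (p k)" "c' (p (k-1)) = alt \<alpha> \<beta> k" if "0 < k"
  proof -
    have "\<forall>i<k. p (Suc i) \<in> N (p i)" "p (k-1) < n" using tr unfolding track_def by auto
    hence "p (Suc (k - 1)) \<in> N (p (k - 1))" "p (k-1) < n" using that by (metis diff_less zero_less_one, simp)
    thus "p (k - 1) \<in> N (p k)" using N_sym pk that by auto
    show "c' (p (k-1)) = alt \<alpha> \<beta> k" using c'p[of "k-1"] that by simp
  qed
  \<comment> \<open>For \<open>k = 0\<close> there is no predecessor to use up an edge; uniqueness
    then comes from \<open>endpoint\<close>.\<close>
  have uw: "w' = w" if "w' \<in> N (p k)" "c' w' = alt \<alpha> \<beta> (Suc k)" for w'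
  proof (cases "k = 0")
    case True
    have "w' \<noteq> v" "w \<noteq> v" using that w True p0 N_irrefl pk by auto
    hence "c w = \<alpha>" "c w' = \<alpha>" using c'o[of w] c'o[of w'] True p0 w that by (auto simp: alt_def)
    thus ?thesis using uniq that w True p0 unfolding endpoint_def by blast
  next
    case False
    have "p (k-1) \<noteq> w" "p (k-1) \<noteq> g" "g \<noteq> w" using prev w g False ac(3)[of k] ac(3)[of "Suc k"] ac(4)[of k] by auto
    hence "N (p k) = {p (k-1), w, g}" using N_eqI[OF pk] prev w g False by auto
    thus ?thesis using that prev g ac(3)[of "Suc k"] ac(4)[of k] False by force
  qed
  show "proper c''"
    unfolding proper_def
  proof (intro allI impI conjI)
    fix u assume u: "u < n"
    show "c'' u \<le> 3" using pr u ac(2) unfolding proper_def c'' by auto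
    assume nz: "c'' u \<noteq> 0"
    hence uw': "u \<noteq> w" by (auto simp: c'')
    show "c'' u \<notin> c'' ` N u"
    proof
      assume "c'' u \<in> c'' ` N u"
      then obtain x where x: "x \<in> N u" "c'' x = c'' u" by auto
      have xn: "x < n" and xu: "x \<noteq> u" using x u N_ltD N_irrefl by auto
      have xw: "x \<noteq> w" using x nz by (auto simp: c'')
      show False
      proof (cases "u = p k")
        case True
        thus False using x xu xw wk uw[of x] by (auto simp: c'')
      next
        case False
        show False
        proof (cases "x = p k")
          case True
          thus False using x xu xw wk uw[of u] False uw' N_sym[OF xn u] by (auto simp: c'')
        next
          case F: False
          hence "c' u \<noteq> 0" "c' x = c' u" using False uw' xw x nz by (auto simp: c'')
          thus False using pr u x unfolding proper_def by (metis imageI)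
        qed
      qed
    qed
  qed
  have wi: "w = v" if "w \<in> p ` {..k}"
  proof (rule ccontr)
    assume wv: "w \<noteq> v"
    obtain i where i: "i \<le> k" "w = p i" using \<open>w \<in> p ` {..k}\<close> by auto
    have "i \<noteq> k" using i wk by auto
    have "i \<noteq> 0" using i wv p0 by (cases "i = 0") auto
    \<comment> \<open>The predecessor has meanwhile taken the other colour of the pair.\<close>
    have "i \<noteq> k - 1" using \<open>i \<noteq> k\<close> \<open>i \<noteq> 0\<close> i prev w ac(4)[of k] by auto
    have ik: "0 < i" "i < k" using i \<open>i \<noteq> k\<close> \<open>i \<noteq> 0\<close> by auto
    obtain h where h: "N (p i) = {p (i - 1), p (Suc i), h}" "c h = 6 - \<alpha> - \<beta>"
      using track_nbrs[OF tc tr v0 ik] by blast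
    have "p k \<in> N (p i)" using N_sym[OF wn pk w(1)] i by simp
    moreover have "p k = p (i - 1) \<longleftrightarrow> k = i - 1" "p k = p (Suc i) \<longleftrightarrow> k = Suc i"
      by (rule inj_on_eq_iff[OF inj]; use ik in auto)+
    hence "p k \<noteq> p (i - 1)" "p k \<noteq> p (Suc i)" using ik \<open>i \<noteq> k - 1\<close> by auto
    ultimately have "p k = h" using h by auto
    moreover have "c (p k) = alt \<alpha> \<beta> k" using tr ik unfolding track_def by auto
    ultimately show False using h ac by auto
  qed
  show "2 \<le> k \<and> even k \<and> (\<exists>g\<in>N (p k). c g = 6 - \<alpha> - \<beta>) \<and> v \<in> N (p k)" if "w = v"
  proof -
    have "k \<noteq> 0" using that wk p0 by (cases "k = 0") auto
    hence "c' v = \<alpha>" using c'p[of 0] p0 by (simp add: alt_def)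
    \<comment> \<open>After the first step \<open>v\<close> carries \<alpha>, and \<alpha> is the
      wanted colour only at even \<open>k\<close>.\<close>
    hence "even k" using w that ac tc by (auto simp: alt_def two_colours_def split: if_splits)
    with \<open>k \<noteq> 0\<close> have "2 \<le> k" by (cases k; cases "k - 1") auto
    thus ?thesis using \<open>even k\<close> g cg w that by auto
  qed
  assume wv: "w \<noteq> v"
  have wp: "w \<notin> p ` {..k}" using wi wv by blast
  have cw: "c w = alt \<alpha> \<beta> (Suc k)" using c'o wp w by auto
  have "track c \<alpha> \<beta> v (p(Suc k := w)) (Suc k)"
    unfolding track_def
  proof (intro conjI allI impI)
    show "(p(Suc k := w)) 0 = v" using p0 by simp
    show "inj_on (p(Suc k := w)) {..Suc k}"
      using inj wp by (auto simp: inj_on_def atMost_Suc)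
    show "(p(Suc k := w)) i < n" if "i \<le> Suc k" for i
      using tr wn that unfolding track_def by auto
    show "(p(Suc k := w)) (Suc i) \<in> N ((p(Suc k := w)) i)" if "i < Suc k" for i
      using tr w that unfolding track_def by (auto simp: less_Suc_eq)
    show "c ((p(Suc k := w)) i) = alt \<alpha> \<beta> i" if "0 < i \<and> i \<le> Suc k" for i
      using tr cw that unfolding track_def by auto
    show "\<exists>g\<in>N ((p(Suc k := w)) i). c g = 6 - \<alpha> - \<beta>" if "0 < i \<and> i < Suc k" for i
      using tr g cg that unfolding track_def by (auto simp: less_Suc_eq)
  qed
  moreover have "shifted c \<alpha> \<beta> (p(Suc k := w)) (Suc k) 0 c''"
    unfolding shifted_def
  proof (intro conjI allI impI)
    fix i assume i: "i < Suc k"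
    have "p i \<noteq> w" using i wp by auto
    moreover have "p i \<noteq> p k" if "i \<noteq> k" using i that inj unfolding inj_on_def by auto
    ultimately show "c'' ((p(Suc k := w)) i) = alt \<alpha> \<beta> (Suc i)"
      using i c'p[of i] by (cases "i = k") (auto simp: c'')
  next
    show "c'' ((p(Suc k := w)) (Suc k)) = 0" by (simp add: c'')
  next
    fix u assume "u \<notin> (p(Suc k := w)) ` {..Suc k}"
    hence "u \<noteq> w" "u \<notin> p ` {..k}" by (auto simp: image_iff atMost_Suc)
    thus "c'' u = c u" using c'o by (auto simp: c'')
  qed
  ultimately show "w \<notin> p ` {..k} \<and> track c \<alpha> \<beta> v (p(Suc k := w)) (Suc k) \<and>
           shifted c \<alpha> \<beta> (p(Suc k := w)) (Suc k) 0 c''" using wp by blast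
qed

section \<open>Kempe swaps around a stuck vertex\<close>

definition stuck :: "(nat \<Rightarrow> nat) \<Rightarrow> nat \<Rightarrow> bool" where
  "stuck c v \<longleftrightarrow> v < n \<and> c v = 0 \<and> c ` N v = {1, 2, 3}"

text \<open>Setting \<open>p (Suc k) = v\<close> closes the track to a cycle, so that the last
  vertex has a successor like all others. Evenness of \<open>k\<close> makes the cycle odd: its two
  edges at \<open>v\<close> lead to vertices of different colours.\<close>

definition returned ::
    "(nat \<Rightarrow> nat) \<Rightarrow> nat \<Rightarrow> nat \<Rightarrow> nat \<Rightarrow> (nat \<Rightarrow> nat) \<Rightarrow> nat \<Rightarrow> (nat \<Rightarrow> nat) \<Rightarrow> bool" where
  "returned c \<alpha> \<beta> v p k c' \<longleftrightarrow>
     track c \<alpha> \<beta> v p k \<and> 2 \<le> k \<and> even k \<and> p (Suc k) = v \<and> v \<in> N (p k) \<and>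
     (\<exists>g\<in>N (p k). c g = 6 - \<alpha> - \<beta>) \<and>
     (\<forall>i. 0 < i \<and> i \<le> k \<longrightarrow> c' (p i) = alt \<alpha> \<beta> (Suc i)) \<and> c' v = 0 \<and>
     (\<forall>u. u \<notin> p ` {..k} \<longrightarrow> c' u = c u)"

lemma returnedI:
  assumes tr: "track c \<alpha> \<beta> v p k" and sh: "shifted c \<alpha> \<beta> p k 0 c'"
    and k: "2 \<le> k" "even k" "\<exists>g\<in>N (p k). c g = 6 - \<alpha> - \<beta>" "v \<in> N (p k)"
  shows "returned c \<alpha> \<beta> v (p(Suc k := v)) k (c'(p k := alt \<alpha> \<beta> (Suc k), v := 0))"
proof -
  have inj: "inj_on p {..k}" and p0: "p 0 = v" using tr unfolding track_def by auto
  have "track c \<alpha> \<beta> v (p(Suc k := v)) k" using tr unfolding track_def by (auto simp: inj_on_def)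
  moreover have "p i \<noteq> v" if "0 < i" "i \<le> k" for i
    using inj_on_eq_iff[OF inj, of i 0] that p0 by auto
  moreover have "p i \<noteq> p k" if "i < k" for i
    using inj_on_eq_iff[OF inj, of i k] that by auto
  moreover have "(p(Suc k := v)) ` {..k} = p ` {..k}" by auto
  moreover have "v \<in> p ` {..k}" using p0 by auto
  ultimately show ?thesis using k sh unfolding returned_def shifted_def
    by (auto simp: le_less)
qed

lemma returned_nbrs:
  assumes "two_colours \<alpha> \<beta>" and ret: "returned c \<alpha> \<beta> v p k c'" and v0: "c v = 0" and i: "0 < i" "i \<le> k"
  obtains g where "N (p i) = {p (i - 1), p (Suc i), g}" "c g = 6 - \<alpha> - \<beta>"
proof (cases "i = k")
  case False
  thus thesis using track_nbrs[of \<alpha> \<beta> c v p k i] assms that unfolding returned_def by auto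
next
  case True
  note ac = alt_colours[OF assms(1)]
  have tr: "track c \<alpha> \<beta> v p k" using ret unfolding returned_def by auto
  obtain g where g: "g \<in> N (p k)" "c g = 6 - \<alpha> - \<beta>" using ret unfolding returned_def by auto
  have vk: "v \<in> N (p k)" "p (Suc k) = v" "2 \<le> k" using ret unfolding returned_def by auto
  have pk: "p k < n" "p (k - 1) < n" using tr unfolding track_def by auto
  have "\<forall>j<k. p (Suc j) \<in> N (p j)" using tr unfolding track_def by auto
  hence "k - 1 < k \<longrightarrow> p (Suc (k - 1)) \<in> N (p (k - 1))" by blast
  hence "p k \<in> N (p (k - 1))" using vk by simp
  hence pr: "p (k - 1) \<in> N (p k)" using N_sym pk by simp
  have inj: "inj_on p {..k}" and p0: "p 0 = v" using tr unfolding track_def by auto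
  have "p (k - 1) \<noteq> v" using inj_on_eq_iff[OF inj, of "k-1" 0] p0 vk by auto
  moreover have "g \<noteq> v" using g v0 ac by auto
  moreover have "c (p (k-1)) = alt \<alpha> \<beta> (k-1)" using tr vk unfolding track_def by auto
  hence "g \<noteq> p (k-1)" using g ac(3)[of "k-1"] by auto
  ultimately have "N (p k) = {p (k-1), p (Suc k), g}" using N_eqI[OF pk(1) pr] vk g by auto
  thus thesis using that g True by blast
qed

text \<open>Three neighbours that show all three colours show each of them once, and 1 + 2 + 3 =
  6.\<close>

lemma stuck_colours:
  assumes "stuck c v" "N v = {x, y, z}"
  shows "two_colours (c x) (c y)" "6 - c x - c y = c z" "x \<noteq> y" "x \<noteq> z" "y \<noteq> z"
proof -
  have v: "v < n" using assms unfolding stuck_def by auto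
  have "inj_on c (N v)" using assms N_card[OF v] unfolding stuck_def by (intro eq_card_imp_inj_on) auto
  moreover show "x \<noteq> y" "x \<noteq> z" "y \<noteq> z" using N_card[OF v] assms(2) by (auto simp: card_insert_if split: if_splits)
  ultimately have d: "c x \<noteq> c y" "c x \<noteq> c z" "c y \<noteq> c z" using assms(2) by auto
  have "{c x, c y, c z} = {1, 2, 3}" using assms unfolding stuck_def by auto
  hence "c x \<in> {1,2,3}" "c y \<in> {1,2,3}" "c z \<in> {1,2,3}" by blast+
  thus "two_colours (c x) (c y)" "6 - c x - c y = c z" using d by (auto simp: two_colours_def)
qed

text \<open>As \<open>k\<close> is even, the walk leaves through \<open>x\<close>, the only
  neighbour of its first colour, and returns through \<open>y\<close>; the colour of
  \<open>z\<close> does not occur on the track. So \<open>v\<close> is as stuck as before, and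
  another walk can start from it.\<close>

lemma returned_ends:
  assumes st: "stuck c v" and Nv: "N v = {x, y, z}" and ret: "returned c (c x) (c y) v p k c'"
  shows "p 1 = x" "p k = y" "c' x = c y" "c' y = c x" "c' z = c z" "stuck c' v"
proof -
  note sc = stuck_colours[OF st Nv]
  have v: "v < n" "c v = 0" using st unfolding stuck_def by auto
  have tr: "track c (c x) (c y) v p k" and k: "2 \<le> k" "even k" using ret unfolding returned_def by auto
  have col: "c (p i) = alt (c x) (c y) i" if "0 < i" "i \<le> k" for i using tr that unfolding track_def by auto
  have d: "c x \<noteq> c y" "c z \<noteq> c x" "c z \<noteq> c y" using sc alt_colours(3)[OF sc(1), of 0] alt_colours(3)[OF sc(1), of 1]
    by (auto simp: two_colours_def alt_def)
  have "p (Suc 0) \<in> N (p 0)" "p 0 = v" using tr k unfolding track_def by auto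
  thus p1: "p 1 = x" using Nv col[of 1] k d by (auto simp: alt_def)
  have "p k < n" "v \<in> N (p k)" using tr ret unfolding track_def returned_def by auto
  hence "p k \<in> N v" using N_sym v by auto
  thus pk: "p k = y" using Nv col[of k] k d by (auto simp: alt_def)
  have c': "c' (p i) = alt (c x) (c y) (Suc i)" if "0 < i" "i \<le> k" for i using ret that unfolding returned_def by auto
  show x: "c' x = c y" using c'[of 1] p1 k by (auto simp: alt_def)
  show y: "c' y = c x" using c'[of k] pk k by (auto simp: alt_def)
  have "z \<notin> p ` {..k}"
  proof
    assume "z \<in> p ` {..k}"
    then obtain i where i: "i \<le> k" "z = p i" by auto
    have "c z \<noteq> 0" using sc two_colours_def alt_colours(5) by metis
    hence "i \<noteq> 0" using i \<open>p 0 = v\<close> v by (cases "i = 0") auto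
    thus False using col[of i] i d by (auto simp: alt_def split: if_splits)
  qed
  thus z: "c' z = c z" using ret unfolding returned_def by auto
  have "c ` N v = c' ` N v" using Nv x y z by auto
  thus "stuck c' v" using st ret unfolding stuck_def returned_def by auto
qed

text \<open>
  A walk that returns to \<open>v\<close> swaps two colours along a Kempe chain between two neighbours of \<open>v\<close>.
  After the first three swaps, the second vertex \<open>w\<close> of the first path has two neighbours of the
  same colour besides \<open>x\<close>, so the fourth walk, which enters \<open>w\<close> from \<open>x\<close>, ends there.
\<close>

lemma four_walks:
  assumes st: "stuck c\<^sub>0 v" and Nv: "N v = {x, y, z}" and nadj: "y \<notin> N x"
    and r1: "returned c\<^sub>0 (c\<^sub>0 x) (c\<^sub>0 y) v r k c\<^sub>1"
    and r2: "returned c\<^sub>1 (c\<^sub>1 x) (c\<^sub>1 z) v p l c\<^sub>2"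
    and r3: "returned c\<^sub>2 (c\<^sub>2 y) (c\<^sub>2 z) v q m c\<^sub>3"
    and r4: "returned c\<^sub>3 (c\<^sub>3 x) (c\<^sub>3 y) v s e c\<^sub>4"
  shows False
proof -
  define X Y Z where XYZ: "X = c\<^sub>0 x" "Y = c\<^sub>0 y" "Z = c\<^sub>0 z"
  have Nv2: "N v = {x, z, y}" and Nv3: "N v = {y, z, x}" using Nv by auto
  have v: "v < n" using st unfolding stuck_def by auto
  have xn: "x < n" "y < n" "z < n" using N_ltD[OF v] Nv by auto
  have vx: "v \<in> N x" "v \<in> N y" "v \<in> N z" using N_sym[OF xn(1) v] N_sym[OF xn(2) v] N_sym[OF xn(3) v] Nv by auto
  note S0 = stuck_colours[OF st Nv]
  have Nv4: "N v = {y, z, x}" "N v = {x, z, y}" using Nv by auto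
  note S1 = stuck_colours[OF st Nv4(1)] and S2 = stuck_colours[OF st Nv4(2)]
  have tXY: "two_colours X Y" and tYZ: "two_colours Y Z" and tXZ: "two_colours X Z"
    and gXY: "6 - X - Y = Z" and gYZ: "6 - Y - Z = X"
    using S0(1,2) S1(1,2) S2(1,2) XYZ by simp_all
  have d: "X \<noteq> Y" "X \<noteq> Z" "Y \<noteq> Z" using tXY tYZ tXZ unfolding two_colours_def by blast+
  have "{X, Y, Z} \<subseteq> {1, 2, 3}" using tXY tYZ unfolding two_colours_def by blast
  hence d0: "X \<noteq> 0" "Y \<noteq> 0" "Z \<noteq> 0" by auto
  note d = d d0
  note E1 = returned_ends[OF st Nv r1]
  note st1 = E1(6)
  note E2 = returned_ends[OF st1 Nv2 r2]
  note st2 = E2(6)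
  note E3 = returned_ends[OF st2 Nv3 r3]
  note st3 = E3(6)
  note E4 = returned_ends[OF st3 Nv r4]
  have C1: "c\<^sub>1 x = Y" "c\<^sub>1 y = X" "c\<^sub>1 z = Z" using E1 XYZ by auto
  have C2: "c\<^sub>2 x = Z" "c\<^sub>2 z = Y" "c\<^sub>2 y = X" using E2 C1 by auto
  have C3: "c\<^sub>3 y = Y" "c\<^sub>3 z = X" "c\<^sub>3 x = Z" using E3 C2 by auto
  have v0: "c\<^sub>0 v = 0" "c\<^sub>1 v = 0" "c\<^sub>2 v = 0" "c\<^sub>3 v = 0" using st st1 st2 st3 unfolding stuck_def by auto
  have R: "returned c\<^sub>0 X Y v r k c\<^sub>1" using r1 XYZ by simp
  have P: "returned c\<^sub>1 Y Z v p l c\<^sub>2" using r2 C1 by simp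
  have Q: "returned c\<^sub>2 X Y v q m c\<^sub>3" using r3 C2 by simp
  have S: "returned c\<^sub>3 Z Y v s e c\<^sub>4" using r4 C3 by simp
  have rk: "2 \<le> k" "even k" "r 0 = v" "r 1 = x" "r k = y" and injr: "inj_on r {..k}"
    using R E1 unfolding returned_def track_def by auto
  have rN: "r (Suc i) \<in> N (r i)" if "i < k" for i using R that unfolding returned_def track_def by auto
  have rn: "r i < n" if "i \<le> k" for i using R that unfolding returned_def track_def by auto
  have rc1: "c\<^sub>1 (r i) = alt X Y (Suc i)" if "0 < i" "i \<le> k" for i using R that unfolding returned_def by auto
  have r_eq: "r i = r j \<longleftrightarrow> i = j" if "i \<le> k" "j \<le> k" for i j using inj_on_eq_iff[OF injr] that by auto
  \<comment> \<open>Here nonadjacency enters: for \<open>k = 2\<close> the chain would be the edge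
    between \<open>x\<close> and \<open>y\<close>.\<close>
  have "k \<noteq> 2" using rN[of 1] rk nadj by (auto simp: numeral_2_eq_2)
  hence k4: "4 \<le> k" using rk by (cases "k = 3") auto
  have p0: "p 0 = v" and pc1: "\<And>i. 0 < i \<Longrightarrow> i \<le> l \<Longrightarrow> c\<^sub>1 (p i) = alt Y Z i" and pl: "p (Suc l) = v"
    using P unfolding returned_def track_def by auto
  have c2o: "\<And>u. u \<notin> p ` {..l} \<Longrightarrow> c\<^sub>2 u = c\<^sub>1 u" using P unfolding returned_def by auto
  \<comment> \<open>the second path meets the first one only in \<open>x\<close>\<close>
  have rp: "r j \<notin> p ` {..l}" if j: "2 \<le> j" "j \<le> k" for j
  proof
    assume "r j \<in> p ` {..l}"
    then obtain i where i: "i \<le> l" "r j = p i" by auto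
    have "r j \<noteq> v" using r_eq[of j 0] rk j by auto
    hence i0: "0 < i" using i p0 by (cases "i = 0") auto
    have "alt X Y (Suc j) = alt Y Z i" using rc1[of j] pc1[OF i0 i(1)] i j by auto
    \<comment> \<open>The colour pairs of the two paths have only Y in common, which fixes the
      parity of \<open>j\<close>.\<close>
    hence oj: "odd j" using d by (auto simp: alt_def split: if_splits)
    hence jk: "j < k" using j rk by (cases "j = k") auto
    obtain g where g: "N (p i) = {p (i - 1), p (Suc i), g}"
      using returned_nbrs[OF tYZ P v0(2) i0 i(1)] by metis
    have b: "u \<noteq> p (i - 1) \<and> u \<noteq> p (Suc i)" if u: "c\<^sub>1 u = X" for u
    proof -
      have "c\<^sub>1 (p (i - 1)) \<noteq> X" using pc1[of "i-1"] i p0 v0 d by (cases "i - 1 = 0") (auto simp: alt_def)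
      moreover have "c\<^sub>1 (p (Suc i)) \<noteq> X" using pc1[of "Suc i"] i pl v0 d by (cases "i = l") (auto simp: alt_def)
      ultimately show ?thesis using u by auto
    qed
    have "r (Suc j) \<in> N (r j)" using rN jk by auto
    moreover have "r (Suc (j - 1)) \<in> N (r (j - 1))" by (rule rN) (use jk in auto)
    hence "r (j - 1) \<in> N (r j)" using N_sym[OF rn[of j] rn[of "j-1"]] j by auto
    moreover have "c\<^sub>1 (r (Suc j)) = X" using rc1[of "Suc j"] jk oj by (auto simp: alt_def)
    moreover have "c\<^sub>1 (r (j - 1)) = X" using rc1[of "j-1"] j jk oj by (auto simp: alt_def)
    \<comment> \<open>Both neighbours of \<open>r j\<close> on the first path have colour X, but the
      second path uses up two edges of \<open>r j\<close> and leaves only \<open>g\<close> for this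
      colour.\<close>
    ultimately have "r (Suc j) = g" "r (j - 1) = g" using g i b by auto
    hence "Suc j = j - 1" by (subst r_eq[symmetric]) (use jk in auto)
    thus False by simp
  qed
  have rc2: "c\<^sub>2 (r j) = alt X Y (Suc j)" if "2 \<le> j" "j \<le> k" for j using rp c2o rc1 that by auto
  have qm: "2 \<le> m" "even m" "q 0 = v" "q 1 = y" "q m = z" "q (Suc m) = v" and injq: "inj_on q {..m}"
    using Q E3 unfolding returned_def track_def by auto
  have qc2: "c\<^sub>2 (q i) = alt X Y i" if "0 < i" "i \<le> m" for i using Q that unfolding returned_def track_def by auto
  have qc3: "c\<^sub>3 (q i) = alt X Y (Suc i)" if "0 < i" "i \<le> m" for i using Q that unfolding returned_def by auto
  have rz: "r j \<noteq> z" if "j \<le> k" "0 < j" for j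
    using rc1[of j] that C1 d by (auto simp: alt_def split: if_splits)
  \<comment> \<open>so the third walk runs back along the first path\<close>
  have qr: "i \<le> m \<and> q i = r (k + 1 - i)" if "0 < i" "i < k" for i
    using that
  proof (induction i rule: less_induct)
    case (less i)
    show ?case
    proof (cases "i = 1")
      case True
      thus ?thesis using qm rk by simp
    next
      case False
      define h where "h = i - 1"
      have h: "i = Suc h" "0 < h" "h < k" "Suc h < k" using False less.prems by (auto simp: h_def)
      have IH: "h \<le> m" "q h = r (k + 1 - h)" using less.IH[of h] h by auto
      have "r (k + 1 - h) \<noteq> z" by (rule rz) (use h in auto)
      hence "h \<noteq> m" using IH qm by auto
      hence im: "h < m" using IH by auto
      obtain g where g: "N (q h) = {q (h - 1), q (Suc h), g}" "c\<^sub>2 g = 6 - X - Y"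
        using returned_nbrs[OF tXY Q v0(3), of h] h im by auto
      have "r (Suc (k - h)) \<in> N (r (k - h))" using rN[of "k - h"] h by auto
      hence "r (k - h) \<in> N (r (Suc (k - h)))"
        by (rule N_sym[OF rn rn, rotated 2]) (use h in auto)
      hence m: "r (k - h) \<in> N (q h)" using IH h by (auto simp: Suc_diff_le)
      have "c\<^sub>2 (r (k - h)) = alt X Y (Suc (k - h))" by (rule rc2) (use h in auto)
      hence "r (k - h) \<noteq> g" using g alt_colours(3)[OF tXY, of "Suc (k - h)"] by auto
      moreover have "r (k - h) \<noteq> q (h - 1)"
      proof (cases "h = 1")
        case True
        thus ?thesis using qm r_eq[of "k-h" 0] rk k4 by auto
      next
        case F: False
        hence "q (h - 1) = r (k + 1 - (h - 1))" using less.IH[of "h - 1"] h by simp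
        moreover have "r (k - h) \<noteq> r (k + 1 - (h - 1))" using h F by (subst r_eq) auto
        ultimately show ?thesis by simp
      qed
      ultimately have "q (Suc h) = r (k - h)" using g m by auto
      thus ?thesis using im h by auto
    qed
  qed
  \<comment> \<open>The second swap gave \<open>x\<close> the colour Z, so the third walk cannot
    continue from \<open>r 2\<close> to \<open>x\<close> and turns off there. This determines all
    three neighbours of \<open>w\<close>.\<close>
  define w where "w = r 2"
  have qw: "q (k - 1) = w" "k - 1 \<le> m" using qr[of "k-1"] k4 by (auto simp: w_def numeral_2_eq_2 Suc_diff_le)
  have "w \<noteq> z" unfolding w_def using rz k4 by auto
  hence km: "k - 1 < m" using qw qm by (cases "k - 1 = m") auto
  obtain g where g: "N w = {q (k - 2), q k, g}" "c\<^sub>2 g = 6 - X - Y"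
    using returned_nbrs[OF tXY Q v0(3), of "k-1"] k4 km qw by (auto simp: numeral_2_eq_2)
  have wn: "w < n" unfolding w_def using rn k4 by auto
  have wx: "w \<in> N x" using rN[of 1] rk k4 by (auto simp: w_def numeral_2_eq_2)
  hence xw: "x \<in> N w" using N_sym[OF wn xn(1)] by auto
  have "x \<noteq> q (k - 2)" "x \<noteq> q k"
    using qc2[of "k-2"] qc2[of k] km k4 C2 d by (auto simp: alt_def split: if_splits)
  hence Nw: "N w = {q (k - 2), q k, x}" using xw g by auto
  have q3: "c\<^sub>3 (q (k - 2)) = X" "c\<^sub>3 (q k) = X" "c\<^sub>3 w = Y"
    using qc3[of "k-2"] qc3[of k] qc3[of "k-1"] qw km k4 rk by (auto simp: alt_def)
  have se: "2 \<le> e" "s 0 = v" "s 1 = x" "s e = y" and injs: "inj_on s {..e}"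
    using S E4 unfolding returned_def track_def by auto
  have sc3: "c\<^sub>3 (s i) = alt Z Y i" if "0 < i" "i \<le> e" for i
    using S that unfolding returned_def track_def by auto
  have tZY: "two_colours Z Y" using tYZ by (auto simp: two_colours_def)
  obtain g' where g': "N (s 1) = {s 0, s (Suc 1), g'}" "c\<^sub>3 g' = 6 - Z - Y"
    using returned_nbrs[OF tZY S v0(4), of 1] se by auto
  have "w \<noteq> v" unfolding w_def using r_eq[of 2 0] k4 rk by auto
  moreover have "w \<noteq> g'" using q3 g' gYZ d by auto
  \<comment> \<open>The neighbours of \<open>x\<close> are the uncoloured \<open>v\<close>, the
    vertex \<open>g'\<close> of colour X and the next vertex of the fourth path. As \<open>w\<close>
    has colour Y, it must be the latter.\<close>
  ultimately have s2: "s 2 = w" using wx g' se by (auto simp: numeral_2_eq_2)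
  have "w \<noteq> y" unfolding w_def using r_eq[of 2 k] k4 rk by auto
  hence "2 < e" using s2 se by (cases "e = 2") auto
  have sN: "\<forall>i<e. s (Suc i) \<in> N (s i)" using S unfolding returned_def track_def by auto
  have "s 3 \<in> N w" using spec[OF sN, of 2] s2 \<open>2 < e\<close> by simp
  moreover have "c\<^sub>3 (s 3) = Z" using sc3[of 3] \<open>2 < e\<close> by (simp add: alt_def)
  moreover have "s 3 \<noteq> x" using inj_on_eq_iff[OF injs, of 3 1] se \<open>2 < e\<close> by auto
  ultimately show False using Nw q3 d by auto
qed

section \<open>Colour classes\<close>

definition colouring :: "(nat \<Rightarrow> nat) \<Rightarrow> bool" where
  "colouring c \<longleftrightarrow> (\<forall>u<n. c u \<in> {1, 2, 3} \<and> c u \<notin> c ` N u)"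

definition num :: "(nat \<Rightarrow> nat) \<Rightarrow> nat set \<Rightarrow> nat \<Rightarrow> nat" where
  "num c S j = card {x \<in> S. c x = j}"

text \<open>Ordered pairs are counted: inside the vertex set this is the number of edges between
  \<open>X\<close> and \<open>Y\<close> if they are disjoint, and \<open>arcs X X\<close> is twice
  the number of edges within \<open>X\<close>.\<close>

definition arcs :: "nat set \<Rightarrow> nat set \<Rightarrow> nat" where
  "arcs X Y = card {(u, w). u \<in> X \<and> w \<in> Y \<and> w \<in> N u}"

lemma colouring_neq: "colouring c \<Longrightarrow> u < n \<Longrightarrow> w \<in> N u \<Longrightarrow> c w \<noteq> c u"
  unfolding colouring_def by (metis imageI)

lemma colouring_cases: "colouring c \<Longrightarrow> u < n \<Longrightarrow> c u = 1 \<or> c u = 2 \<or> c u = 3"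
  unfolding colouring_def by blast

lemma num_Un: "finite S \<Longrightarrow> finite T \<Longrightarrow> S \<inter> T = {} \<Longrightarrow> num c (S \<union> T) j = num c S j + num c T j"
  unfolding num_def by (subst card_Un_disjoint[symmetric]) (auto intro: arg_cong[where f = card])

lemma num_split: "finite S \<Longrightarrow> K \<subseteq> S \<Longrightarrow> num c S j = num c K j + num c (S - K) j"
  by (subst num_Un[symmetric]) (auto simp: finite_subset Un_absorb1)

lemma num_cong: "(\<And>x. x \<in> S \<Longrightarrow> c x = c' x) \<Longrightarrow> num c S j = num c' S j"
  unfolding num_def by (rule arg_cong[where f = card]) auto

lemma arcs_eq_sum:
  assumes "finite X" "finite Y"
  shows "arcs X Y = (\<Sum>u\<in>X. card (N u \<inter> Y))"
proof -
  have "{(u, w). u \<in> X \<and> w \<in> Y \<and> w \<in> N u} = Sigma X (\<lambda>u. N u \<inter> Y)" by auto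
  thus ?thesis unfolding arcs_def using assms by (simp add: card_SigmaI)
qed

lemma arcs_sym:
  assumes "X \<subseteq> {..<n}" "Y \<subseteq> {..<n}"
  shows "arcs X Y = arcs Y X"
  unfolding arcs_def
proof (rule bij_betw_same_card)
  show "bij_betw prod.swap {(u, w). u \<in> X \<and> w \<in> Y \<and> w \<in> N u} {(u, w). u \<in> Y \<and> w \<in> X \<and> w \<in> N u}"
    by (rule bij_betw_byWitness[where f' = prod.swap]) (use assms N_sym subsetD[OF assms(1)] subsetD[OF assms(2)] in fastforce)+
qed

lemma arcs_Un:
  assumes "finite X" "finite Y" "finite Z" "Y \<inter> Z = {}"
  shows "arcs X (Y \<union> Z) = arcs X Y + arcs X Z"
proof -
  have "card (N u \<inter> (Y \<union> Z)) = card (N u \<inter> Y) + card (N u \<inter> Z)" for u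
    by (subst card_Un_disjoint[symmetric]) (use assms in \<open>auto simp: Int_Un_distrib\<close>)
  thus ?thesis using assms by (simp add: arcs_eq_sum sum.distrib)
qed

lemma arcs_full:
  assumes "X \<subseteq> {..<n}" "\<And>u. u \<in> X \<Longrightarrow> N u \<subseteq> Y" "finite Y"
  shows "arcs X Y = 3 * card X"
proof -
  have "finite X" using assms finite_subset by blast
  have "card (N u \<inter> Y) = 3" if "u \<in> X" for u
    using assms that N_card[of u] by (auto simp: Int_absorb2)
  thus ?thesis using assms \<open>finite X\<close> by (simp add: arcs_eq_sum)
qed

lemma arcs_ge:
  assumes "finite X" "finite Y" "\<And>u. u \<in> X \<Longrightarrow> k \<le> card (N u \<inter> Y)"
  shows "k * card X \<le> arcs X Y"
  using sum_mono[of X "\<lambda>_. k" "\<lambda>u. card (N u \<inter> Y)"] assms by (simp add: arcs_eq_sum mult.commute)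

lemma arcs_le:
  assumes "finite X" "finite Y" "\<And>u. u \<in> X \<Longrightarrow> card (N u \<inter> Y) \<le> k"
  shows "arcs X Y \<le> k * card X"
  using sum_mono[of X "\<lambda>u. card (N u \<inter> Y)" "\<lambda>_. k"] assms by (simp add: arcs_eq_sum mult.commute)

abbreviation col_class :: "(nat \<Rightarrow> nat) \<Rightarrow> nat \<Rightarrow> nat set" where
  "col_class c j \<equiv> {x \<in> {..<n}. c x = j}"

lemma colouring_arcs:
  assumes col: "colouring c" and ijk: "{i, j, k} = {1, 2, 3}" "i \<noteq> j" "i \<noteq> k" "j \<noteq> k"
  shows "arcs (col_class c i) (col_class c j) + arcs (col_class c i) (col_class c k) = 3 * num c {..<n} i"
proof -
  have "arcs (col_class c i) (col_class c j \<union> col_class c k) = 3 * card (col_class c i)"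
  proof (rule arcs_full)
    fix u assume u: "u \<in> col_class c i"
    show "N u \<subseteq> col_class c j \<union> col_class c k"
    proof
      fix w assume w: "w \<in> N u"
      have "w < n" using N_ltD u w by auto
      moreover have "c w \<noteq> i" using colouring_neq[OF col _ w] u by auto
      moreover have "c w \<in> {i, j, k}" using colouring_cases[OF col \<open>w < n\<close>] ijk(1) by auto
      ultimately show "w \<in> col_class c j \<union> col_class c k" by auto
    qed
  qed auto
  thus ?thesis using ijk by (subst (asm) arcs_Un) (auto simp: num_def)
qed

lemma colouring_balance:
  assumes "colouring c"
  shows "3 * num c {..<n} 2 + 3 * num c {..<n} 3 = 3 * num c {..<n} 1 + 2 * arcs (col_class c 2) (col_class c 3)"
    "num c {..<n} 1 + num c {..<n} 2 + num c {..<n} 3 = n"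
proof -
  have "arcs (col_class c 1) (col_class c 2) + arcs (col_class c 1) (col_class c 3) = 3 * num c {..<n} 1"
    "arcs (col_class c 2) (col_class c 1) + arcs (col_class c 2) (col_class c 3) = 3 * num c {..<n} 2"
    "arcs (col_class c 3) (col_class c 1) + arcs (col_class c 3) (col_class c 2) = 3 * num c {..<n} 3"
    by (rule colouring_arcs[OF assms]; auto)+
  moreover have sym: "arcs (col_class c i) (col_class c j) = arcs (col_class c j) (col_class c i)" for i j
    by (rule arcs_sym) auto
  note sym[of 2 1] sym[of 3 1] sym[of 3 2]
  ultimately show "3 * num c {..<n} 2 + 3 * num c {..<n} 3 = 3 * num c {..<n} 1 + 2 * arcs (col_class c 2) (col_class c 3)"
    by linarith
  have "{..<n} = col_class c 1 \<union> col_class c 2 \<union> col_class c 3"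
    using colouring_cases[OF assms] by auto
  hence "card {..<n} = card (col_class c 1 \<union> col_class c 2 \<union> col_class c 3)" by (rule arg_cong)
  also have "\<dots> = num c {..<n} 1 + num c {..<n} 2 + num c {..<n} 3"
    unfolding num_def by (subst card_Un_disjoint; (subst card_Un_disjoint)?) auto
  finally show "num c {..<n} 1 + num c {..<n} 2 + num c {..<n} 3 = n" by simp
qed

lemma class1_bound:
  assumes col: "colouring c"
    and nonbip: "\<not> (\<exists>f :: nat \<Rightarrow> bool. \<forall>u<n. \<forall>w\<in>N u. f u \<noteq> f w)"
  shows "num c {..<n} 1 + 2 \<le> num c {..<n} 2 + num c {..<n} 3"
proof -
  have "arcs (col_class c 2) (col_class c 3) \<noteq> 0"
  proof
    assume "arcs (col_class c 2) (col_class c 3) = 0"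
    hence e: "{(u, w). u \<in> col_class c 2 \<and> w \<in> col_class c 3 \<and> w \<in> N u} = {}"
      unfolding arcs_def
      by (subst (asm) card_0_eq)
        (auto intro: finite_subset[of _ "{..<n} \<times> {..<n}"])
    \<comment> \<open>Without edges between classes 2 and 3, class 1 and its complement would be a
      bipartition.\<close>
    have key: "(c u = 1) \<noteq> (c w = 1)" if "u < n" "w \<in> N u" for u w
    proof -
      have w: "w < n" using that N_ltD by blast
      have w: "w < n" "u \<in> N w" using w N_sym[OF w that(1) that(2)] by auto
      have "c u = 1 \<or> c u = 2 \<or> c u = 3" "c w = 1 \<or> c w = 2 \<or> c w = 3" "c w \<noteq> c u"
        using colouring_cases[OF col] colouring_neq[OF col] that w by blast+
      moreover have "\<not> (c u = 2 \<and> c w = 3)" "\<not> (c w = 2 \<and> c u = 3)" using e that w by auto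
      ultimately show ?thesis by auto
    qed
    have "\<exists>f :: nat \<Rightarrow> bool. \<forall>u<n. \<forall>w\<in>N u. f u \<noteq> f w"
      by (intro exI[of _ "\<lambda>x. c x = 1"] allI impI ballI key)
    thus False using nonbip by contradiction
  qed
  \<comment> \<open>Three times the excess of the two classes over class 1 is positive and even,
    hence the excess is at least 2.\<close>
  thus ?thesis using colouring_balance(1)[OF col] by presburger
qed

text \<open>In a colouring such a vertex is an isolated vertex of the graph induced by classes 2 and
  3, so it may switch between these two colours at will.\<close>

definition free :: "(nat \<Rightarrow> nat) \<Rightarrow> nat \<Rightarrow> bool" where
  "free c u \<longleftrightarrow> (\<forall>w\<in>N u. c w = 1)"

definition movable :: "(nat \<Rightarrow> nat) \<Rightarrow> nat \<Rightarrow> bool" where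
  "movable c x \<longleftrightarrow> c x = 1 \<and> (\<exists>p\<in>N x. \<exists>q\<in>N x. p \<noteq> q \<and> free c p \<and> free c q)"

text \<open>Let a be the size of class 1 and f the number of free vertices. If nothing is movable,
  each vertex of class 1 has at most one free neighbour, so 3 f \<le> a. The other classes span 3 (n
  - a) - 3 a arcs among themselves, and each of their vertices that is not free has one, so n - a -
  f \<le> 3 n - 6 a. Together 7 a \<le> 3 n, and 3/7 is less than 4/9.\<close>

lemma movable_exists:
  assumes col: "colouring c" and big: "4 * n < 9 * num c {..<n} 1"
  shows "\<exists>x<n. movable c x"
proof (rule ccontr)
  assume no: "\<not> (\<exists>x<n. movable c x)"
  define A B F where "A = col_class c 1" and "B = col_class c 2 \<union> col_class c 3" and "F = {u \<in> {..<n}. free c u}"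
  have fin: "finite A" "finite B" "finite F" and sub: "A \<subseteq> {..<n}" "B \<subseteq> {..<n}" "F \<subseteq> {..<n}"
    by (auto simp: A_def B_def F_def)
  have AB: "A \<inter> B = {}" "A \<union> B = {..<n}" using colouring_cases[OF col] by (auto simp: A_def B_def)
  have cA: "card A = num c {..<n} 1" by (simp add: A_def num_def)
  have cAB: "card A + card B = n"
    using card_Un_disjoint[of A B] fin AB by simp
  have FB: "F \<subseteq> B"
  proof
    fix u assume "u \<in> F"
    hence u: "u < n" "free c u" by (auto simp: F_def)
    have "nb u 0 \<in> N u" by (simp add: N_def)
    hence "c u \<noteq> 1" using colouring_neq[OF col] u unfolding free_def by metis
    thus "u \<in> B" using u AB by (auto simp: A_def)
  qed
  have "3 * card F = arcs F A"
    by (rule arcs_full[symmetric]) (use sub fin N_ltD in \<open>auto simp: F_def A_def free_def\<close>)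
  also have "\<dots> = arcs A F" using arcs_sym sub by blast
  also have "\<dots> \<le> 1 * card A"
  proof (rule arcs_le)
    fix x assume x: "x \<in> A"
    hence "\<not> movable c x" "c x = 1" using no by (auto simp: A_def)
    hence "p = q" if "p \<in> N x \<inter> F" "q \<in> N x \<inter> F" for p q
      using that by (auto simp: movable_def F_def)
    thus "card (N x \<inter> F) \<le> 1" by (intro card_le_Suc0_iff_eq[THEN iffD2, folded One_nat_def]) auto
  qed (use fin in auto)
  finally have 1: "3 * card F \<le> card A" by simp
  have "1 * card (B - F) \<le> arcs (B - F) B"
  proof (rule arcs_ge)
    fix u assume u: "u \<in> B - F"
    hence "\<not> free c u" "u < n" using sub by (auto simp: F_def)
    then obtain w where w: "w \<in> N u" "c w \<noteq> 1" by (auto simp: free_def)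
    hence "w \<in> N u \<inter> B" using AB N_ltD \<open>u < n\<close> by (auto simp: A_def)
    hence "0 < card (N u \<inter> B)" using fin by (subst card_gt_0_iff) auto
    thus "1 \<le> card (N u \<inter> B)" by linarith
  qed (use fin in auto)
  also have "\<dots> \<le> arcs B B"
    unfolding arcs_def by (rule card_mono) (use fin in \<open>auto intro: finite_subset[of _ "B \<times> B"]\<close>)
  finally have 2: "card B \<le> card F + arcs B B" using card_Diff_subset[of F B] FB fin by auto
  have "arcs B A + arcs B B = 3 * card B"
  proof -
    have "arcs B (A \<union> B) = 3 * card B" by (rule arcs_full) (use sub fin AB N_less[OF subsetD[OF sub(2), simplified lessThan_iff]] in auto)
    thus ?thesis using arcs_Un[of B A B] AB fin by simp
  qed
  moreover have "arcs A B = 3 * card A"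
  proof (rule arcs_full)
    fix u assume u: "u \<in> A"
    show "N u \<subseteq> B"
    proof
      fix w assume w: "w \<in> N u"
      have "w < n" using N_ltD u w sub by auto
      moreover have "c w \<noteq> 1" using colouring_neq[OF col _ w] u by (auto simp: A_def)
      ultimately show "w \<in> B" using AB by (auto simp: A_def)
    qed
  qed (use fin sub in auto)
  moreover have "arcs A B = arcs B A" using arcs_sym sub by blast
  ultimately show False using 1 2 big cAB cA by linarith
qed

text \<open>Every vertex of class \<open>j\<close> has a neighbour in class \<open>k\<close>, so the
  size of class \<open>j\<close> is at most the number of edges between the two classes. Twice that
  number is 3 (n - 2 a), where a is the size of class 1.\<close>

lemma unmixed_bound:
  assumes col: "colouring c" and j: "{j, k} = {2, 3}"
    and nofree: "\<And>u. u < n \<Longrightarrow> free c u \<Longrightarrow> c u \<noteq> j"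
  shows "2 * num c {..<n} j + 6 * num c {..<n} 1 \<le> 3 * n"
proof -
  have jk: "j \<noteq> k" using j by auto
  have "1 * card (col_class c j) \<le> arcs (col_class c j) (col_class c k)"
  proof (rule arcs_ge)
    fix u assume u: "u \<in> col_class c j"
    hence "\<not> free c u" "u < n" using nofree by auto
    then obtain w where w: "w \<in> N u" "c w \<noteq> 1" by (auto simp: free_def)
    hence wn: "w < n" using N_ltD \<open>u < n\<close> by auto
    have "c w \<in> {j, k}" using w j colouring_cases[OF col wn] by auto
    moreover have "c w \<noteq> c u" using colouring_neq[OF col _ w(1)] u by auto
    ultimately have "w \<in> N u \<inter> col_class c k" using w wn u by auto
    hence "0 < card (N u \<inter> col_class c k)" by (subst card_gt_0_iff) auto
    thus "1 \<le> card (N u \<inter> col_class c k)" by linarith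
  qed auto
  moreover have "arcs (col_class c 2) (col_class c 3) = arcs (col_class c 3) (col_class c 2)" by (rule arcs_sym) auto
  moreover have "j = 2 \<and> k = 3 \<or> j = 3 \<and> k = 2" using j by (auto simp: doubleton_eq_iff)
  ultimately have "num c {..<n} j \<le> arcs (col_class c 2) (col_class c 3)" by (auto simp: num_def)
  moreover have "2 * x + 6 * a \<le> 3 * n" if "x \<le> d" "3 * b + 3 * b' = 3 * a + 2 * d" "a + b + b' = n"
    for x a b b' d :: nat using that by linarith
  ultimately show ?thesis using colouring_balance[OF col] by blast
qed

text \<open>The free vertices \<open>p\<close> and \<open>q\<close> join the colour of
  \<open>r\<close>, so \<open>x\<close> sees a single colour and takes the other one of 2 and 3,
  which sum to 5. Since class 1 only loses a vertex, no vertex becomes free; a later move can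
  therefore not revive a vertex that was passed over.\<close>

lemma colouring_move:
  assumes col: "colouring c" and x: "x < n" "c x = 1" and Nx: "N x = {p, q, r}" "p \<noteq> q" "p \<noteq> r" "q \<noteq> r"
    and f: "free c p" "free c q"
    and c': "c' = c(p := c r, q := c r, x := 5 - c r)"
  shows "colouring c'" "col_class c' 1 = col_class c 1 - {x}" "\<And>u. u < n \<Longrightarrow> free c' u \<Longrightarrow> free c u"
proof -
  have lt: "p < n" "q < n" "r < n" using N_ltD x Nx by auto
  have nx: "x \<noteq> p" "x \<noteq> q" "x \<noteq> r" using N_irrefl[OF x(1)] Nx by auto
  have cr: "c r \<in> {2, 3}" using colouring_cases[OF col lt(3)] colouring_neq[OF col x(1), of r] x Nx by auto
  have pq1: "c p \<noteq> 1" "c q \<noteq> 1" using colouring_neq[OF col x(1)] x Nx by auto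
  have one: "c' w = 1 \<longleftrightarrow> c w = 1 \<and> w \<noteq> x" for w using cr pq1 nx by (auto simp: c')
  show "col_class c' 1 = col_class c 1 - {x}" using one by auto
  show "free c u" if "u < n" "free c' u" for u using that one unfolding free_def by auto
  have key: "c' u \<noteq> c' w" if "u < n" "w \<in> N u" "u = x \<or> u = p \<or> u = q" for u w
    using that(3)
  proof (elim disjE)
    assume "u = x"
    hence "w = p \<or> w = q \<or> w = r" using that Nx by auto
    hence "c' w = c r" using nx by (elim disjE) (simp_all add: c')
    moreover have "c' u = 5 - c r" using \<open>u = x\<close> by (simp add: c')
    moreover have "5 - c r \<noteq> c r" using cr by auto
    ultimately show ?thesis by simp
  next
    assume u: "u = p"
    hence "c w = 1" using f that by (auto simp: free_def)
    hence "w \<noteq> p" "w \<noteq> q" using pq1 by auto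
    hence "c' w = 1 \<or> c' w = 5 - c r" using \<open>c w = 1\<close> by (simp add: c')
    moreover have "c' u = c r" using u nx by (simp add: c')
    moreover have "5 - c r \<noteq> c r" "c r \<noteq> 1" using cr by auto
    ultimately show ?thesis by metis
  next
    assume u: "u = q"
    hence "c w = 1" using f that by (auto simp: free_def)
    hence "w \<noteq> p" "w \<noteq> q" using pq1 by auto
    hence "c' w = 1 \<or> c' w = 5 - c r" using \<open>c w = 1\<close> by (simp add: c')
    moreover have "c' u = c r" using u nx by (simp add: c')
    moreover have "5 - c r \<noteq> c r" "c r \<noteq> 1" using cr by auto
    ultimately show ?thesis by metis
  qed
  show "colouring c'"
    unfolding colouring_def
  proof (intro allI impI conjI)
    fix u assume u: "u < n"
    show "c' u \<in> {1, 2, 3}" using cr colouring_cases[OF col u] by (auto simp: c')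
    show "c' u \<notin> c' ` N u"
    proof
      assume "c' u \<in> c' ` N u"
      then obtain w where w: "w \<in> N u" "c' w = c' u" by auto
      have wn: "w < n" using w u N_ltD by blast
      have wn: "w < n" "u \<in> N w" using wn N_sym[OF wn u] N_sym[OF u wn] w by blast+
      show False
      proof (cases "u = x \<or> u = p \<or> u = q \<or> w = x \<or> w = p \<or> w = q")
        case True
        thus False using key[of u w] key[of w u] u w wn by metis
      next
        case False
        hence "c w = c u" using w by (simp add: c')
        thus False using colouring_neq[OF col u] w by auto
      qed
    qed
  qed
qed

lemma colouring_upd:
  assumes col: "colouring c" and u: "u < n" and j: "j \<in> {1, 2, 3}" "j \<notin> c ` N u"
  shows "colouring (c(u := j))"
  unfolding colouring_def
proof (intro allI impI conjI)
  fix w assume w: "w < n"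
  show "(c(u := j)) w \<in> {1, 2, 3}" using colouring_cases[OF col w] j by auto
  show "(c(u := j)) w \<notin> c(u := j) ` N w"
  proof
    assume "(c(u := j)) w \<in> c(u := j) ` N w"
    then obtain x where x: "x \<in> N w" "(c(u := j)) x = (c(u := j)) w" by auto
    have "x < n" using x(1) w N_ltD by blast
    hence "x < n" "w \<in> N x" "x \<noteq> w" using x w N_sym N_irrefl by blast+
    thus False using x w j colouring_neq[OF col w x(1)] by (auto split: if_splits)
  qed
qed

text \<open>Being free depends on class 1 alone, and a free vertex lies outside it.\<close>

lemma colouring_free_upd:
  assumes col: "colouring c" and u: "u < n" "free c u" and j: "j \<in> {2, 3}"
  shows "colouring (c(u := j))" "col_class (c(u := j)) 1 = col_class c 1" "free (c(u := j)) w = free c w" "c u \<noteq> 1"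
proof -
  have "nb u 0 \<in> N u" by (simp add: N_def)
  thus c1: "c u \<noteq> 1" using colouring_neq[OF col] u unfolding free_def by metis
  have "j \<notin> c ` N u" using u(2) j unfolding free_def by (auto simp: image_iff)
  thus "colouring (c(u := j))" using colouring_upd[OF col u(1), of j] j by auto
  show "col_class (c(u := j)) 1 = col_class c 1" using c1 j by auto
  have "(c(u := j)) x = 1 \<longleftrightarrow> c x = 1" for x using c1 j by auto
  thus "free (c(u := j)) w = free c w" unfolding free_def by blast
qed

section \<open>Balancing two colour classes\<close>

definition links :: "(nat \<Rightarrow> nat) \<Rightarrow> (nat \<times> nat) set" where
  "links c = {(x, y). x < n \<and> y \<in> N x \<and> c x \<noteq> 1 \<and> c y \<noteq> 1}"

definition comp :: "(nat \<Rightarrow> nat) \<Rightarrow> nat \<Rightarrow> nat set" where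
  "comp c w = (links c)\<^sup>* `` {w}"

text \<open>For a colouring this means that class 1 is a maximal independent set. The other two
  classes then induce a graph of maximum degree 2, a union of paths and cycles.\<close>

definition dominating :: "(nat \<Rightarrow> nat) \<Rightarrow> bool" where
  "dominating c \<longleftrightarrow> (\<forall>u<n. c u \<noteq> 1 \<longrightarrow> 1 \<in> c ` N u)"

lemma links_symD: "(x, y) \<in> links c \<Longrightarrow> (y, x) \<in> links c"
  using N_ltD N_sym unfolding links_def by blast

lemma links_rtrancl_symD: "(x, y) \<in> (links c)\<^sup>* \<Longrightarrow> (y, x) \<in> (links c)\<^sup>*"
  by (rule symD[OF sym_rtrancl]) (auto intro: symI links_symD)

lemma comp_self: "w \<in> comp c w"
  by (simp add: comp_def)

lemma comp_subset:
  assumes "\<And>x y. x \<in> K \<Longrightarrow> (x, y) \<in> links c \<Longrightarrow> y \<in> K" "w \<in> K"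
  shows "comp c w \<subseteq> K"
proof
  fix y assume "y \<in> comp c w"
  hence "(w, y) \<in> (links c)\<^sup>*" by (simp add: comp_def)
  thus "y \<in> K" using assms by (induction) blast+
qed

lemma comp_closed: "x \<in> comp c w \<Longrightarrow> (x, y) \<in> links c \<Longrightarrow> y \<in> comp c w"
  unfolding comp_def by (auto intro: rtrancl_into_rtrancl)

lemma comp_eq:
  assumes "x \<in> comp c w"
  shows "comp c x = comp c w"
proof -
  have 1: "(w, x) \<in> (links c)\<^sup>*" using assms by (simp add: comp_def)
  note 2 = links_rtrancl_symD[OF 1]
  show ?thesis unfolding comp_def using rtrancl_trans[OF 1] rtrancl_trans[OF 2] by auto
qed

lemma comp_lt: "w < n \<Longrightarrow> comp c w \<subseteq> {..<n}"
  by (rule comp_subset) (auto simp: links_def dest: N_ltD)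

lemma links_cong:
  assumes "\<And>x. x < n \<Longrightarrow> (c x = 1) = (c' x = 1)"
  shows "links c = links c'"
  unfolding links_def using assms N_ltD by blast

text \<open>Swapping colours 2 and 3 leaves class 1 alone, so the components are the same throughout
  the balancing.\<close>

lemma comp_cong:
  assumes "\<And>x. x < n \<Longrightarrow> (c x = 1) = (c' x = 1)"
  shows "comp c w = comp c' w"
  using links_cong[OF assms] by (simp add: comp_def)

lemma dominated_nbrs:
  assumes dom: "dominating c" and u: "u < n" "c u \<noteq> 1"
  obtains g x y where "N u = {g, x, y}" "c g = 1"
proof -
  obtain g where g: "g \<in> N u" "c g = 1" using dom u unfolding dominating_def by (metis imageE)
  have "card (N u - {g}) = 2" using N_card[OF u(1)] g by simp
  then obtain x y where "N u - {g} = {x, y}" by (auto simp: card_2_iff)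
  hence "N u = {g, x, y}" using g by auto
  thus thesis using that g by blast
qed

text \<open>
  Components of a graph of maximum degree 2 have a surplus of \<open>\<beta>\<close> only if they are paths with both
  ends coloured \<open>\<beta>\<close>, so it suffices to treat the endpoints of colour \<open>\<beta>\<close>.
\<close>

definition settled :: "(nat \<Rightarrow> nat) \<Rightarrow> nat \<Rightarrow> nat \<Rightarrow> nat \<Rightarrow> bool" where
  "settled c \<alpha> \<beta> i \<longleftrightarrow>
     (\<forall>w<i. c w = \<beta> \<and> endpoint c \<alpha> w \<longrightarrow> num c (comp c w) \<beta> \<le> num c (comp c w) \<alpha>)"

text \<open>If no vertex of colour \<beta> in the component is an endpoint, each of them has two
  neighbours of colour \<alpha>, while a vertex of colour \<alpha> has at most two of colour
  \<beta>; double counting the edges compares the two numbers. Otherwise any such endpoint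
  represents the component in \<open>settled\<close>.\<close>

lemma comp_num_le:
  assumes col: "colouring c" and dom: "dominating c" and ab: "{\<alpha>, \<beta>} = {2, 3}"
    and st: "settled c \<alpha> \<beta> n" and w: "w < n"
  shows "num c (comp c w) \<beta> \<le> num c (comp c w) \<alpha>"
proof (cases "\<exists>e\<in>comp c w. c e = \<beta> \<and> endpoint c \<alpha> e")
  case True
  then obtain e where e: "e \<in> comp c w" "c e = \<beta>" "endpoint c \<alpha> e" by blast
  hence "e < n" using comp_lt[OF w] by auto
  thus ?thesis using st e comp_eq[OF e(1)] unfolding settled_def by metis
next
  case False
  have ab1: "\<alpha> \<noteq> 1" "\<beta> \<noteq> 1" "\<alpha> \<noteq> \<beta>" using ab by (auto simp: doubleton_eq_iff)
  define A B where "A = {x \<in> comp c w. c x = \<alpha>}" and "B = {x \<in> comp c w. c x = \<beta>}"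
  have sub: "A \<subseteq> {..<n}" "B \<subseteq> {..<n}" using comp_lt[OF w] by (auto simp: A_def B_def)
  hence fin: "finite A" "finite B" by (auto intro: finite_subset)
  have "2 * card B \<le> arcs B A"
  proof (rule arcs_ge)
    fix u assume u: "u \<in> B"
    hence un: "u < n" and "\<not> endpoint c \<alpha> u" using sub False by (auto simp: B_def)
    then obtain y z where yz: "y \<in> N u" "z \<in> N u" "c y = \<alpha>" "c z = \<alpha>" "y \<noteq> z"
      by (auto simp: endpoint_def)
    have "(u, y) \<in> links c" "(u, z) \<in> links c" using yz u ab1 un by (auto simp: links_def B_def)
    hence "{y, z} \<subseteq> N u \<inter> A" using comp_closed[of u c w] u yz by (auto simp: A_def B_def)
    hence "card {y, z} \<le> card (N u \<inter> A)" by (intro card_mono) auto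
    thus "2 \<le> card (N u \<inter> A)" using yz by simp
  qed (use fin in auto)
  also have "arcs B A = arcs A B" using arcs_sym sub by blast
  also have "\<dots> \<le> 2 * card A"
  proof (rule arcs_le)
    fix u assume u: "u \<in> A"
    hence un: "u < n" "c u \<noteq> 1" using sub ab1 by (auto simp: A_def)
    obtain g x y where g: "N u = {g, x, y}" "c g = 1" using dominated_nbrs[OF dom un] by blast
    hence "N u \<inter> B \<subseteq> {x, y}" using ab1 by (auto simp: B_def)
    hence "card (N u \<inter> B) \<le> card {x, y}" by (intro card_mono) auto
    also have "\<dots> \<le> 2" by (simp add: card_insert_if)
    finally show "card (N u \<inter> B) \<le> 2" .
  qed (use fin in auto)
  finally show ?thesis by (simp add: A_def B_def num_def)
qed

text \<open>The claim is generalised to all unions of components, so that components can be split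
  off one at a time.\<close>

lemma settled_num_le:
  assumes col: "colouring c" and dom: "dominating c" and ab: "{\<alpha>, \<beta>} = {2, 3}"
    and st: "settled c \<alpha> \<beta> n"
  shows "num c {..<n} \<beta> \<le> num c {..<n} \<alpha>"
proof -
  have "num c S \<beta> \<le> num c S \<alpha>"
    if "S \<subseteq> {..<n}" "\<And>x y. x \<in> S \<Longrightarrow> (x, y) \<in> links c \<Longrightarrow> y \<in> S" for S
    using that
  proof (induction "card S" arbitrary: S rule: less_induct)
    case less
    have fS: "finite S" using less.prems finite_subset by blast
    show ?case
    proof (cases "S = {}")
      case True
      thus ?thesis by (simp add: num_def)
    next
      case False
      then obtain w where w: "w \<in> S" by blast
      have cS: "comp c w \<subseteq> S" by (rule comp_subset) (use less.prems w in auto)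
      have "num c (S - comp c w) \<beta> \<le> num c (S - comp c w) \<alpha>"
      proof (rule less.hyps)
        show "card (S - comp c w) < card S"
          by (rule psubset_card_mono[OF fS]) (use w comp_self in blast)
        show "S - comp c w \<subseteq> {..<n}" using less.prems by auto
        fix x y assume "x \<in> S - comp c w" "(x, y) \<in> links c"
        thus "y \<in> S - comp c w" using less.prems(2) comp_closed links_symD by blast
      qed
      moreover have "num c (comp c w) \<beta> \<le> num c (comp c w) \<alpha>"
        by (rule comp_num_le[OF assms]) (use w less.prems in auto)
      ultimately show ?thesis using num_split[OF fS cS] by (metis add_mono)
    qed
  qed
  thus ?thesis by (auto simp: links_def dest: N_ltD)
qed

definition flipped :: "(nat \<Rightarrow> nat) \<Rightarrow> nat \<Rightarrow> nat \<Rightarrow> (nat \<Rightarrow> nat) \<Rightarrow> nat \<Rightarrow> (nat \<Rightarrow> nat) \<Rightarrow> bool" where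
  "flipped c \<alpha> \<beta> p k c' \<longleftrightarrow> inj_on p {..k} \<and> (\<forall>i\<le>k. p i < n) \<and>
     (\<forall>i\<le>k. c (p i) = alt \<alpha> \<beta> i \<and> c' (p i) = alt \<alpha> \<beta> (Suc i)) \<and>
     (\<forall>u. u \<notin> p ` {..k} \<longrightarrow> c' u = c u) \<and> p ` {..k} = comp c (p 0)"

text \<open>The third colour is 1 here, so an inner vertex of the track has no neighbour of class 2
  or 3 besides its predecessor and successor. With \<open>endpoint\<close> at the start and
  \<open>last\<close> at the other end, the track is closed under \<open>links\<close>, hence a
  whole component.\<close>

lemma flip_path:
  assumes col: "colouring c" and dom: "dominating c" and ab: "{\<alpha>, \<beta>} = {2, 3}"
    and u: "u < n" "c u = \<beta>" "endpoint c \<alpha> u"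
    and tr: "track (c(u := 0)) \<alpha> \<beta> u p k"
    and sh: "shifted (c(u := 0)) \<alpha> \<beta> p k (alt \<alpha> \<beta> (Suc k)) c'"
    and last: "\<And>w. w \<in> N (p k) \<Longrightarrow> c' w \<noteq> alt \<alpha> \<beta> (Suc k)"
  shows "flipped c \<alpha> \<beta> p k c'"
proof -
  have tc: "two_colours \<alpha> \<beta>" and ab1: "\<alpha> \<noteq> 1" "\<beta> \<noteq> 1" and six: "6 - \<alpha> - \<beta> = 1"
    using ab by (auto simp: two_colours_def doubleton_eq_iff)
  note ac = alt_colours[OF tc]
  have p0: "p 0 = u" and inj: "inj_on p {..k}" and lt: "\<And>i. i \<le> k \<Longrightarrow> p i < n"
    and pN: "\<And>i. i < k \<Longrightarrow> p (Suc i) \<in> N (p i)"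
    using tr unfolding track_def by auto
  have pu: "p i \<noteq> u" if "0 < i" "i \<le> k" for i using inj_on_eq_iff[OF inj, of i 0] p0 that by auto
  have cp: "c (p i) = alt \<alpha> \<beta> i" if "i \<le> k" for i
    using tr pu[of i] p0 u that unfolding track_def by (cases "i = 0") (auto simp: alt_def)
  have c'p: "c' (p i) = alt \<alpha> \<beta> (Suc i)" if "i \<le> k" for i
    using sh that unfolding shifted_def by (cases "i = k") auto
  have c'o: "c' x = c x" if "x \<notin> p ` {..k}" for x
  proof -
    have "x \<noteq> u" using that p0 by auto
    thus ?thesis using sh that unfolding shifted_def by auto
  qed
  have alt1: "alt \<alpha> \<beta> i \<noteq> 1" for i using ab1 by (simp add: alt_def)
  have altc: "j = alt \<alpha> \<beta> (Suc i)" if "j = 1 \<or> j = 2 \<or> j = 3" "j \<noteq> 1" "j \<noteq> alt \<alpha> \<beta> i" for i j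
    using that ab by (auto simp: alt_def doubleton_eq_iff)
  define K where "K = p ` {..k}"
  have closed: "y \<in> K" if x: "x \<in> K" and xy: "(x, y) \<in> links c" for x y
  proof -
    obtain i where i: "i \<le> k" "x = p i" using x by (auto simp: K_def)
    have y: "y \<in> N (p i)" "c y \<noteq> 1" "y < n" using xy i N_ltD unfolding links_def by auto
    have "c y \<noteq> alt \<alpha> \<beta> i" using colouring_neq[OF col lt[OF i(1)] y(1)] cp i by auto
    hence cy: "c y = alt \<alpha> \<beta> (Suc i)" using altc colouring_cases[OF col y(3)] y by blast
    show ?thesis
    proof (cases "i = k")
      case True
      \<comment> \<open>A neighbour off the track would have kept the colour that
        \<open>last\<close> rules out.\<close>
      hence "c' y \<noteq> c y" using last y cy by auto
      thus ?thesis using c'o by (auto simp: K_def)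
    next
      case False
      show ?thesis
      proof (cases "i = 0")
        case True
        hence "p 1 \<in> N u" "c (p 1) = \<alpha>" "c y = \<alpha>" "y \<in> N u" using pN[of 0] False i p0 cp[of 1] cy y by (auto simp: alt_def)
        hence "y = p 1" using u(3) unfolding endpoint_def by blast
        thus ?thesis using False i True by (auto simp: K_def)
      next
        case F: False
        have ik: "0 < i" "i < k" using F False i by auto
        obtain g where g: "N (p i) = {p (i - 1), p (Suc i), g}" "(c(u := 0)) g = 1"
          using track_nbrs[OF tc tr _ ik] six by auto
        hence "y \<noteq> g" using y by (auto split: if_splits)
        hence "y = p (i - 1) \<or> y = p (Suc i)" using y g by auto
        thus ?thesis using ik by (auto simp: K_def)
      qed
    qed
  qed
  have "comp c u \<subseteq> K" by (rule comp_subset) (use closed p0 in \<open>auto simp: K_def\<close>)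
  moreover have "p i \<in> comp c u" if "i \<le> k" for i
    using that
  proof (induction i)
    case 0
    thus ?case using p0 comp_self by simp
  next
    case (Suc i)
    have "(p i, p (Suc i)) \<in> links c"
      using Suc.prems lt[of i] pN[of i] cp[of i] cp[of "Suc i"] alt1[of i] alt1[of "Suc i"] by (simp add: links_def)
    thus ?case using Suc comp_closed by simp
  qed
  ultimately have "K = comp c u" by (auto simp: K_def)
  thus ?thesis unfolding flipped_def using inj lt cp c'p c'o p0 by (auto simp: K_def)
qed

lemma card_even_le: "card {i. i \<le> (k::nat) \<and> odd i} \<le> card {i. i \<le> k \<and> even i} \<and>
    card {i. i \<le> k \<and> even i} \<le> card {i. i \<le> k \<and> odd i} + 1"
proof -
  have "{i. i \<le> k \<and> odd i} \<subseteq> Suc ` {i. i \<le> k \<and> even i}"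
  proof
    fix i assume "i \<in> {i. i \<le> k \<and> odd i}"
    thus "i \<in> Suc ` {i. i \<le> k \<and> even i}" by (cases i) auto
  qed
  hence "card {i. i \<le> k \<and> odd i} \<le> card (Suc ` {i. i \<le> k \<and> even i})"
    by (intro card_mono) auto
  also have "\<dots> = card {i. i \<le> k \<and> even i}" by (simp add: card_image)
  finally have 1: "card {i. i \<le> k \<and> odd i} \<le> card {i. i \<le> k \<and> even i}" .
  have "{i. i \<le> k \<and> even i} \<subseteq> insert 0 (Suc ` {i. i \<le> k \<and> odd i})"
  proof
    fix i assume "i \<in> {i. i \<le> k \<and> even i}"
    thus "i \<in> insert 0 (Suc ` {i. i \<le> k \<and> odd i})" by (cases i) auto
  qed
  hence "card {i. i \<le> k \<and> even i} \<le> card (insert 0 (Suc ` {i. i \<le> k \<and> odd i}))"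
    by (intro card_mono) auto
  also have "\<dots> \<le> card (Suc ` {i. i \<le> k \<and> odd i}) + 1" by (simp add: card_insert_if)
  also have "card (Suc ` {i. i \<le> k \<and> odd i}) = card {i. i \<le> k \<and> odd i}" by (simp add: card_image)
  finally show ?thesis using 1 by simp
qed

lemma num_path:
  assumes "inj_on p {..k}" "\<And>i. i \<le> k \<Longrightarrow> (c (p i) = j) = Q i"
  shows "num c (p ` {..k}) j = card {i. i \<le> k \<and> Q i}"
proof -
  have "{x \<in> p ` {..k}. c x = j} = p ` {i. i \<le> k \<and> Q i}" using assms(2) by auto
  moreover have "inj_on p {i. i \<le> k \<and> Q i}" using assms(1) by (rule inj_on_subset) auto
  ultimately show ?thesis by (simp add: num_def card_image)
qed

text \<open>The path alternates in colour and starts with \<beta>, so \<beta> is ahead by the number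
  of even minus the number of odd indices, which is 0 or 1. The flip makes this a deficit, which
  settles the component, and other components do not change.\<close>

lemma flipped_effect:
  assumes dom: "dominating c" and ab: "{\<alpha>, \<beta>} = {2, 3}"
    and fl: "flipped c \<alpha> \<beta> p k c'" and st: "settled c \<alpha> \<beta> (p 0)"
  shows "col_class c' 1 = col_class c 1" "dominating c'" "settled c' \<alpha> \<beta> (Suc (p 0))"
    "\<exists>\<delta>\<le>1. num c {..<n} \<beta> = num c' {..<n} \<beta> + \<delta> \<and> num c' {..<n} \<alpha> = num c {..<n} \<alpha> + \<delta>"
proof -
  have ab1: "\<alpha> \<noteq> 1" "\<beta> \<noteq> 1" "\<alpha> \<noteq> \<beta>" using ab by (auto simp: doubleton_eq_iff)
  define K where "K = p ` {..k}"
  have inj: "inj_on p {..k}" and lt: "\<And>i. i \<le> k \<Longrightarrow> p i < n"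
    and cp: "\<And>i. i \<le> k \<Longrightarrow> c (p i) = alt \<alpha> \<beta> i" and c'p: "\<And>i. i \<le> k \<Longrightarrow> c' (p i) = alt \<alpha> \<beta> (Suc i)"
    and o: "\<And>x. x \<notin> K \<Longrightarrow> c' x = c x" and K: "K = comp c (p 0)"
    using fl unfolding flipped_def K_def by auto
  have one: "c' x = 1 \<longleftrightarrow> c x = 1" for x
  proof (cases "x \<in> K")
    case True
    then obtain i where "i \<le> k" "x = p i" by (auto simp: K_def)
    thus ?thesis using cp c'p ab1 by (simp add: alt_def)
  qed (use o in auto)
  show "col_class c' 1 = col_class c 1" using one by auto
  have im: "1 \<in> c' ` S \<longleftrightarrow> 1 \<in> c ` S" for S :: "nat set"
  proof -
    have "1 \<in> h ` S \<longleftrightarrow> (\<exists>x\<in>S. h x = 1)" for h :: "nat \<Rightarrow> nat" by (auto simp: image_iff eq_commute)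
    thus ?thesis using one by simp
  qed
  show dom': "dominating c'" using dom unfolding dominating_def im one .
  have comp: "comp c' w = comp c w" for w by (rule comp_cong) (use one in auto)
  define ev od where "ev = card {i. i \<le> k \<and> even i}" and "od = card {i. i \<le> k \<and> odd i}"
  have K1: "num c K \<beta> = ev" "num c K \<alpha> = od" "num c' K \<beta> = od" "num c' K \<alpha> = ev"
    unfolding K_def ev_def od_def
    by (rule num_path[OF inj]; use cp c'p ab1 in \<open>simp add: alt_def\<close>)+
  have eo: "od \<le> ev" "ev \<le> od + 1" using card_even_le unfolding ev_def od_def by auto
  have KS: "K \<subseteq> {..<n}" using lt by (auto simp: K_def)
  have "num c' ({..<n} - K) j = num c ({..<n} - K) j" for j by (rule num_cong) (use o in auto)
  hence "num c {..<n} \<beta> = num c' {..<n} \<beta> + (ev - od)" "num c' {..<n} \<alpha> = num c {..<n} \<alpha> + (ev - od)"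
    using num_split[OF _ KS, of c] num_split[OF _ KS, of c'] K1 eo by simp_all
  thus "\<exists>\<delta>\<le>1. num c {..<n} \<beta> = num c' {..<n} \<beta> + \<delta> \<and> num c' {..<n} \<alpha> = num c {..<n} \<alpha> + \<delta>"
    using eo by (intro exI[of _ "ev - od"]) auto
  show "settled c' \<alpha> \<beta> (Suc (p 0))"
    unfolding settled_def
  proof (intro allI impI)
    fix w assume w: "w < Suc (p 0)" "c' w = \<beta> \<and> endpoint c' \<alpha> w"
    show "num c' (comp c' w) \<beta> \<le> num c' (comp c' w) \<alpha>"
    proof (cases "w \<in> K")
      case True
      hence "comp c' w = K" using comp_eq K comp by auto
      thus ?thesis using K1 eo by simp
    next
      case False
      have wn: "w < n" using w lt[of 0] by simp
      have "p 0 \<in> K" by (auto simp: K_def)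
      hence w0: "w < p 0" using w False by (cases "w = p 0") auto
      have disj: "x \<notin> K" if "x \<in> comp c w" for x
      proof
        assume "x \<in> K"
        hence "comp c w = K" using comp_eq K that by metis
        thus False using comp_self False by auto
      qed
      have "c w = \<beta>" using w o False by auto
      moreover have "endpoint c \<alpha> w"
        unfolding endpoint_def
      proof (intro ballI impI)
        fix y z assume yz: "y \<in> N w" "z \<in> N w" "c y = \<alpha>" "c z = \<alpha>"
        have "(w, y) \<in> links c" "(w, z) \<in> links c" using yz wn ab1 \<open>c w = \<beta>\<close> by (auto simp: links_def)
        hence "y \<in> comp c w" "z \<in> comp c w" using comp_closed comp_self by blast+
        hence "c' y = \<alpha>" "c' z = \<alpha>" using o disj yz by auto
        thus "y = z" using w yz unfolding endpoint_def by blast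
      qed
      ultimately have "num c (comp c w) \<beta> \<le> num c (comp c w) \<alpha>" using st w0 unfolding settled_def by blast
      moreover have "num c' (comp c w) j = num c (comp c w) j" for j by (rule num_cong) (use o disj in auto)
      ultimately show ?thesis using comp by simp
    qed
  qed
qed

end

section \<open>Total correctness with running times\<close>

definition runs :: "(ram_state \<Rightarrow> bool) \<Rightarrow> com \<Rightarrow> nat \<Rightarrow> (ram_state \<Rightarrow> bool) \<Rightarrow> bool" where
  "runs P c t Q \<longleftrightarrow> (\<forall>s. P s \<longrightarrow> (\<exists>t' s'. exec c s t' s' \<and> t' \<le> t \<and> Q s'))"

lemma runs_conseq:
  assumes "runs P c t Q" "\<And>s. P' s \<Longrightarrow> P s" "\<And>s. Q s \<Longrightarrow> Q' s" "t \<le> t'"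
  shows "runs P' c t' Q'"
  using assms unfolding runs_def by (meson le_trans)

lemma runs_pre: "runs P c t Q \<Longrightarrow> (\<And>s. P' s \<Longrightarrow> P s) \<Longrightarrow> runs P' c t Q"
  by (erule runs_conseq) auto

lemma runs_post: "runs P c t Q \<Longrightarrow> (\<And>s. Q s \<Longrightarrow> Q' s) \<Longrightarrow> runs P c t Q'"
  by (erule runs_conseq) auto

lemma runs_Seq:
  assumes "runs P c t Q" "runs Q d u R"
  shows "runs P (Seq c d) (t + u) R"
  unfolding runs_def
proof (intro allI impI)
  fix s assume "P s"
  then obtain t' s' where 1: "exec c s t' s'" "t' \<le> t" "Q s'" using assms(1) unfolding runs_def by blast
  then obtain u' s'' where 2: "exec d s' u' s''" "u' \<le> u" "R s''" using assms(2) unfolding runs_def by blast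
  show "\<exists>t' s'. exec (Seq c d) s t' s' \<and> t' \<le> t + u \<and> R s'"
    using exec.Seq[OF 1(1) 2(1)] 1 2 by (intro exI conjI) auto
qed

text \<open>Both branches are charged. This is coarse, but keeps time bounds free of maxima.\<close>

lemma runs_Cond:
  assumes "runs (\<lambda>s. P s \<and> bval b s) c t Q" "runs (\<lambda>s. P s \<and> \<not> bval b s) d u Q"
  shows "runs P (Cond b c d) (bcost b + 1 + t + u) Q"
  unfolding runs_def
proof (intro allI impI)
  fix s assume P: "P s"
  show "\<exists>t' s'. exec (Cond b c d) s t' s' \<and> t' \<le> bcost b + 1 + t + u \<and> Q s'"
  proof (cases "bval b s")
    case True
    then obtain t' s' where 1: "exec c s t' s'" "t' \<le> t" "Q s'" using assms(1) P unfolding runs_def by blast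
    show ?thesis using exec.CondTrue[OF True 1(1)] 1 by (intro exI conjI) auto
  next
    case False
    then obtain t' s' where 1: "exec d s t' s'" "t' \<le> u" "Q s'" using assms(2) P unfolding runs_def by blast
    show ?thesis using exec.CondFalse[OF False 1(1)] 1 by (intro exI conjI) auto
  qed
qed

text \<open>The index \<open>m\<close> of the invariant bounds the number of remaining iterations.\<close>

lemma runs_While:
  assumes body: "\<And>m. runs (\<lambda>s. I m s \<and> bval b s) c t (\<lambda>s. \<exists>m'<m. I m' s)"
  shows "runs (I m) (While b c) ((m + 1) * (bcost b + 1 + t)) (\<lambda>s. (\<exists>m. I m s) \<and> \<not> bval b s)"
proof -
  have "\<exists>t' s'. exec (While b c) s t' s' \<and> t' \<le> (m + 1) * (bcost b + 1 + t) \<and> (\<exists>m. I m s') \<and> \<not> bval b s'"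
    if "I m s" for s
    using that
  proof (induction m arbitrary: s rule: less_induct)
    case (less m)
    show ?case
    proof (cases "bval b s")
      case False
      show ?thesis using exec.WhileFalse[OF False] less.prems False by (intro exI conjI) auto
    next
      case True
      then obtain t' s' m' where 1: "exec c s t' s'" "t' \<le> t" "m' < m" "I m' s'"
        using body[of m] less.prems unfolding runs_def by blast
      obtain u s'' where 2: "exec (While b c) s' u s''" "u \<le> (m' + 1) * (bcost b + 1 + t)"
        "\<exists>m. I m s''" "\<not> bval b s''" using less.IH[OF 1(3,4)] by blast
      have "(m' + 1) * (bcost b + 1 + t) \<le> m * (bcost b + 1 + t)" using 1(3) by (intro mult_le_mono1) auto
      hence "bcost b + 1 + t' + u \<le> (m + 1) * (bcost b + 1 + t)" using 1 2 by (simp add: algebra_simps)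
      thus ?thesis using exec.WhileTrue[OF True 1(1) 2(1)] 2(3,4) by blast
    qed
  qed
  thus ?thesis unfolding runs_def by blast
qed

primrec straight :: "com \<Rightarrow> bool" where
  "straight Skip = True"
| "straight (NAssign x e) = True"
| "straight (NStore a i e) = True"
| "straight (RAssign x e) = True"
| "straight (Seq c d) = (straight c \<and> straight d)"
| "straight (Cond b c d) = (straight c \<and> straight d)"
| "straight (While b c) = False"

text \<open>Loop-free programs have an explicit final state, so they can be verified by rewriting
  instead of by intermediate assertions. The value at \<open>While\<close> is a dummy, which
  \<open>straight\<close> excludes.\<close>

primrec effect :: "com \<Rightarrow> ram_state \<Rightarrow> ram_state" where
  "effect Skip s = s"
| "effect (NAssign x e) s = s\<lparr>nreg := (nreg s)(x := nval e s)\<rparr>"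
| "effect (NStore a i e) s = s\<lparr>narr := (narr s)(a := (narr s a)(nval i s := nval e s))\<rparr>"
| "effect (RAssign x e) s = s\<lparr>rreg := (rreg s)(x := rval e s)\<rparr>"
| "effect (Seq c d) s = effect d (effect c s)"
| "effect (Cond b c d) s = (if bval b s then effect c s else effect d s)"
| "effect (While b c) s = s"

primrec cost :: "com \<Rightarrow> nat" where
  "cost Skip = 1"
| "cost (NAssign x e) = ncost e + 1"
| "cost (NStore a i e) = ncost i + ncost e + 1"
| "cost (RAssign x e) = rcost e + 1"
| "cost (Seq c d) = cost c + cost d"
| "cost (Cond b c d) = bcost b + 1 + cost c + cost d"
| "cost (While b c) = 0"

lemma straight_exec: "straight c \<Longrightarrow> \<exists>t\<le>cost c. exec c s t (effect c s)"
proof (induction c arbitrary: s)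
  case Skip
  show ?case using exec.Skip[of s] by (intro exI conjI) auto
next
  case (NAssign x e)
  show ?case using exec.NAssign[of x e s] by (intro exI conjI) auto
next
  case (NStore a i e)
  show ?case using exec.NStore[of a i e s] by (intro exI conjI) auto
next
  case (RAssign x e)
  show ?case using exec.RAssign[of x e s] by (intro exI conjI) auto
next
  case (Seq c d)
  then obtain t u where "t \<le> cost c" "exec c s t (effect c s)"
    "u \<le> cost d" "exec d (effect c s) u (effect d (effect c s))" by fastforce
  thus ?case using exec.Seq by (intro exI[of _ "t + u"]) auto
next
  case (Cond b c d)
  then obtain t u where tu: "t \<le> cost c" "exec c s t (effect c s)" "u \<le> cost d" "exec d s u (effect d s)"
    by fastforce
  show ?case
  proof (cases "bval b s")
    case True
    thus ?thesis using exec.CondTrue[OF True tu(2), of d] tu by (intro exI[of _ "bcost b + 1 + t"]) auto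
  next
    case False
    thus ?thesis using exec.CondFalse[OF False tu(4), of c] tu by (intro exI[of _ "bcost b + 1 + u"]) auto
  qed
qed simp

lemma runs_straight:
  assumes "straight c" "\<And>s. P s \<Longrightarrow> Q (effect c s)"
  shows "runs P c (cost c) Q"
  unfolding runs_def using straight_exec[OF assms(1)] assms(2) by blast

definition For :: "vname \<Rightarrow> com \<Rightarrow> com" where
  "For x c = Seq (NAssign x (NConst 0))
     (While (NLess (NReg x) (NReg ''n'')) (Seq c (NAssign x (NAdd (NReg x) (NConst 1)))))"

text \<open>The assumption \<open>stable\<close> says that the invariant ignores the loop register,
  so setting and incrementing that register preserve it. A round costs 4 units for the test and 4
  for the increment, besides the body.\<close>

lemma runs_For:
  assumes body: "\<And>i. i < k \<Longrightarrow>
      runs (\<lambda>s. I i s \<and> nreg s x = i \<and> nreg s ''n'' = k) c t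
        (\<lambda>s. I (Suc i) s \<and> nreg s x = i \<and> nreg s ''n'' = k)"
    and stable: "\<And>i s y. I i s \<Longrightarrow> I i (s\<lparr>nreg := (nreg s)(x := y)\<rparr>)"
    and x: "x \<noteq> ''n''"
  shows "runs (\<lambda>s. I 0 s \<and> nreg s ''n'' = k) (For x c) (2 + (k + 1) * (t + 8))
    (\<lambda>s. I k s \<and> nreg s ''n'' = k)"
proof -
  define J where "J m s \<longleftrightarrow> (\<exists>i\<le>k. m = k - i \<and> I i s \<and> nreg s x = i \<and> nreg s ''n'' = k)" for m s
  have "runs (\<lambda>s. J m s \<and> bval (NLess (NReg x) (NReg ''n'')) s)
      (Seq c (NAssign x (NAdd (NReg x) (NConst 1)))) (t + 4) (\<lambda>s. \<exists>m'<m. J m' s)" for m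
  proof (cases "\<exists>i<k. m = k - i")
    case False
    thus ?thesis unfolding runs_def J_def by auto
  next
    case True
    then obtain i where i: "i < k" "m = k - i" by blast
    have "runs (\<lambda>s. I (Suc i) s \<and> nreg s x = i \<and> nreg s ''n'' = k) (NAssign x (NAdd (NReg x) (NConst 1)))
       (cost (NAssign x (NAdd (NReg x) (NConst 1)))) (\<lambda>s. \<exists>m'<m. J m' s)"
    proof (rule runs_straight)
      fix s assume s: "I (Suc i) s \<and> nreg s x = i \<and> nreg s ''n'' = k"
      show "\<exists>m'<m. J m' (effect (NAssign x (NAdd (NReg x) (NConst 1))) s)"
        unfolding J_def using s stable[of "Suc i" s] i x
        by (intro exI[of _ "k - Suc i"] conjI exI[of _ "Suc i"]) auto
    qed simp
    from runs_Seq[OF body[OF i(1)] this] show ?thesis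
    proof (rule runs_conseq)
      fix s assume "J m s \<and> bval (NLess (NReg x) (NReg ''n'')) s"
      then obtain i' where i': "m = k - i'" "I i' s" "nreg s x = i'" "nreg s ''n'' = k" "i' < k"
        by (auto simp: J_def)
      hence "i' = i" using i by linarith
      thus "I i s \<and> nreg s x = i \<and> nreg s ''n'' = k" using i' by blast
    qed auto
  qed
  from runs_While[of J, OF this, of k]
  have W: "runs (J k) (While (NLess (NReg x) (NReg ''n'')) (Seq c (NAssign x (NAdd (NReg x) (NConst 1)))))
     ((k + 1) * (t + 8)) (\<lambda>s. I k s \<and> nreg s ''n'' = k)"
    by (rule runs_conseq) (auto simp: J_def)
  have "runs (\<lambda>s. I 0 s \<and> nreg s ''n'' = k) (NAssign x (NConst 0)) (cost (NAssign x (NConst 0))) (J k)"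
    by (rule runs_straight) (use stable x in \<open>auto simp: J_def\<close>)
  from runs_Seq[OF this W] show ?thesis unfolding For_def by (rule runs_conseq) auto
qed

text \<open>The index \<open>3 * v + j\<close> is formed by additions, as the machine has no
  multiplication.\<close>

definition nbr :: "nexp \<Rightarrow> nat \<Rightarrow> nexp" where
  "nbr e j = NArr ''adj'' (NAdd e (NAdd e (NAdd e (NConst j))))"

abbreviation colr :: "nexp \<Rightarrow> nexp" where
  "colr e \<equiv> NArr ''machine'' e"

abbreviation Or :: "bexp \<Rightarrow> bexp \<Rightarrow> bexp" where
  "Or b c \<equiv> BNot (BAnd (BNot b) (BNot c))"

definition absent :: "nexp \<Rightarrow> nexp \<Rightarrow> bexp" where
  "absent a e = BAnd (BNot (NEq (colr (nbr e 0)) a))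
     (BAnd (BNot (NEq (colr (nbr e 1)) a)) (BNot (NEq (colr (nbr e 2)) a)))"

section \<open>Colouring with three colours\<close>

text \<open>
  Register \<open>h\<close> holds the uncoloured vertex, \<open>v\<close> the start of the walk, \<open>a\<close> the colour that \<open>h\<close>
  is to take and \<open>b\<close> the other colour of the walk. Afterwards \<open>f\<close> is 0 if all vertices on the walk are
  coloured, and 2 if the walk is back at \<open>v\<close>.
\<close>

definition pick :: com where
  "pick =
    Cond (NEq (colr (nbr (NReg ''h'') 0)) (NReg ''a'')) (NAssign ''w'' (nbr (NReg ''h'') 0))
    (Cond (NEq (colr (nbr (NReg ''h'') 1)) (NReg ''a'')) (NAssign ''w'' (nbr (NReg ''h'') 1))
      (NAssign ''w'' (nbr (NReg ''h'') 2)))"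

definition step :: com where
  "step =
    Cond (absent (NReg ''a'') (NReg ''h''))
      (Seq (NStore ''machine'' (NReg ''h'') (NReg ''a'')) (NAssign ''f'' (NConst 0)))
    (Cond (absent (NSub (NSub (NConst 6) (NReg ''a'')) (NReg ''b'')) (NReg ''h''))
      (Seq (NStore ''machine'' (NReg ''h'') (NSub (NSub (NConst 6) (NReg ''a'')) (NReg ''b'')))
        (NAssign ''f'' (NConst 0)))
    (Seq pick
    (Seq (NStore ''machine'' (NReg ''h'') (NReg ''a''))
    (Seq (NStore ''machine'' (NReg ''w'') (NConst 0))
    (Seq (NAssign ''h'' (NReg ''w''))
    (Seq (NAssign ''t'' (NReg ''a''))
    (Seq (NAssign ''a'' (NReg ''b''))
    (Seq (NAssign ''b'' (NReg ''t''))
      (Cond (NEq (NReg ''h'') (NReg ''v'')) (NAssign ''f'' (NConst 2)) Skip)))))))))"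

definition walk :: com where
  "walk = Seq (NAssign ''f'' (NConst 1)) (While (NEq (NReg ''f'') (NConst 1)) step)"

definition walk_time :: "nat \<Rightarrow> nat" where
  "walk_time n = 2 + (n + 1) * (4 + cost step)"

context cubic_lists begin

text \<open>Equality with the whole array, also beyond \<open>n\<close>, makes the colouring a
  function of the state. So any two colourings that a state holds coincide.\<close>

definition holds :: "(nat \<Rightarrow> nat) \<Rightarrow> ram_state \<Rightarrow> bool" where
  "holds c s \<longleftrightarrow> (\<forall>v<n. \<forall>j<3. narr s ''adj'' (v + (v + (v + j))) = nb v j) \<and>
     nreg s ''n'' = n \<and> narr s ''machine'' = c"

lemma nval_nbr: "holds c s \<Longrightarrow> nval e s < n \<Longrightarrow> j < 3 \<Longrightarrow> nval (nbr e j) s = nb (nval e s) j"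
  by (simp add: holds_def nbr_def)

lemma holds_machine: "holds c s \<Longrightarrow> narr s ''machine'' = c"
  by (simp add: holds_def)

lemma holds_n: "holds c s \<Longrightarrow> nreg s ''n'' = n"
  by (simp add: holds_def)

lemma holds_nreg [simp]: "r ''n'' = nreg s ''n'' \<Longrightarrow> holds c (s\<lparr>nreg := r\<rparr>) = holds c s"
  by (simp add: holds_def)

lemma bval_absent:
  assumes "holds c s" "nval e s < n"
  shows "bval (absent a e) s \<longleftrightarrow> nval a s \<notin> c ` N (nval e s)"
  using nval_nbr[OF assms] holds_machine[OF assms(1)] by (auto simp: absent_def N_def image_iff)

lemma proper_fill:
  assumes "proper c" "h < n" "a \<notin> c ` N h" "a \<le> 3"
  shows "proper (c(h := a))"
  unfolding proper_def
proof (intro allI impI conjI)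
  fix u assume u: "u < n"
  show "(c(h := a)) u \<le> 3" using assms u by (auto simp: proper_def)
  assume nz: "(c(h := a)) u \<noteq> 0"
  show "(c(h := a)) u \<notin> c(h := a) ` N u"
  proof
    assume "(c(h := a)) u \<in> c(h := a) ` N u"
    then obtain x where x: "x \<in> N u" "(c(h := a)) x = (c(h := a)) u" by auto
    have xn: "x < n" using x u N_ltD by blast
    have ux: "u \<in> N x" "x \<noteq> u" using x N_sym[OF xn u] N_sym[OF u xn] N_irrefl[OF u] by auto
    show False
    proof (cases "x = h")
      case True
      thus False using x ux assms(3) by (auto simp: image_iff)
    next
      case False
      have "u \<noteq> h" using x assms(3) False by (auto simp: image_iff)
      hence "c u \<notin> c ` N u" using assms(1) u nz by (simp add: proper_def)
      thus False using x False \<open>u \<noteq> h\<close> by (auto simp: image_iff)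
    qed
  qed
qed

text \<open>That \<open>x\<close> is absent around \<open>p k\<close> says why the walk stopped
  there; when a path is flipped, this identifies \<open>p k\<close> as its other end.\<close>

definition walked :: "(nat \<Rightarrow> nat) \<Rightarrow> nat \<Rightarrow> nat \<Rightarrow> nat \<Rightarrow> (nat \<Rightarrow> nat) \<Rightarrow> nat \<Rightarrow> bool" where
  "walked c \<alpha> \<beta> v c' f \<longleftrightarrow> proper c' \<and>
     (f = 0 \<and> (\<exists>p k x. track c \<alpha> \<beta> v p k \<and> shifted c \<alpha> \<beta> p k x c' \<and> x \<notin> c' ` N (p k) \<and>
        (x = alt \<alpha> \<beta> (Suc k) \<or> x = 6 - \<alpha> - \<beta>)) \<or>
      f = 2 \<and> (\<exists>p k. returned c \<alpha> \<beta> v p k c'))"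

lemma shifted_fill:
  assumes "shifted c \<alpha> \<beta> p k y c'" "inj_on p {..k}"
  shows "shifted c \<alpha> \<beta> p k x (c'(p k := x))"
proof -
  have "p i \<noteq> p k" if "i < k" for i using inj_on_eq_iff[OF assms(2), of i k] that by auto
  thus ?thesis using assms(1) unfolding shifted_def by auto
qed

text \<open>The registers for the two colours are exchanged at every step, but the third colour
  computed from them stays the same.\<close>

lemma six_alt: "6 - alt \<alpha> \<beta> (Suc k) - alt \<alpha> \<beta> k = 6 - \<alpha> - \<beta>"
  by (auto simp: alt_def)

lemma runs_walk:
  assumes tc: "two_colours \<alpha> \<beta>" and v: "v < n" "c v = 0" and pr: "proper c"
    and uniq: "endpoint c \<alpha> v"
  shows "runs (\<lambda>s. holds c s \<and> nreg s ''h'' = v \<and> nreg s ''v'' = v \<and> nreg s ''a'' = \<alpha> \<and> nreg s ''b'' = \<beta>)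
     walk (walk_time n)
     (\<lambda>s. nreg s ''v'' = v \<and> (nreg s ''f'' = 2 \<longrightarrow> nreg s ''h'' = v) \<and>
        (\<exists>c'. holds c' s \<and> walked c \<alpha> \<beta> v c' (nreg s ''f'')))"
proof -
  define act where "act m s c' p k \<longleftrightarrow> nreg s ''f'' = 1 \<and> m = n - k \<and> track c \<alpha> \<beta> v p k \<and>
    shifted c \<alpha> \<beta> p k 0 c' \<and> proper c' \<and> nreg s ''h'' = p k \<and>
    nreg s ''a'' = alt \<alpha> \<beta> (Suc k) \<and> nreg s ''b'' = alt \<alpha> \<beta> k" for m :: nat and s :: ram_state and c' p k
  define I where "I m s \<longleftrightarrow> nreg s ''v'' = v \<and> (\<exists>c'. holds c' s \<and>
     ((\<exists>p k. act m s c' p k) \<or>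
      m = 0 \<and> nreg s ''f'' \<noteq> 1 \<and> (nreg s ''f'' = 2 \<longrightarrow> nreg s ''h'' = v) \<and> walked c \<alpha> \<beta> v c' (nreg s ''f'')))" for m :: nat and s :: ram_state
  have "runs (\<lambda>s. I m s \<and> bval (NEq (NReg ''f'') (NConst 1)) s) step (cost step) (\<lambda>s. \<exists>m'<m. I m' s)" for m
  proof (rule runs_straight)
    show "straight step" by (simp add: step_def pick_def)
    fix s assume s: "I m s \<and> bval (NEq (NReg ''f'') (NConst 1)) s"
    then obtain c' p k where hc: "holds c' s" and nv: "nreg s ''v'' = v" and "act m s c' p k"
      unfolding I_def by auto
    hence A: "m = n - k" "track c \<alpha> \<beta> v p k" "shifted c \<alpha> \<beta> p k 0 c'" "proper c'" "nreg s ''h'' = p k"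
      "nreg s ''a'' = alt \<alpha> \<beta> (Suc k)" "nreg s ''b'' = alt \<alpha> \<beta> k" by (auto simp: act_def)
    have pk: "p k < n" and inj: "inj_on p {..k}" using A(2) by (auto simp: track_def)
    \<comment> \<open>A track visits distinct vertices, so \<open>n - k\<close> bounds the number of
      remaining steps.\<close>
    have "card (p ` {..k}) \<le> card {..<n}" by (rule card_mono) (use A(2) in \<open>auto simp: track_def\<close>)
    hence kn: "k < n" using card_image[OF inj] by simp
    note mach = holds_machine[OF hc]
    show "\<exists>m'<m. I m' (effect step s)"
    proof (cases "bval (absent (NReg ''a'') (NReg ''h'')) s")
      case True
      hence ab: "alt \<alpha> \<beta> (Suc k) \<notin> c' ` N (p k)" using bval_absent[OF hc] A pk by simp
      define c'' where "c'' = c'(p k := alt \<alpha> \<beta> (Suc k))"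
      have "alt \<alpha> \<beta> (Suc k) \<notin> c'' ` N (p k)" using ab N_irrefl[OF pk] by (auto simp: c''_def image_iff)
      moreover have "proper c''" unfolding c''_def by (rule proper_fill) (use A pk ab alt_colours(2)[OF tc] in auto)
      moreover have "shifted c \<alpha> \<beta> p k (alt \<alpha> \<beta> (Suc k)) c''" unfolding c''_def by (rule shifted_fill[OF A(3) inj])
      ultimately have "walked c \<alpha> \<beta> v c'' 0" unfolding walked_def using A(2) by blast
      moreover have "holds c'' (effect step s)" "nreg (effect step s) ''f'' = 0" "nreg (effect step s) ''v'' = v"
        using True hc A nv by (auto simp: step_def holds_def c''_def)
      ultimately have "I 0 (effect step s)" unfolding I_def by auto
      thus ?thesis using A kn by (intro exI[of _ 0]) auto
    next
      case F1: False
      hence ex: "alt \<alpha> \<beta> (Suc k) \<in> c' ` N (p k)" using bval_absent[OF hc] A pk by simp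
      let ?six = "NSub (NSub (NConst 6) (NReg ''a'')) (NReg ''b'')"
      have six: "nval ?six s = 6 - \<alpha> - \<beta>" using A six_alt[of \<alpha> \<beta> k] by simp
      show ?thesis
      proof (cases "bval (absent ?six (NReg ''h'')) s")
        case True
        hence ab: "6 - \<alpha> - \<beta> \<notin> c' ` N (p k)" using bval_absent[OF hc] A pk six by simp
        define c'' where "c'' = c'(p k := 6 - \<alpha> - \<beta>)"
        have "6 - \<alpha> - \<beta> \<notin> c'' ` N (p k)" using ab N_irrefl[OF pk] by (auto simp: c''_def image_iff)
        moreover have "proper c''" unfolding c''_def by (rule proper_fill) (use A pk ab alt_colours(6)[OF tc] in auto)
        moreover have "shifted c \<alpha> \<beta> p k (6 - \<alpha> - \<beta>) c''" unfolding c''_def by (rule shifted_fill[OF A(3) inj])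
        ultimately have "walked c \<alpha> \<beta> v c'' 0" unfolding walked_def using A(2) by blast
        moreover have "holds c'' (effect step s)" "nreg (effect step s) ''f'' = 0" "nreg (effect step s) ''v'' = v"
          using True F1 hc A nv six by (auto simp: step_def holds_def c''_def)
        ultimately have "I 0 (effect step s)" unfolding I_def by auto
        thus ?thesis using A kn by (intro exI[of _ 0]) auto
      next
        case F2: False
        hence "6 - \<alpha> - \<beta> \<in> c' ` N (p k)" using bval_absent[OF hc] A pk six by simp
        then obtain g where g: "g \<in> N (p k)" "c' g = 6 - \<alpha> - \<beta>" by auto
        define w where "w = (if c' (nb (p k) 0) = alt \<alpha> \<beta> (Suc k) then nb (p k) 0
          else if c' (nb (p k) 1) = alt \<alpha> \<beta> (Suc k) then nb (p k) 1 else nb (p k) 2)"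
        have w: "w \<in> N (p k)" "c' w = alt \<alpha> \<beta> (Suc k)" using ex by (auto simp: w_def N_def)
        define c'' where "c'' = c'(p k := alt \<alpha> \<beta> (Suc k), w := 0)"
        note ts = track_step[OF tc A(2) v(2) A(3,4) uniq w g c''_def]
        have E: "holds c'' (effect step s)" "nreg (effect step s) ''f'' = (if w = v then 2 else 1)"
          "nreg (effect step s) ''v'' = v" "nreg (effect step s) ''h'' = w"
          "nreg (effect step s) ''a'' = alt \<alpha> \<beta> k" "nreg (effect step s) ''b'' = alt \<alpha> \<beta> (Suc k)"
        proof -
          have "nval (nbr (NReg ''h'') j) s = nb (p k) j" if "j < 3" for j
            using nval_nbr[OF hc, of "NReg ''h''" j] that A pk by simp
          hence "effect pick s = s\<lparr>nreg := (nreg s)(''w'' := w)\<rparr>"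
            using A mach by (simp add: pick_def w_def)
          hence e: "effect step s = (let s' = s\<lparr>nreg := (nreg s)(''w'' := w, ''h'' := w, ''t'' := alt \<alpha> \<beta> (Suc k),
             ''a'' := alt \<alpha> \<beta> k, ''b'' := alt \<alpha> \<beta> (Suc k)), narr := (narr s)(''machine'' := c'')\<rparr>
             in if w = v then s'\<lparr>nreg := (nreg s')(''f'' := 2)\<rparr> else s')"
            using A mach nv F1 F2 by (simp add: step_def c''_def Let_def fun_upd_twist)
          show "holds c'' (effect step s)" "nreg (effect step s) ''f'' = (if w = v then 2 else 1)"
            "nreg (effect step s) ''v'' = v" "nreg (effect step s) ''h'' = w"
            "nreg (effect step s) ''a'' = alt \<alpha> \<beta> k" "nreg (effect step s) ''b'' = alt \<alpha> \<beta> (Suc k)"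
            using hc nv s unfolding e by (simp_all add: holds_def Let_def)
        qed
        show ?thesis
        proof (cases "w = v")
          case True
          have "returned c \<alpha> \<beta> v (p(Suc k := v)) k c''"
            unfolding c''_def True by (rule returnedI[OF A(2,3)]) (use ts(2)[OF True] in auto)
          hence "walked c \<alpha> \<beta> v c'' 2" using ts(1) unfolding walked_def by auto
          hence "I 0 (effect step s)" using E True unfolding I_def by auto
          thus ?thesis using A kn by (intro exI[of _ 0]) auto
        next
          case False
          have "act (n - Suc k) (effect step s) c'' (p(Suc k := w)) (Suc k)"
            using E ts(1) ts(3)[OF False] False unfolding act_def by auto
          hence "I (n - Suc k) (effect step s)" unfolding I_def using E by blast
          thus ?thesis using A kn by (intro exI[of _ "n - Suc k"]) auto
        qed
      qed
    qed
  qed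
  from runs_While[of I, OF this, of n]
  have W: "runs (I n) (While (NEq (NReg ''f'') (NConst 1)) step) ((n + 1) * (4 + cost step))
    (\<lambda>s. (\<exists>m. I m s) \<and> nreg s ''f'' \<noteq> 1)" by (rule runs_conseq) (auto simp: algebra_simps)
  have "runs (\<lambda>s. holds c s \<and> nreg s ''h'' = v \<and> nreg s ''v'' = v \<and> nreg s ''a'' = \<alpha> \<and> nreg s ''b'' = \<beta>)
     (NAssign ''f'' (NConst 1)) (cost (NAssign ''f'' (NConst 1))) (I n)"
  proof (rule runs_straight)
    fix s assume s: "holds c s \<and> nreg s ''h'' = v \<and> nreg s ''v'' = v \<and> nreg s ''a'' = \<alpha> \<and> nreg s ''b'' = \<beta>"
    have "act n (effect (NAssign ''f'' (NConst 1)) s) c (\<lambda>_. v) 0"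
      unfolding act_def using s v pr track_0[OF v(1)] shifted_0[of c v, OF v(2)] by (auto simp: alt_def)
    thus "I n (effect (NAssign ''f'' (NConst 1)) s)" unfolding I_def using s by auto
  qed simp
  from runs_Seq[OF this W] show ?thesis
    unfolding walk_def walk_time_def
    by (rule runs_conseq) (auto simp: I_def act_def)
qed

end

lemma runs_ex: "(\<And>x. runs (P x) c t Q) \<Longrightarrow> runs (\<lambda>s. \<exists>x. P x s) c t Q"
  unfolding runs_def by blast

lemma runs_fact: "(A \<Longrightarrow> runs P c t Q) \<Longrightarrow> runs (\<lambda>s. A \<and> P s) c t Q"
  unfolding runs_def by blast

section \<open>Colouring one more vertex by Kempe swaps\<close>

definition attempt :: "nat \<Rightarrow> nat \<Rightarrow> com" where
  "attempt j k =
    Cond (NEq (NReg ''f'') (NConst 2))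
      (Seq (Seq (NAssign ''a'' (colr (nbr (NReg ''v'') j))) (NAssign ''b'' (colr (nbr (NReg ''v'') k)))) walk)
      Skip"

text \<open>These are the walks of \<open>four_walks\<close>, with the neighbours numbered
  \<open>i\<close>, \<open>j\<close>, \<open>k\<close> as \<open>x\<close>, \<open>y\<close>,
  \<open>z\<close>. If the first two of them are nonadjacent, one of the walks ends by colouring all
  vertices on it.\<close>

definition attempts :: "nat \<Rightarrow> nat \<Rightarrow> nat \<Rightarrow> com" where
  "attempts i j k = Seq (attempt i j) (Seq (attempt i k) (Seq (attempt j k) (attempt i j)))"

text \<open>Instead of testing which two neighbours are nonadjacent, all three pairs are tried in
  turn.\<close>

definition place :: com where
  "place =
    Cond (absent (NConst 1) (NReg ''v'')) (NStore ''machine'' (NReg ''v'') (NConst 1))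
    (Cond (absent (NConst 2) (NReg ''v'')) (NStore ''machine'' (NReg ''v'') (NConst 2))
    (Cond (absent (NConst 3) (NReg ''v'')) (NStore ''machine'' (NReg ''v'') (NConst 3))
    (Seq (Seq (NAssign ''h'' (NReg ''v'')) (NAssign ''f'' (NConst 2)))
    (Seq (attempts 0 1 2) (Seq (attempts 0 2 1) (attempts 1 2 0))))))"

definition attempt_time :: "nat \<Rightarrow> nat" where
  "attempt_time n = 30 + walk_time n"

definition place_time :: "nat \<Rightarrow> nat" where
  "place_time n = 200 + 12 * attempt_time n"

context cubic_lists begin

definition coloured :: "(nat \<Rightarrow> nat) \<Rightarrow> nat \<Rightarrow> bool" where
  "coloured c i \<longleftrightarrow> proper c \<and> (\<forall>u<n. c u \<noteq> 0 \<longleftrightarrow> u < i)"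

text \<open>The predicate \<open>H\<close> speaks about the case of failure only and records the
  history: chaining attempts nests \<open>went\<close> under existential quantifiers, until
  \<open>four_walks\<close> applies to the sequence of colourings.\<close>

definition status :: "nat \<Rightarrow> ((nat \<Rightarrow> nat) \<Rightarrow> bool) \<Rightarrow> ram_state \<Rightarrow> bool" where
  "status v H s \<longleftrightarrow> nreg s ''v'' = v \<and>
     (nreg s ''f'' = 0 \<and> (\<exists>c. holds c s \<and> coloured c (Suc v)) \<or>
      nreg s ''f'' = 2 \<and> nreg s ''h'' = v \<and> (\<exists>c. holds c s \<and> coloured c v \<and> stuck c v \<and> H c))"

definition went :: "nat \<Rightarrow> nat \<Rightarrow> nat \<Rightarrow> (nat \<Rightarrow> nat) \<Rightarrow> (nat \<Rightarrow> nat) \<Rightarrow> bool" where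
  "went v j k c c' \<longleftrightarrow> stuck c v \<and> (\<exists>p l. returned c (c (nb v j)) (c (nb v k)) v p l c')"

lemma N_perm: "{i, j, k} = {0, 1, 2} \<Longrightarrow> N v = {nb v i, nb v j, nb v k}"
proof -
  assume "{i, j, k} = {0, 1, 2}"
  moreover have "N v = nb v ` {0, 1, 2}" by (simp add: N_def)
  ultimately have "N v = nb v ` {i, j, k}" by metis
  thus ?thesis by simp
qed

lemma shifted_coloured:
  assumes tc: "two_colours \<alpha> \<beta>" and tr: "track c \<alpha> \<beta> v p k" and sh: "shifted c \<alpha> \<beta> p k x c'"
    and x: "x \<noteq> 0" and pr: "proper c'" and c: "coloured c v"
  shows "coloured c' (Suc v)"
proof -
  note ac = alt_colours(1)[OF tc]
  have p0: "p 0 = v" using tr unfolding track_def by auto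
  have "c' u \<noteq> 0 \<longleftrightarrow> u < Suc v" if u: "u < n" for u
  proof (cases "u \<in> p ` {..k}")
    case True
    then obtain i where i: "i \<le> k" "u = p i" by auto
    have 1: "c' u \<noteq> 0" using i sh x ac unfolding shifted_def by (cases "i = k") auto
    have "u < Suc v"
    proof (cases "i = 0")
      case True
      thus ?thesis using i p0 by simp
    next
      case False
      hence "c u \<noteq> 0" using i tr ac unfolding track_def by auto
      thus ?thesis using c u unfolding coloured_def by auto
    qed
    thus ?thesis using 1 by simp
  next
    case False
    hence "c' u = c u" "u \<noteq> v" using sh p0 unfolding shifted_def by auto
    thus ?thesis using c u unfolding coloured_def by auto
  qed
  thus ?thesis using pr unfolding coloured_def by blast
qed

lemma returned_coloured:
  assumes tc: "two_colours \<alpha> \<beta>" and ret: "returned c \<alpha> \<beta> v p k c'" and v0: "c v = 0"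
    and pr: "proper c'" and c: "coloured c v"
  shows "coloured c' v"
proof -
  note ac = alt_colours(1)[OF tc]
  have tr: "track c \<alpha> \<beta> v p k" using ret unfolding returned_def by auto
  hence p0: "p 0 = v" unfolding track_def by auto
  have "c' u \<noteq> 0 \<longleftrightarrow> c u \<noteq> 0" for u
  proof (cases "u \<in> p ` {..k}")
    case True
    then obtain i where i: "i \<le> k" "u = p i" by auto
    show ?thesis
    proof (cases "i = 0")
      case True
      thus ?thesis using i p0 v0 ret unfolding returned_def by auto
    next
      case False
      hence "c u \<noteq> 0" using i tr ac unfolding track_def by auto
      moreover have "c' u \<noteq> 0" using i False ret ac unfolding returned_def by auto
      ultimately show ?thesis by simp
    qed
  next
    case False
    thus ?thesis using ret unfolding returned_def by auto
  qed
  thus ?thesis using c pr unfolding coloured_def by simp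
qed

lemma runs_attempt:
  assumes v: "v < n" and jkl: "{j, k, l} = {0, 1, 2}"
  shows "runs (status v H) (attempt j k) (attempt_time n) (status v (\<lambda>c'. \<exists>c. H c \<and> went v j k c c'))"
proof -
  let ?Q = "status v (\<lambda>c'. \<exists>c. H c \<and> went v j k c c')"
  let ?set = "Seq (NAssign ''a'' (colr (nbr (NReg ''v'') j))) (NAssign ''b'' (colr (nbr (NReg ''v'') k)))"
  have jk: "j < 3" "k < 3"
  proof -
    have "j \<in> {0, 1, 2}" "k \<in> {0, 1, 2}" using jkl by blast+
    thus "j < 3" "k < 3" by auto
  qed
  have main: "runs (\<lambda>s. (coloured c v \<and> stuck c v \<and> H c) \<and> nreg s ''v'' = v \<and> nreg s ''h'' = v \<and> holds c s)
      (Seq ?set walk) (cost ?set + walk_time n) ?Q" for c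
  proof (rule runs_fact)
    assume c: "coloured c v \<and> stuck c v \<and> H c"
    define \<alpha> \<beta> where "\<alpha> = c (nb v j)" and "\<beta> = c (nb v k)"
    have Nv: "N v = {nb v j, nb v k, nb v l}" by (rule N_perm[OF jkl])
    have st: "stuck c v" using c by auto
    note sc = stuck_colours[OF st Nv]
    have tc: "two_colours \<alpha> \<beta>" using sc by (simp add: \<alpha>_def \<beta>_def)
    have pr: "proper c" and v0: "c v = 0" using c unfolding coloured_def stuck_def by auto
    have "c (nb v l) \<noteq> \<alpha>" "\<beta> \<noteq> \<alpha>" using sc(2) tc alt_colours(3)[OF tc, of 1] unfolding two_colours_def alt_def \<alpha>_def \<beta>_def by auto
    hence ep: "endpoint c \<alpha> v" unfolding endpoint_def Nv \<beta>_def by auto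
    have S: "runs (\<lambda>s. nreg s ''v'' = v \<and> nreg s ''h'' = v \<and> holds c s) ?set (cost ?set)
       (\<lambda>s. holds c s \<and> nreg s ''h'' = v \<and> nreg s ''v'' = v \<and> nreg s ''a'' = \<alpha> \<and> nreg s ''b'' = \<beta>)"
    proof (rule runs_straight)
      fix s assume s: "nreg s ''v'' = v \<and> nreg s ''h'' = v \<and> holds c s"
      have nv: "nval (nbr (NReg ''v'') i) (s\<lparr>nreg := (nreg s)(''a'' := y)\<rparr>) = nb v i" if "i < 3" for i y
        using nval_nbr[of c "s\<lparr>nreg := (nreg s)(''a'' := y)\<rparr>" "NReg ''v''" i] that s v by simp
      have "nval (nbr (NReg ''v'') i) s = nb v i" if "i < 3" for i
        using nval_nbr[of c s "NReg ''v''" i] that s v by simp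
      thus "holds c (effect ?set s) \<and> nreg (effect ?set s) ''h'' = v \<and> nreg (effect ?set s) ''v'' = v \<and>
          nreg (effect ?set s) ''a'' = \<alpha> \<and> nreg (effect ?set s) ''b'' = \<beta>"
        using s jk nv holds_machine[of c s] by (simp add: \<alpha>_def \<beta>_def)
    qed simp
    from runs_Seq[OF S runs_walk[OF tc v v0 pr ep]]
    show "runs (\<lambda>s. nreg s ''v'' = v \<and> nreg s ''h'' = v \<and> holds c s) (Seq ?set walk) (cost ?set + walk_time n) ?Q"
    proof (rule runs_post)
      fix s assume "nreg s ''v'' = v \<and> (nreg s ''f'' = 2 \<longrightarrow> nreg s ''h'' = v) \<and>
        (\<exists>c'. holds c' s \<and> walked c \<alpha> \<beta> v c' (nreg s ''f''))"
      then obtain c' where c': "nreg s ''v'' = v" "nreg s ''f'' = 2 \<longrightarrow> nreg s ''h'' = v" "holds c' s"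
        and w: "walked c \<alpha> \<beta> v c' (nreg s ''f'')" by blast
      have pr': "proper c'" using w unfolding walked_def by blast
      from w consider (fill) p i x where "nreg s ''f'' = 0" "track c \<alpha> \<beta> v p i" "shifted c \<alpha> \<beta> p i x c'"
          "x = alt \<alpha> \<beta> (Suc i) \<or> x = 6 - \<alpha> - \<beta>"
        | (ret) p i where "nreg s ''f'' = 2" "returned c \<alpha> \<beta> v p i c'"
        unfolding walked_def by blast
      thus "?Q s"
      proof cases
        case fill
        have "coloured c' (Suc v)"
          by (rule shifted_coloured[OF tc fill(2,3)]) (use fill(4) alt_colours[OF tc] c pr' in auto)
        thus ?thesis using fill(1) c' unfolding status_def by blast
      next
        case ret
        have "coloured c' v" by (rule returned_coloured[OF tc ret(2) v0]) (use c pr' in auto)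
        moreover have "stuck c' v" using returned_ends(6)[OF st Nv] ret(2) \<alpha>_def \<beta>_def by blast
        moreover have "went v j k c c'" unfolding went_def using st ret(2) \<alpha>_def \<beta>_def by blast
        ultimately show ?thesis using ret(1) c c' unfolding status_def by blast
      qed
    qed
  qed
  have T: "runs (\<lambda>s. status v H s \<and> bval (NEq (NReg ''f'') (NConst 2)) s) (Seq ?set walk) (cost ?set + walk_time n) ?Q"
  proof (rule runs_pre)
    show "runs (\<lambda>s. \<exists>c. (coloured c v \<and> stuck c v \<and> H c) \<and> nreg s ''v'' = v \<and> nreg s ''h'' = v \<and> holds c s)
      (Seq ?set walk) (cost ?set + walk_time n) ?Q" by (rule runs_ex[OF main])
  qed (auto simp: status_def)
  have F: "runs (\<lambda>s. status v H s \<and> \<not> bval (NEq (NReg ''f'') (NConst 2)) s) Skip (cost Skip) ?Q"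
    by (rule runs_straight) (auto simp: status_def)
  from runs_Cond[OF T F] show ?thesis
    unfolding attempt_def by (rule runs_conseq) (auto simp: attempt_time_def nbr_def)
qed

text \<open>If \<open>v\<close> is still uncoloured, all four walks have returned, which by
  \<open>four_walks\<close> forces the first two neighbours to be adjacent. The proposition
  \<open>A\<close> carries the adjacencies found before.\<close>

lemma runs_attempts:
  assumes v: "v < n" and ijk: "{i, j, k} = {0, 1, 2}"
  shows "runs (status v (\<lambda>_. A)) (attempts i j k) (4 * attempt_time n)
     (status v (\<lambda>_. A \<and> nb v j \<in> N (nb v i)))"
proof -
  have "{i, k, j} = {i, j, k}" "{j, k, i} = {i, j, k}" by blast+
  hence perms: "{i, k, j} = {0, 1, 2}" "{j, k, i} = {0, 1, 2}" unfolding ijk by blast+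
  note r = runs_attempt[OF v ijk] runs_attempt[OF v perms(1)] runs_attempt[OF v perms(2)]
  note R = runs_Seq[OF r(1) runs_Seq[OF r(2) runs_Seq[OF r(3) r(1)]], of "\<lambda>_. A"]
  have Nv: "N v = {nb v i, nb v j, nb v k}" by (rule N_perm[OF ijk])
  have key: "nb v j \<in> N (nb v i)"
    if "went v i j c\<^sub>0 c\<^sub>1" "went v i k c\<^sub>1 c\<^sub>2" "went v j k c\<^sub>2 c\<^sub>3" "went v i j c\<^sub>3 c\<^sub>4" for c\<^sub>0 c\<^sub>1 c\<^sub>2 c\<^sub>3 c\<^sub>4
    using four_walks[OF _ Nv] that unfolding went_def by blast
  show ?thesis unfolding attempts_def
    by (rule runs_conseq[OF R]) (use key in \<open>auto simp: status_def\<close>)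
qed

lemma runs_place:
  assumes v: "v < n" and noK4: "\<exists>x\<in>N v. \<exists>y\<in>N v. x \<noteq> y \<and> y \<notin> N x"
  shows "runs (\<lambda>s. (\<exists>c. holds c s \<and> coloured c v) \<and> nreg s ''v'' = v) place (place_time n)
    (\<lambda>s. (\<exists>c. holds c s \<and> coloured c (Suc v)) \<and> nreg s ''v'' = v)"
proof -
  let ?Q = "\<lambda>s. (\<exists>c. holds c s \<and> coloured c (Suc v)) \<and> nreg s ''v'' = v"
  let ?ini = "Seq (NAssign ''h'' (NReg ''v'')) (NAssign ''f'' (NConst 2))"
  \<comment> \<open>The set \<open>A\<close> collects the colours that the tests have found on the
    neighbours.\<close>
  define P where "P A s \<longleftrightarrow> (\<exists>c. holds c s \<and> coloured c v \<and> A \<subseteq> c ` N v) \<and> nreg s ''v'' = v" for A s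
  have st: "runs (\<lambda>s. P A s \<and> bval (absent (NConst j) (NReg ''v'')) s)
      (NStore ''machine'' (NReg ''v'') (NConst j)) (cost (NStore ''machine'' (NReg ''v'') (NConst j))) ?Q"
    if j: "j \<in> {1, 2, 3}" for A j
  proof (rule runs_straight)
    fix s assume s: "P A s \<and> bval (absent (NConst j) (NReg ''v'')) s"
    then obtain c where c: "holds c s" "coloured c v" "nreg s ''v'' = v" unfolding P_def by auto
    have "j \<notin> c ` N v" using bval_absent[OF c(1), of "NReg ''v''" "NConst j"] c s v by simp
    hence "proper (c(v := j))" using c(2) v j unfolding coloured_def by (intro proper_fill) auto
    hence "coloured (c(v := j)) (Suc v)" using c(2) v j unfolding coloured_def by auto
    moreover have "holds (c(v := j)) (effect (NStore ''machine'' (NReg ''v'') (NConst j)) s)"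
      using c by (simp add: holds_def)
    ultimately show "?Q (effect (NStore ''machine'' (NReg ''v'') (NConst j)) s)" using c(3) by auto
  qed simp
  have ab: "P (insert j A) s" if "P A s \<and> \<not> bval (absent (NConst j) (NReg ''v'')) s" for A j s
    using that bval_absent[of _ s "NReg ''v''" "NConst j"] v unfolding P_def by auto
  have "runs (P {3, 2, 1}) ?ini (cost ?ini) (status v (\<lambda>_. True))"
  proof (rule runs_straight)
    fix s assume "P {3, 2, 1} s"
    then obtain c where c: "holds c s" "coloured c v" "{1, 2, 3} \<subseteq> c ` N v" "nreg s ''v'' = v" unfolding P_def by auto
    \<comment> \<open>Three neighbours cannot show 0 besides the three colours.\<close>
    have zero: "0 \<notin> c ` N v"
    proof
      assume "0 \<in> c ` N v"
      hence "{0, 1, 2, 3} \<subseteq> c ` N v" using c(3) by blast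
      hence "card {0, 1, 2, 3::nat} \<le> card (c ` N v)" by (intro card_mono) auto
      also have "\<dots> \<le> card (N v)" by (rule card_image_le) simp
      finally show False using N_card[OF v] by simp
    qed
    have "c ` N v \<subseteq> {1, 2, 3}"
    proof
      fix a assume a: "a \<in> c ` N v"
      then obtain w where "w \<in> N v" "a = c w" by blast
      hence "a \<le> 3" using c(2) N_ltD[OF v] unfolding coloured_def proper_def by blast
      moreover have "a \<noteq> 0" using a zero by metis
      ultimately show "a \<in> {1, 2, 3}" by auto
    qed
    hence "c ` N v = {1, 2, 3}" using c(3) by (rule equalityI)
    hence "stuck c v" using c v unfolding stuck_def coloured_def by auto
    thus "status v (\<lambda>_. True) (effect ?ini s)" using c unfolding status_def by auto
  qed simp
  note E = runs_Seq[OF this runs_Seq[OF runs_attempts[OF v] runs_Seq[OF runs_attempts[OF v] runs_attempts[OF v]]]]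
  have E: "runs (P {3, 2, 1}) (Seq ?ini (Seq (attempts 0 1 2) (Seq (attempts 0 2 1) (attempts 1 2 0))))
      (cost ?ini + (4 * attempt_time n + (4 * attempt_time n + 4 * attempt_time n))) ?Q"
  proof (rule runs_post[OF E])
    fix s assume s: "status v (\<lambda>_. ((True \<and> nb v 1 \<in> N (nb v 0)) \<and> nb v 2 \<in> N (nb v 0)) \<and> nb v 2 \<in> N (nb v 1)) s"
    have "\<not> (nb v 1 \<in> N (nb v 0) \<and> nb v 2 \<in> N (nb v 0) \<and> nb v 2 \<in> N (nb v 1))"
    proof
      assume a: "nb v 1 \<in> N (nb v 0) \<and> nb v 2 \<in> N (nb v 0) \<and> nb v 2 \<in> N (nb v 1)"
      have lt: "nb v 0 < n" "nb v 1 < n" "nb v 2 < n" using N_ltD[OF v] by (auto simp: N_def)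
      have "nb v 0 \<in> N (nb v 1)" "nb v 0 \<in> N (nb v 2)" "nb v 1 \<in> N (nb v 2)"
        using a N_sym[OF lt(2,1)] N_sym[OF lt(3,1)] N_sym[OF lt(3,2)] by blast+
      thus False using noK4 a by (auto simp: N_def[of v])
    qed
    thus "?Q s" using s unfolding status_def by blast
  qed auto
  have m: "1 \<in> {1, 2, 3::nat}" "2 \<in> {1, 2, 3::nat}" "3 \<in> {1, 2, 3::nat}" by auto
  note C3 = runs_Cond[OF st[OF m(3)] runs_pre[OF E ab[where A = "{2, 1}" and j = 3]]]
  note C2 = runs_Cond[OF st[OF m(2)] runs_pre[OF C3 ab[where A = "{1}" and j = 2]]]
  note C1 = runs_Cond[OF st[OF m(1)] runs_pre[OF C2 ab[where A = "{}" and j = 1]]]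
  from C1 show ?thesis unfolding place_def
    by (rule runs_conseq) (auto simp: P_def place_time_def absent_def nbr_def)
qed

lemma runs_colour:
  assumes noK4: "\<And>v. v < n \<Longrightarrow> \<exists>x\<in>N v. \<exists>y\<in>N v. x \<noteq> y \<and> y \<notin> N x"
  shows "runs (holds (\<lambda>_. 0)) (For ''v'' place) (2 + (n + 1) * (place_time n + 8))
    (\<lambda>s. \<exists>c. holds c s \<and> colouring c)"
proof -
  have "runs (\<lambda>s. (\<exists>c. holds c s \<and> coloured c 0) \<and> nreg s ''n'' = n) (For ''v'' place) (2 + (n + 1) * (place_time n + 8))
    (\<lambda>s. (\<exists>c. holds c s \<and> coloured c n) \<and> nreg s ''n'' = n)"
  proof (rule runs_For)
    fix v assume v: "v < n"
    show "runs (\<lambda>s. (\<exists>c. holds c s \<and> coloured c v) \<and> nreg s ''v'' = v \<and> nreg s ''n'' = n) place (place_time n)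
       (\<lambda>s. (\<exists>c. holds c s \<and> coloured c (Suc v)) \<and> nreg s ''v'' = v \<and> nreg s ''n'' = n)"
      by (rule runs_conseq[OF runs_place[OF v noK4[OF v]]]) (auto simp: holds_n)
  qed auto
  thus ?thesis
  proof (rule runs_conseq)
    fix s assume "holds (\<lambda>_. 0) s"
    thus "(\<exists>c. holds c s \<and> coloured c 0) \<and> nreg s ''n'' = n"
      using holds_n by (auto simp: coloured_def proper_def)
  next
    fix s assume "(\<exists>c. holds c s \<and> coloured c n) \<and> nreg s ''n'' = n"
    then obtain c where c: "holds c s" "coloured c n" by auto
    have "c u \<in> {1, 2, 3} \<and> c u \<notin> c ` N u" if "u < n" for u
    proof -
      have "c u \<le> 3" "c u \<noteq> 0" "c u \<notin> c ` N u" using c(2) that unfolding coloured_def proper_def by auto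
      thus ?thesis by auto
    qed
    thus "\<exists>c. holds c s \<and> colouring c" using c unfolding colouring_def by blast
  qed simp
qed

end

section \<open>Adjusting the class sizes\<close>

abbreviation cnt :: "nat \<Rightarrow> nexp" where
  "cnt j \<equiv> NArr ''cnt'' (NConst j)"

text \<open>The sweeps that depend on class sizes recount them at every vertex instead of updating
  them: a linear cost per vertex, like that of a walk.\<close>

definition count :: com where
  "count = Seq
     (Seq (NStore ''cnt'' (NConst 1) (NConst 0))
       (Seq (NStore ''cnt'' (NConst 2) (NConst 0)) (NStore ''cnt'' (NConst 3) (NConst 0))))
     (For ''i'' (NStore ''cnt'' (colr (NReg ''i'')) (NAdd (NArr ''cnt'' (colr (NReg ''i''))) (NConst 1))))"

definition count_time :: "nat \<Rightarrow> nat" where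
  "count_time n = 11 + (n + 1) * 16"

definition exchange :: "nat \<Rightarrow> com" where
  "exchange j = For ''v'' (Cond (NEq (colr (NReg ''v'')) (NConst 1)) (NStore ''machine'' (NReg ''v'') (NConst j))
     (Cond (NEq (colr (NReg ''v'')) (NConst j)) (NStore ''machine'' (NReg ''v'') (NConst 1)) Skip))"

definition lead :: "nat \<Rightarrow> com" where
  "lead j = Seq count (Cond (NLess (cnt 1) (cnt j)) (exchange j) Skip)"

definition absorb :: com where
  "absorb = Cond (absent (NConst 1) (NReg ''v'')) (NStore ''machine'' (NReg ''v'') (NConst 1)) Skip"

definition twice :: "nat \<Rightarrow> nat \<Rightarrow> nat \<Rightarrow> bexp" where
  "twice \<alpha> i j = BAnd (NEq (colr (nbr (NReg ''v'') i)) (NConst \<alpha>)) (NEq (colr (nbr (NReg ''v'') j)) (NConst \<alpha>))"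

text \<open>A flip is made only for a surplus of at least 2. It transfers at most one vertex, so it
  cannot reverse the order of the two classes.\<close>

definition unbalanced_end :: "nat \<Rightarrow> nat \<Rightarrow> bexp" where
  "unbalanced_end \<alpha> \<beta> =
    BAnd (BAnd (NEq (colr (NReg ''v'')) (NConst \<beta>)) (NLess (NAdd (cnt \<alpha>) (NConst 1)) (cnt \<beta>)))
      (BAnd (BNot (twice \<alpha> 0 1)) (BAnd (BNot (twice \<alpha> 0 2)) (BNot (twice \<alpha> 1 2))))"

text \<open>Uncolouring the end of a path turns the flip into a walk of an uncoloured vertex, whose
  third colour is 1.\<close>

definition flip_setup :: "nat \<Rightarrow> nat \<Rightarrow> com" where
  "flip_setup \<alpha> \<beta> = Seq (NAssign ''h'' (NReg ''v'')) (Seq (NStore ''machine'' (NReg ''v'') (NConst 0))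
     (Seq (NAssign ''a'' (NConst \<alpha>)) (NAssign ''b'' (NConst \<beta>))))"

definition flip :: "nat \<Rightarrow> nat \<Rightarrow> com" where
  "flip \<alpha> \<beta> = Seq count (Cond (unbalanced_end \<alpha> \<beta>) (Seq (flip_setup \<alpha> \<beta>) walk) Skip)"

definition isolated :: "nexp \<Rightarrow> bexp" where
  "isolated e = BAnd (NEq (colr (nbr e 0)) (NConst 1))
     (BAnd (NEq (colr (nbr e 1)) (NConst 1)) (NEq (colr (nbr e 2)) (NConst 1)))"

definition move :: "nat \<Rightarrow> nat \<Rightarrow> nat \<Rightarrow> com \<Rightarrow> com" where
  "move i j k d = Cond (BAnd (isolated (nbr (NReg ''v'') i)) (isolated (nbr (NReg ''v'') j)))
     (Seq (NAssign ''a'' (colr (nbr (NReg ''v'') k)))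
     (Seq (NStore ''machine'' (nbr (NReg ''v'') i) (NReg ''a''))
     (Seq (NStore ''machine'' (nbr (NReg ''v'') j) (NReg ''a''))
       (NStore ''machine'' (NReg ''v'') (NSub (NConst 5) (NReg ''a'')))))) d"

definition times :: "nat \<Rightarrow> nexp \<Rightarrow> nexp" where
  "times k e = ((NAdd e) ^^ k) (NConst 0)"

definition shrink :: com where
  "shrink = Cond (BAnd (NLess (times 4 (NReg ''n'')) (times 9 (cnt 1))) (NEq (colr (NReg ''v'')) (NConst 1)))
     (move 0 1 2 (move 0 2 1 (move 1 2 0 Skip))) Skip"

definition even_out :: com where
  "even_out = Cond (isolated (NReg ''v''))
     (Cond (BAnd (NEq (colr (NReg ''v'')) (NConst 2)) (NLess (NAdd (cnt 3) (NConst 1)) (cnt 2)))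
       (NStore ''machine'' (NReg ''v'') (NConst 3))
     (Cond (BAnd (NEq (colr (NReg ''v'')) (NConst 3)) (NLess (NAdd (cnt 2) (NConst 1)) (cnt 3)))
       (NStore ''machine'' (NReg ''v'') (NConst 2)) Skip)) Skip"

lemma nval_times [simp]: "nval (times k e) s = k * nval e s"
  unfolding times_def by (induction k) auto

context cubic_lists begin

definition counted :: "(nat \<Rightarrow> nat) \<Rightarrow> ram_state \<Rightarrow> bool" where
  "counted c s \<longleftrightarrow> (\<forall>j\<in>{1, 2, 3}. narr s ''cnt'' j = num c {..<n} j)"

lemma holds_narr [simp]:
  "a ''adj'' = narr s ''adj'' \<Longrightarrow> a ''machine'' = narr s ''machine'' \<Longrightarrow> holds c (s\<lparr>narr := a\<rparr>) = holds c s"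
  by (simp add: holds_def)

lemma holds_upd: "holds c s \<Longrightarrow>
    holds (c(x := y)) (s\<lparr>narr := (narr s)(''machine'' := (narr s ''machine'')(x := y))\<rparr>)"
  by (simp add: holds_def)

lemma num_Suc: "num c {..<Suc i} j = num c {..<i} j + (if c i = j then 1 else 0)"
proof -
  have "{x \<in> {..<Suc i}. c x = j} = (if c i = j then insert i {x \<in> {..<i}. c x = j} else {x \<in> {..<i}. c x = j})"
    by (auto simp: less_Suc_eq)
  thus ?thesis by (simp add: num_def)
qed

lemma runs_count:
  "runs (\<lambda>s. nreg s ''v'' = v \<and> holds c s) count (count_time n) (\<lambda>s. nreg s ''v'' = v \<and> holds c s \<and> counted c s)"
proof -
  let ?init = "Seq (NStore ''cnt'' (NConst 1) (NConst 0))
       (Seq (NStore ''cnt'' (NConst 2) (NConst 0)) (NStore ''cnt'' (NConst 3) (NConst 0)))"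
  let ?body = "NStore ''cnt'' (colr (NReg ''i'')) (NAdd (NArr ''cnt'' (colr (NReg ''i''))) (NConst 1))"
  define I where "I i s \<longleftrightarrow> nreg s ''v'' = v \<and> holds c s \<and> (\<forall>j\<in>{1, 2, 3}. narr s ''cnt'' j = num c {..<i} j)"
    for i :: nat and s :: ram_state
  have "runs (\<lambda>s. nreg s ''v'' = v \<and> holds c s) ?init (cost ?init) (\<lambda>s. I 0 s \<and> nreg s ''n'' = n)"
    by (rule runs_straight) (auto simp: I_def num_def holds_n)
  moreover have "runs (\<lambda>s. I 0 s \<and> nreg s ''n'' = n) (For ''i'' ?body) (2 + (n + 1) * (cost ?body + 8))
     (\<lambda>s. I n s \<and> nreg s ''n'' = n)"
  proof (rule runs_For)
    fix i
    show "runs (\<lambda>s. I i s \<and> nreg s ''i'' = i \<and> nreg s ''n'' = n) ?body (cost ?body)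
        (\<lambda>s. I (Suc i) s \<and> nreg s ''i'' = i \<and> nreg s ''n'' = n)"
    proof (rule runs_straight)
      fix s assume s: "I i s \<and> nreg s ''i'' = i \<and> nreg s ''n'' = n"
      hence "narr s ''machine'' = c" unfolding I_def holds_def by auto
      moreover have "((narr s ''cnt'')(c i := narr s ''cnt'' (c i) + 1)) j = num c {..<Suc i} j" if "j \<in> {1, 2, 3}" for j
      proof -
        have "narr s ''cnt'' j = num c {..<i} j" using that s unfolding I_def by blast
        thus ?thesis by (cases "c i = j") (simp_all add: num_Suc)
      qed
      ultimately show "I (Suc i) (effect ?body s) \<and> nreg (effect ?body s) ''i'' = i \<and> nreg (effect ?body s) ''n'' = n"
        using s by (simp add: I_def)
    qed simp
  qed (auto simp: I_def)
  ultimately show ?thesis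
    unfolding count_def by (rule runs_conseq[OF runs_Seq]) (auto simp: I_def counted_def count_time_def)
qed

lemma runs_sweep:
  assumes "\<And>v. v < n \<Longrightarrow> runs (\<lambda>s. nreg s ''v'' = v \<and> (\<exists>c. I v c \<and> holds c s)) b t
      (\<lambda>s. nreg s ''v'' = v \<and> (\<exists>c. I (Suc v) c \<and> holds c s))"
  shows "runs (\<lambda>s. \<exists>c. I 0 c \<and> holds c s) (For ''v'' b) (2 + (n + 1) * (t + 8)) (\<lambda>s. \<exists>c. I n c \<and> holds c s)"
proof -
  have "runs (\<lambda>s. (\<exists>c. I 0 c \<and> holds c s) \<and> nreg s ''n'' = n) (For ''v'' b) (2 + (n + 1) * (t + 8))
    (\<lambda>s. (\<exists>c. I n c \<and> holds c s) \<and> nreg s ''n'' = n)"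
    by (rule runs_For; (rule runs_conseq[OF assms])?) (auto simp: holds_n)
  thus ?thesis by (rule runs_conseq) (auto simp: holds_n)
qed

lemma runs_local:
  assumes "straight b"
    and "\<And>c s. I c \<Longrightarrow> holds c s \<Longrightarrow> nreg s ''v'' = v \<Longrightarrow>
      nreg (effect b s) ''v'' = v \<and> (\<exists>c'. J c' \<and> holds c' (effect b s))"
  shows "runs (\<lambda>s. nreg s ''v'' = v \<and> (\<exists>c. I c \<and> holds c s)) b (cost b)
      (\<lambda>s. nreg s ''v'' = v \<and> (\<exists>c. J c \<and> holds c s))"
  by (rule runs_straight[OF assms(1)]) (use assms(2) in blast)

text \<open>The colouring is fixed before \<open>b\<close> is analysed, so a guard on the counters
  becomes a proposition about \<open>c\<close> that no longer mentions the state.\<close>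

lemma runs_counting:
  assumes "\<And>c. I c \<Longrightarrow> runs (\<lambda>s. nreg s ''v'' = v \<and> holds c s \<and> counted c s) b t Q"
  shows "runs (\<lambda>s. nreg s ''v'' = v \<and> (\<exists>c. I c \<and> holds c s)) (Seq count b) (count_time n + t) Q"
proof -
  have "runs (\<lambda>s. \<exists>c. I c \<and> nreg s ''v'' = v \<and> holds c s) (Seq count b) (count_time n + t) Q"
    by (rule runs_ex, rule runs_fact, rule runs_Seq[OF runs_count assms])
  thus ?thesis by (rule runs_pre) auto
qed

lemma runs_counting_straight:
  assumes "straight b"
    and "\<And>c s. I c \<Longrightarrow> holds c s \<Longrightarrow> counted c s \<Longrightarrow> nreg s ''v'' = v \<Longrightarrow>
      nreg (effect b s) ''v'' = v \<and> (\<exists>c'. J c' \<and> holds c' (effect b s))"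
  shows "runs (\<lambda>s. nreg s ''v'' = v \<and> (\<exists>c. I c \<and> holds c s)) (Seq count b) (count_time n + cost b)
      (\<lambda>s. nreg s ''v'' = v \<and> (\<exists>c. J c \<and> holds c s))"
  by (rule runs_counting, rule runs_straight[OF assms(1)]) (use assms(2) in blast)

section \<open>Making class 1 a largest class\<close>

definition transposed :: "nat \<Rightarrow> nat \<Rightarrow> nat" where
  "transposed j a = (if a = 1 then j else if a = j then 1 else a)"

lemma runs_exchange:
  assumes j: "j \<in> {2, 3}"
  shows "runs (holds c) (exchange j) (2 + (n + 1) * 40) (\<lambda>s. \<exists>c'. holds c' s \<and> (\<forall>u<n. c' u = transposed j (c u)))"
proof -
  define I where "I i c' \<longleftrightarrow> (\<forall>u. c' u = (if u < i then transposed j (c u) else c u))" for i c'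
  let ?b = "Cond (NEq (colr (NReg ''v'')) (NConst 1)) (NStore ''machine'' (NReg ''v'') (NConst j))
     (Cond (NEq (colr (NReg ''v'')) (NConst j)) (NStore ''machine'' (NReg ''v'') (NConst 1)) Skip)"
  have "runs (\<lambda>s. nreg s ''v'' = v \<and> (\<exists>c. I v c \<and> holds c s)) ?b (cost ?b)
      (\<lambda>s. nreg s ''v'' = v \<and> (\<exists>c. I (Suc v) c \<and> holds c s))" for v
  proof (rule runs_local)
    fix c' s assume I: "I v c'" and h: "holds c' s" and v: "nreg s ''v'' = v"
    have m: "narr s ''machine'' = c'" using h by (simp add: holds_def)
    have "I (Suc v) (c'(v := transposed j (c v)))" using I by (auto simp: I_def less_Suc_eq)
    moreover have "c' v = c v" using I by (simp add: I_def)
    hence "holds (c'(v := transposed j (c v))) (effect ?b s)"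
      using holds_upd[OF h, of v "transposed j (c v)"] h v m
      by (auto simp: transposed_def fun_upd_idem)
    moreover have "nreg (effect ?b s) ''v'' = v" using v by simp
    ultimately show "nreg (effect ?b s) ''v'' = v \<and> (\<exists>c'. I (Suc v) c' \<and> holds c' (effect ?b s))" by blast
  qed simp
  from runs_sweep[of I, OF this] show ?thesis unfolding exchange_def
    by (rule runs_conseq) (auto simp: I_def)
qed

lemma transposed_effect:
  assumes col: "colouring c" and j: "j \<in> {2, 3}" and c': "\<And>u. u < n \<Longrightarrow> c' u = transposed j (c u)"
  shows "colouring c'" "num c' {..<n} 1 = num c {..<n} j" "num c' {..<n} j = num c {..<n} 1"
    "num c' {..<n} (5 - j) = num c {..<n} (5 - j)"
proof -
  have inj: "transposed j a = transposed j b \<longleftrightarrow> a = b" for a b by (auto simp: transposed_def)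
  show "colouring c'"
    unfolding colouring_def
  proof (intro allI impI conjI)
    fix u assume u: "u < n"
    show "c' u \<in> {1, 2, 3}" using colouring_cases[OF col u] c'[OF u] j by (auto simp: transposed_def)
    show "c' u \<notin> c' ` N u"
    proof
      assume "c' u \<in> c' ` N u"
      then obtain w where w: "w \<in> N u" "c' w = c' u" by auto
      hence "c w = c u" using c'[OF u] c'[OF N_ltD[OF u w(1)]] inj by simp
      thus False using colouring_neq[OF col u w(1)] by simp
    qed
  qed
  have n: "num c' {..<n} (transposed j a) = num c {..<n} a" for a
    unfolding num_def using c' inj by (intro arg_cong[where f = card]) auto
  show "num c' {..<n} 1 = num c {..<n} j" "num c' {..<n} j = num c {..<n} 1"
    "num c' {..<n} (5 - j) = num c {..<n} (5 - j)"
    using n[of j] n[of 1] n[of "5 - j"] j by (auto simp: transposed_def)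
qed

text \<open>The other class besides \<open>j\<close> and 1 has number \<open>5 - j\<close>. An
  exchange takes place only if it enlarges class 1, so what an earlier call achieved for that class
  survives; \<open>A\<close> tells whether there was such a call.\<close>

lemma runs_lead:
  assumes j: "j \<in> {2, 3}"
  shows "runs (\<lambda>s. \<exists>c. colouring c \<and> (A \<longrightarrow> num c {..<n} (5 - j) \<le> num c {..<n} 1) \<and> holds c s)
    (lead j) (count_time n + 50 + (n + 1) * 40)
    (\<lambda>s. \<exists>c. colouring c \<and> num c {..<n} j \<le> num c {..<n} 1 \<and> (A \<longrightarrow> num c {..<n} (5 - j) \<le> num c {..<n} 1) \<and> holds c s)"
    (is "runs ?P _ _ ?Q")
proof -
  let ?I = "\<lambda>c. colouring c \<and> (A \<longrightarrow> num c {..<n} (5 - j) \<le> num c {..<n} 1)"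
  let ?b = "NLess (cnt 1) (cnt j)"
  have "runs (\<lambda>s. nreg s ''v'' = v \<and> (\<exists>c. ?I c \<and> holds c s)) (lead j) (count_time n + (50 + (n + 1) * 40)) ?Q" for v
    unfolding lead_def
  proof (rule runs_counting)
    fix c assume I: "?I c"
    have T: "runs (\<lambda>s. (nreg s ''v'' = v \<and> holds c s \<and> counted c s) \<and> bval ?b s) (exchange j) (2 + (n + 1) * 40) ?Q"
    proof -
      have "runs (\<lambda>s. num c {..<n} 1 < num c {..<n} j \<and> holds c s) (exchange j) (2 + (n + 1) * 40) ?Q"
      proof (rule runs_fact, rule runs_post[OF runs_exchange[OF j]])
        fix s assume lt: "num c {..<n} 1 < num c {..<n} j" and "\<exists>c'. holds c' s \<and> (\<forall>u<n. c' u = transposed j (c u))"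
        then obtain c' where c': "holds c' s" "\<And>u. u < n \<Longrightarrow> c' u = transposed j (c u)" by blast
        have "colouring c" using I by simp
        note te = transposed_effect[OF this j c'(2)]
        show "?Q s" using te lt I c'(1) by (intro exI[of _ c']) auto
      qed
      thus ?thesis by (rule runs_pre) (use j in \<open>auto simp: counted_def\<close>)
    qed
    have F: "runs (\<lambda>s. (nreg s ''v'' = v \<and> holds c s \<and> counted c s) \<and> \<not> bval ?b s) Skip (cost Skip) ?Q"
      by (rule runs_straight) (use I j in \<open>auto simp: counted_def not_less\<close>)
    from runs_Cond[OF T F]
    show "runs (\<lambda>s. nreg s ''v'' = v \<and> holds c s \<and> counted c s) (Cond ?b (exchange j) Skip) (50 + (n + 1) * 40) ?Q"
      by (rule runs_conseq) auto
  qed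
  hence "runs (\<lambda>s. \<exists>v. nreg s ''v'' = v \<and> (\<exists>c. ?I c \<and> holds c s)) (lead j) (count_time n + (50 + (n + 1) * 40)) ?Q"
    by (rule runs_ex)
  thus ?thesis by (rule runs_conseq) auto
qed

text \<open>A largest class contains a third of the vertices. This form of the fact passes through
  the later phases, where class 1 grows or is left alone, and it leaves the other two classes at
  most 2 n / 3 vertices together.\<close>

definition pre_balanced :: "(nat \<Rightarrow> nat) \<Rightarrow> bool" where
  "pre_balanced c \<longleftrightarrow> colouring c \<and> n \<le> 3 * num c {..<n} 1"

text \<open>One sweep suffices: class 1 only grows, so a vertex with a neighbour in it keeps that
  neighbour.\<close>

lemma runs_absorb:
  "runs (\<lambda>s. \<exists>c. pre_balanced c \<and> holds c s) (For ''v'' absorb) (2 + (n + 1) * (cost absorb + 8))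
     (\<lambda>s. \<exists>c. (pre_balanced c \<and> dominating c) \<and> holds c s)"
proof -
  define I where "I i c \<longleftrightarrow> pre_balanced c \<and> (\<forall>u<i. c u \<noteq> 1 \<longrightarrow> 1 \<in> c ` N u)" for i c
  have "runs (\<lambda>s. nreg s ''v'' = v \<and> (\<exists>c. I v c \<and> holds c s)) absorb (cost absorb)
      (\<lambda>s. nreg s ''v'' = v \<and> (\<exists>c. I (Suc v) c \<and> holds c s))" if v: "v < n" for v
  proof (rule runs_local)
    show "straight absorb" by (simp add: absorb_def)
    fix c s assume I: "I v c" and h: "holds c s" and nv: "nreg s ''v'' = v"
    have col: "colouring c" using I by (simp add: I_def pre_balanced_def)
    have b: "bval (absent (NConst 1) (NReg ''v'')) s \<longleftrightarrow> 1 \<notin> c ` N v"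
      using bval_absent[OF h, of "NReg ''v''" "NConst 1"] v nv by simp
    show "nreg (effect absorb s) ''v'' = v \<and> (\<exists>c'. I (Suc v) c' \<and> holds c' (effect absorb s))"
    proof (cases "1 \<in> c ` N v")
      case True
      hence "I (Suc v) c" using I by (auto simp: I_def less_Suc_eq)
      thus ?thesis using True b h nv by (auto simp: absorb_def)
    next
      case False
      let ?c = "c(v := 1)"
      have "colouring ?c" by (rule colouring_upd[OF col v]) (use False in auto)
      moreover have "num c {..<n} 1 \<le> num ?c {..<n} 1" unfolding num_def by (rule card_mono) auto
      moreover have "1 \<in> ?c ` N u" if "1 \<in> c ` N u" for u
        using that by (auto simp: image_iff)
      ultimately have "I (Suc v) ?c" using I by (auto simp: I_def pre_balanced_def less_Suc_eq)
      moreover have "holds ?c (effect absorb s)" using False b nv holds_upd[OF h, of v 1] by (simp add: absorb_def)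
      ultimately show ?thesis using False b nv by (auto simp: absorb_def)
    qed
  qed
  from runs_sweep[of I, OF this] show ?thesis
    by (rule runs_conseq) (auto simp: I_def dominating_def)
qed

lemma straight_bits: "straight (flip_setup \<alpha> \<beta>)" "straight shrink" "straight even_out"
  by (simp_all add: flip_setup_def shrink_def move_def even_out_def)

section \<open>Balancing classes 2 and 3 by path flips\<close>

lemma bval_endpoint:
  assumes "holds c s" "nreg s ''v'' = v" "v < n"
  shows "bval (BAnd (BNot (twice \<alpha> 0 1)) (BAnd (BNot (twice \<alpha> 0 2)) (BNot (twice \<alpha> 1 2)))) s \<longleftrightarrow> endpoint c \<alpha> v"
proof -
  have "nval (nbr (NReg ''v'') i) s = nb v i" if "i < 3" for i
    using nval_nbr[of c s "NReg ''v''" i] assms that by simp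
  moreover have "nb v 0 \<noteq> nb v 1" "nb v 0 \<noteq> nb v 2" "nb v 1 \<noteq> nb v 2"
    using N_card[OF assms(3)] by (auto simp: N_def card_insert_if split: if_splits)
  ultimately show ?thesis using holds_machine[OF assms(1)] by (auto simp: endpoint_def N_def twice_def)
qed

text \<open>The walk can end only at the far end of the path. If it returned, \<open>k\<close> would
  be even and \<open>v\<close> would have a neighbour \<open>p k\<close> of its own colour \<beta>.
  Filling with the third colour 1 is impossible, because \<open>p k\<close> has a neighbour in class
  1, and the walk does not touch that class.\<close>

lemma runs_flip_path:
  assumes col: "colouring c" and dom: "dominating c" and ab: "{\<alpha>, \<beta>} = {2, 3}"
    and v: "v < n" "c v = \<beta>" "endpoint c \<alpha> v"
  shows "runs (\<lambda>s. nreg s ''v'' = v \<and> holds c s) (Seq (flip_setup \<alpha> \<beta>) walk) (cost (flip_setup \<alpha> \<beta>) + walk_time n)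
    (\<lambda>s. nreg s ''v'' = v \<and> (\<exists>c' p k. holds c' s \<and> colouring c' \<and> p 0 = v \<and> flipped c \<alpha> \<beta> p k c'))"
proof -
  let ?c = "c(v := 0)"
  have tc: "two_colours \<alpha> \<beta>" and ab1: "\<alpha> \<noteq> 1" "\<beta> \<noteq> 1" "\<alpha> \<noteq> 0" and six: "6 - \<alpha> - \<beta> = 1"
    using ab by (auto simp: two_colours_def doubleton_eq_iff)
  note ac = alt_colours[OF tc]
  have pr: "proper ?c"
  proof (rule proper_fill)
    have "c u \<le> 3 \<and> c u \<notin> c ` N u" if "u < n" for u
    proof -
      have "c u \<notin> c ` N u" using col that unfolding colouring_def by blast
      thus ?thesis using colouring_cases[OF col that] by auto
    qed
    thus "proper c" unfolding proper_def by blast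
    show "0 \<notin> c ` N v"
    proof
      assume "0 \<in> c ` N v"
      then obtain w where "w \<in> N v" "c w = 0" by auto
      thus False using colouring_cases[OF col N_ltD[OF v(1)]] by force
    qed
  qed (use v in auto)
  have ep: "endpoint ?c \<alpha> v" using v ab1 unfolding endpoint_def by auto
  have S: "runs (\<lambda>s. nreg s ''v'' = v \<and> holds c s) (flip_setup \<alpha> \<beta>) (cost (flip_setup \<alpha> \<beta>))
     (\<lambda>s. holds ?c s \<and> nreg s ''h'' = v \<and> nreg s ''v'' = v \<and> nreg s ''a'' = \<alpha> \<and> nreg s ''b'' = \<beta>)"
    by (rule runs_straight[OF straight_bits(1)]) (auto simp: flip_setup_def holds_def)
  from runs_Seq[OF S runs_walk[OF tc v(1) _ pr ep]]
  show ?thesis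
  proof (rule runs_post)
    fix s assume "nreg s ''v'' = v \<and> (nreg s ''f'' = 2 \<longrightarrow> nreg s ''h'' = v) \<and>
      (\<exists>c'. holds c' s \<and> walked ?c \<alpha> \<beta> v c' (nreg s ''f''))"
    then obtain c' where nv: "nreg s ''v'' = v" and h: "holds c' s"
      and w: "walked ?c \<alpha> \<beta> v c' (nreg s ''f'')" by blast
    have pr': "proper c'" using w unfolding walked_def by blast
    from w consider (fill) p k x where "track ?c \<alpha> \<beta> v p k" "shifted ?c \<alpha> \<beta> p k x c'" "x \<notin> c' ` N (p k)"
        "x = alt \<alpha> \<beta> (Suc k) \<or> x = 6 - \<alpha> - \<beta>"
      | (ret) p k where "returned ?c \<alpha> \<beta> v p k c'"
      unfolding walked_def by blast
    thus "nreg s ''v'' = v \<and> (\<exists>c' p k. holds c' s \<and> colouring c' \<and> p 0 = v \<and> flipped c \<alpha> \<beta> p k c')"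
    proof cases
      case ret
      hence tr: "track ?c \<alpha> \<beta> v p k" and k: "2 \<le> k" "even k" "v \<in> N (p k)" unfolding returned_def by auto
      have pk: "p k < n" "p k \<noteq> p 0" "p 0 = v"
        using tr k inj_on_eq_iff[of p "{..k}" k 0] unfolding track_def by auto
      have "\<forall>i. 0 < i \<and> i \<le> k \<longrightarrow> ?c (p i) = alt \<alpha> \<beta> i" using tr unfolding track_def by blast
      hence "?c (p k) = alt \<alpha> \<beta> k" by (elim allE[of _ k]) (use k in auto)
      hence "c (p k) = \<beta>" using k pk by (simp add: alt_def)
      thus ?thesis using colouring_neq[OF col pk(1) k(3)] v by simp
    next
      case fill
      have p0: "p 0 = v" and pk: "p k < n" using fill(1) unfolding track_def by auto
      have cpk: "c (p k) \<noteq> 1"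
      proof (cases "k = 0")
        case True
        thus ?thesis using p0 v ab1 by simp
      next
        case False
        hence "p k \<noteq> v" "?c (p k) = alt \<alpha> \<beta> k"
          using fill(1) p0 inj_on_eq_iff[of p "{..k}" k 0] unfolding track_def by auto
        thus ?thesis using ab1 by (auto simp: alt_def)
      qed
      have "x = alt \<alpha> \<beta> (Suc k)"
      proof (rule ccontr)
        assume "x \<noteq> alt \<alpha> \<beta> (Suc k)"
        hence x1: "x = 1" using fill(4) six by auto
        have "1 \<in> c ` N (p k)" using dom pk cpk unfolding dominating_def by blast
        then obtain g where g: "g \<in> N (p k)" "c g = 1" by auto
        have "g \<notin> p ` {..k}"
        proof
          assume "g \<in> p ` {..k}"
          then obtain i where i: "i \<le> k" "g = p i" by auto
          have "i \<noteq> 0" using i g p0 v ab1 by (cases "i = 0") auto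
          hence "p i \<noteq> v" "?c (p i) = alt \<alpha> \<beta> i"
            using fill(1) i p0 inj_on_eq_iff[of p "{..k}" i 0] unfolding track_def by auto
          thus False using i g ab1 by (auto simp: alt_def split: if_splits)
        qed
        moreover have "g \<noteq> v" using g v ab1 by auto
        ultimately have "c' g = 1" using fill(2) g unfolding shifted_def by auto
        thus False using fill(3) x1 g by (metis imageI)
      qed
      note x = this
      have "flipped c \<alpha> \<beta> p k c'"
      proof (rule flip_path[OF col dom ab v fill(1)])
        show "shifted ?c \<alpha> \<beta> p k (alt \<alpha> \<beta> (Suc k)) c'" using fill(2) x by simp
        show "c' w \<noteq> alt \<alpha> \<beta> (Suc k)" if "w \<in> N (p k)" for w using fill(3) x that by (metis imageI)
      qed
      moreover have "colouring c'"
        unfolding colouring_def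
      proof (intro allI impI)
        fix u assume u: "u < n"
        have "c' u \<noteq> 0"
        proof (cases "u \<in> p ` {..k}")
          case True
          then obtain i where "i \<le> k" "u = p i" by auto
          thus ?thesis using fill(2) x ac(1) unfolding shifted_def by (cases "i = k") auto
        next
          case False
          hence "c' u = c u" using fill(2) p0 unfolding shifted_def by auto
          thus ?thesis using colouring_cases[OF col u] by auto
        qed
        hence "c' u \<le> 3" "c' u \<noteq> 0" "c' u \<notin> c' ` N u" using pr' u unfolding proper_def by auto
        thus "c' u \<in> {1, 2, 3} \<and> c' u \<notin> c' ` N u" by auto
      qed
      ultimately show ?thesis using h p0 nv by blast
    qed
  qed simp
qed

text \<open>The invariant demands \<open>settled\<close> only while the surplus of \<beta> is at
  least 2. If the surplus lasts to the end of the sweep, all endpoints are settled and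
  \<open>settled_num_le\<close> contradicts it. The flag \<open>B\<close> preserves the result of
  the call with the roles of the colours exchanged.\<close>

lemma runs_flips:
  assumes ab: "{\<alpha>, \<beta>} = {2, 3}"
  shows "runs (\<lambda>s. \<exists>c. (pre_balanced c \<and> dominating c \<and> (B \<longrightarrow> num c {..<n} \<alpha> \<le> num c {..<n} \<beta> + 1)) \<and> holds c s)
    (For ''v'' (flip \<alpha> \<beta>)) (2 + (n + 1) * (count_time n + (200 + walk_time n) + 8))
    (\<lambda>s. \<exists>c. (pre_balanced c \<and> dominating c \<and> num c {..<n} \<beta> \<le> num c {..<n} \<alpha> + 1 \<and>
        (B \<longrightarrow> num c {..<n} \<alpha> \<le> num c {..<n} \<beta> + 1)) \<and> holds c s)"
proof -
  have ab3: "\<alpha> \<in> {1, 2, 3}" "\<beta> \<in> {1, 2, 3}" using ab by (auto simp: doubleton_eq_iff)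
  define I where "I i c \<longleftrightarrow> pre_balanced c \<and> dominating c \<and> (B \<longrightarrow> num c {..<n} \<alpha> \<le> num c {..<n} \<beta> + 1) \<and>
     (num c {..<n} \<alpha> + 2 \<le> num c {..<n} \<beta> \<longrightarrow> settled c \<alpha> \<beta> i)" for i c
  have "runs (\<lambda>s. nreg s ''v'' = v \<and> (\<exists>c. I v c \<and> holds c s)) (flip \<alpha> \<beta>) (count_time n + (200 + walk_time n))
      (\<lambda>s. nreg s ''v'' = v \<and> (\<exists>c. I (Suc v) c \<and> holds c s))" if v: "v < n" for v
    unfolding flip_def
  proof (rule runs_counting)
    fix c assume I: "I v c"
    have col: "colouring c" and dom: "dominating c" using I by (auto simp: I_def pre_balanced_def)
    let ?Q = "\<lambda>s. nreg s ''v'' = v \<and> (\<exists>c. I (Suc v) c \<and> holds c s)"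
    let ?P = "\<lambda>s. nreg s ''v'' = v \<and> holds c s \<and> counted c s"
    define G where "G \<longleftrightarrow> (c v = \<beta> \<and> num c {..<n} \<alpha> + 2 \<le> num c {..<n} \<beta>) \<and> endpoint c \<alpha> v"
    have G: "bval (unbalanced_end \<alpha> \<beta>) s = G" if "?P s" for s
    proof -
      have "narr s ''cnt'' \<alpha> = num c {..<n} \<alpha>" "narr s ''cnt'' \<beta> = num c {..<n} \<beta>" "narr s ''machine'' = c"
        using that ab3 unfolding counted_def holds_def by blast+
      thus ?thesis using bval_endpoint[of c s v \<alpha>] that v unfolding unbalanced_end_def G_def by auto
    qed
    have "runs (\<lambda>s. G \<and> (nreg s ''v'' = v \<and> holds c s)) (Seq (flip_setup \<alpha> \<beta>) walk) (cost (flip_setup \<alpha> \<beta>) + walk_time n) ?Q"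
    proof (rule runs_fact)
      assume g: "G"
      hence g: "c v = \<beta>" "endpoint c \<alpha> v" "num c {..<n} \<alpha> + 2 \<le> num c {..<n} \<beta>" by (auto simp: G_def)
      show "runs (\<lambda>s. nreg s ''v'' = v \<and> holds c s) (Seq (flip_setup \<alpha> \<beta>) walk) (cost (flip_setup \<alpha> \<beta>) + walk_time n) ?Q"
      proof (rule runs_post[OF runs_flip_path[OF col dom ab v g(1,2)]])
        fix s assume "nreg s ''v'' = v \<and> (\<exists>c' p k. holds c' s \<and> colouring c' \<and> p 0 = v \<and> flipped c \<alpha> \<beta> p k c')"
        then obtain c' p k where s: "nreg s ''v'' = v" "holds c' s" "colouring c'" "p 0 = v" "flipped c \<alpha> \<beta> p k c'" by blast
        have "settled c \<alpha> \<beta> (p 0)" using I g s by (simp add: I_def)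
        note fe = flipped_effect[OF dom ab s(5) this]
        have "num c' {..<n} 1 = num c {..<n} 1" using fe(1) by (simp add: num_def)
        hence "pre_balanced c'" using I s(3) by (simp add: I_def pre_balanced_def)
        moreover obtain \<delta> where "\<delta> \<le> 1" "num c {..<n} \<beta> = num c' {..<n} \<beta> + \<delta>" "num c' {..<n} \<alpha> = num c {..<n} \<alpha> + \<delta>"
          using fe(4) by blast
        hence "num c' {..<n} \<alpha> \<le> num c' {..<n} \<beta> + 1" using g(3) by linarith
        ultimately have "I (Suc v) c'" using fe(2,3) s(4) by (simp add: I_def)
        thus "?Q s" using s by blast
      qed
    qed
    hence T: "runs (\<lambda>s. ?P s \<and> bval (unbalanced_end \<alpha> \<beta>) s) (Seq (flip_setup \<alpha> \<beta>) walk) (cost (flip_setup \<alpha> \<beta>) + walk_time n) ?Q"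
      by (rule runs_pre) (use G in blast)
    have F: "runs (\<lambda>s. ?P s \<and> \<not> bval (unbalanced_end \<alpha> \<beta>) s) Skip (cost Skip) ?Q"
    proof (rule runs_straight)
      fix s assume s: "?P s \<and> \<not> bval (unbalanced_end \<alpha> \<beta>) s"
      hence "\<not> G" using G by blast
      hence "I (Suc v) c" using I unfolding I_def settled_def G_def by (auto simp: less_Suc_eq)
      thus "?Q (effect Skip s)" using s by auto
    qed simp
    from runs_Cond[OF T F] show "runs ?P (Cond (unbalanced_end \<alpha> \<beta>) (Seq (flip_setup \<alpha> \<beta>) walk) Skip) (200 + walk_time n) ?Q"
      by (rule runs_conseq) (auto simp: unbalanced_end_def twice_def nbr_def flip_setup_def)
  qed
  from runs_sweep[of I, OF this] show ?thesis
  proof (rule runs_conseq)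
    fix s assume "\<exists>c. I n c \<and> holds c s"
    then obtain c where c: "I n c" "holds c s" by blast
    have "num c {..<n} \<beta> \<le> num c {..<n} \<alpha> + 1"
    proof (rule ccontr)
      assume n: "\<not> num c {..<n} \<beta> \<le> num c {..<n} \<alpha> + 1"
      hence "settled c \<alpha> \<beta> n" using c by (simp add: I_def)
      hence "num c {..<n} \<beta> \<le> num c {..<n} \<alpha>" using c settled_num_le[OF _ _ ab] by (simp add: I_def pre_balanced_def)
      thus False using n by simp
    qed
    thus "\<exists>c. (pre_balanced c \<and> dominating c \<and> num c {..<n} \<beta> \<le> num c {..<n} \<alpha> + 1 \<and>
        (B \<longrightarrow> num c {..<n} \<alpha> \<le> num c {..<n} \<beta> + 1)) \<and> holds c s" using c unfolding I_def by blast
  qed (auto simp: I_def settled_def)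
qed

section \<open>Reducing class 1 and evening out the other two\<close>

definition balanced :: "(nat \<Rightarrow> nat) \<Rightarrow> bool" where
  "balanced c \<longleftrightarrow> n \<le> 3 * num c {..<n} 1 \<and>
     num c {..<n} 2 \<le> num c {..<n} 3 + 1 \<and> num c {..<n} 3 \<le> num c {..<n} 2 + 1"

definition small :: "(nat \<Rightarrow> nat) \<Rightarrow> bool" where
  "small c \<longleftrightarrow> colouring c \<and> 9 * num c {..<n} 1 \<le> 4 * n"

text \<open>
  Vertices leave class 1 only while \<open>4 n < 9 a\<close>, and \<open>2 a + 2 \<le> n\<close> then yields \<open>18 < n\<close>. The bound
  \<open>14 \<le> n\<close> is what the final estimate needs.
\<close>

definition tight :: "(nat \<Rightarrow> nat) \<Rightarrow> bool" where
  "tight c \<longleftrightarrow> 4 * n < 9 * num c {..<n} 1 + 9 \<and> 14 \<le> n"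

lemma bval_isolated:
  assumes "holds c s" "nval e s < n"
  shows "bval (isolated e) s \<longleftrightarrow> free c (nval e s)"
  using nval_nbr[OF assms] holds_machine[OF assms(1)] by (auto simp: isolated_def free_def N_def)

lemma effect_move:
  assumes h: "holds c s" and nv: "nreg s ''v'' = v" and v: "v < n" and ijk: "{i, j, k} = {0, 1, 2}"
    and col: "colouring c" and c1: "c v = 1"
    and f: "free c (nb v i)" "free c (nb v j)"
  shows "\<exists>c'. holds c' (effect (move i j k d) s) \<and> nreg (effect (move i j k d) s) ''v'' = v \<and>
    colouring c' \<and> num c {..<n} 1 = num c' {..<n} 1 + 1 \<and> (\<forall>u<n. movable c' u \<longrightarrow> movable c u \<and> u \<noteq> v)"
proof -
  have Nv: "N v = {nb v i, nb v j, nb v k}" by (rule N_perm[OF ijk])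
  have d: "nb v i \<noteq> nb v j" "nb v i \<noteq> nb v k" "nb v j \<noteq> nb v k"
    using N_card[OF v] unfolding Nv by (auto simp: card_insert_if split: if_splits)
  have lt: "nb v i < n" "nb v j < n" "nb v k < n" using N_ltD[OF v] Nv by auto
  define c' where "c' = c(nb v i := c (nb v k), nb v j := c (nb v k), v := 5 - c (nb v k))"
  note cm = colouring_move[OF col v c1 Nv d f c'_def]
  have "\<forall>m\<in>{i, j, k}. m < 3" unfolding ijk by auto
  hence lt3: "i < 3" "j < 3" "k < 3" by auto
  have nb: "nval (nbr (NReg ''v'') m) s' = nb v m"
    if "m < 3" "narr s' ''adj'' = narr s ''adj''" "nreg s' ''v'' = v" for m s'
    using h v that by (simp add: holds_def nbr_def)
  have T: "bval (isolated (nbr (NReg ''v'') i)) s" "bval (isolated (nbr (NReg ''v'') j)) s"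
    using bval_isolated[OF h] nb[of _ s] lt3 lt f nv by simp_all
  have m: "narr s ''machine'' = c" using h by (simp add: holds_def)
  have "holds c' (effect (move i j k d) s)" "nreg (effect (move i j k d) s) ''v'' = v"
    using T h nv nb lt3 m by (simp_all add: move_def c'_def holds_def)
  moreover have "card (col_class c 1) = card (col_class c' 1) + 1"
  proof -
    have "col_class c 1 = insert v (col_class c' 1)" "v \<notin> col_class c' 1" using cm(2) v c1 by auto
    thus ?thesis by simp
  qed
  moreover have "movable c u \<and> u \<noteq> v" if u: "u < n" "movable c' u" for u
  proof -
    have "c' u = 1" using u unfolding movable_def by blast
    hence "u \<in> col_class c' 1" using u by simp
    hence "c u = 1" "u \<noteq> v" using cm(2) by auto
    moreover obtain p q where "p \<in> N u" "q \<in> N u" "p \<noteq> q" "free c' p" "free c' q"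
      using u unfolding movable_def by blast
    ultimately show ?thesis using cm(3) N_ltD[OF u(1)] unfolding movable_def by blast
  qed
  ultimately show ?thesis using cm(1) by (intro exI[of _ c']) (auto simp: num_def)
qed

text \<open>Moves make no vertex movable and take the moved one out of class 1. So if class 1 were
  still too large after the sweep, no vertex would be movable, against
  \<open>movable_exists\<close>. A colouring that is small from the beginning is not touched and
  remains balanced; otherwise the last move leaves it tight.\<close>

lemma runs_shrink:
  assumes nonbip: "\<not> (\<exists>f :: nat \<Rightarrow> bool. \<forall>u<n. \<forall>w\<in>N u. f u \<noteq> f w)"
  shows "runs (\<lambda>s. \<exists>c. (colouring c \<and> balanced c) \<and> holds c s) (For ''v'' (Seq count shrink))
     (2 + (n + 1) * (count_time n + cost shrink + 8))
     (\<lambda>s. \<exists>c. (small c \<and> (balanced c \<or> tight c)) \<and> holds c s)"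
proof -
  define I where "I i c \<longleftrightarrow> colouring c \<and>
     (small c \<and> (balanced c \<or> tight c) \<or> 4 * n < 9 * num c {..<n} 1 \<and> (\<forall>u<i. \<not> movable c u))" for i c
  have "runs (\<lambda>s. nreg s ''v'' = v \<and> (\<exists>c. I v c \<and> holds c s)) (Seq count shrink) (count_time n + cost shrink)
      (\<lambda>s. nreg s ''v'' = v \<and> (\<exists>c. I (Suc v) c \<and> holds c s))" if v: "v < n" for v
  proof (rule runs_counting_straight[OF straight_bits(2)])
    fix c s assume I: "I v c" and h: "holds c s" and ct: "counted c s" and nv: "nreg s ''v'' = v"
    have col: "colouring c" using I by (simp add: I_def)
    have m: "narr s ''machine'' = c" and nn: "nreg s ''n'' = n" using h by (auto simp: holds_def)
    have a: "narr s ''cnt'' 1 = num c {..<n} 1" using ct unfolding counted_def by blast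
    let ?g = "BAnd (NLess (times 4 (NReg ''n'')) (times 9 (cnt 1))) (NEq (colr (NReg ''v'')) (NConst 1))"
    have g: "bval ?g s \<longleftrightarrow> 4 * n < 9 * num c {..<n} 1 \<and> c v = 1" using m nn a nv by simp
    have nb: "nval (nbr (NReg ''v'') j) s = nb v j" if "j < 3" for j
      using nval_nbr[of c s "NReg ''v''" j] h v nv that by simp
    have lt: "nb v 0 < n" "nb v 1 < n" "nb v 2 < n" using N_ltD[OF v] by (auto simp: N_def)
    have iso: "bval (isolated (nbr (NReg ''v'') 0)) s \<longleftrightarrow> free c (nb v 0)"
       "bval (isolated (nbr (NReg ''v'') 1)) s \<longleftrightarrow> free c (nb v 1)"
       "bval (isolated (nbr (NReg ''v'') 2)) s \<longleftrightarrow> free c (nb v 2)"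
      using bval_isolated[OF h] nb lt by simp_all
    show "nreg (effect shrink s) ''v'' = v \<and> (\<exists>c'. I (Suc v) c' \<and> holds c' (effect shrink s))"
    proof (cases "4 * n < 9 * num c {..<n} 1 \<and> c v = 1")
      case False
      hence ng: "\<not> bval ?g s" using g by blast
      have "effect shrink s = s" by (simp only: shrink_def effect.simps ng if_False)
      moreover have "\<not> movable c v \<or> small c \<and> (balanced c \<or> tight c)"
        using False I by (auto simp: movable_def I_def small_def)
      hence "I (Suc v) c" using I by (auto simp: I_def less_Suc_eq)
      ultimately show ?thesis using h nv by auto
    next
      case True
      hence big: "4 * n < 9 * num c {..<n} 1" and c1: "c v = 1" by auto
      have gt: "bval ?g s" using True g by blast
      have e0: "effect shrink s = effect (move 0 1 2 (move 0 2 1 (move 1 2 0 Skip))) s"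
        by (simp only: shrink_def effect.simps gt if_True)
      have skip: "effect (move i j k d) s = effect d s"
        if "\<not> (bval (isolated (nbr (NReg ''v'') i)) s \<and> bval (isolated (nbr (NReg ''v'') j)) s)" for i j k d
        unfolding move_def effect.simps bval.simps using that by (rule if_not_P)
      have nm: "\<forall>u<v. \<not> movable c u" using I big by (auto simp: I_def small_def)
      have moved: ?thesis if e: "effect shrink s = effect (move i j k d) s" and ijk: "{i, j, k} = {0, 1, 2}"
        and f: "free c (nb v i)" "free c (nb v j)" for i j k d
      proof -
        obtain c' where c': "holds c' (effect shrink s)" "nreg (effect shrink s) ''v'' = v"
          "colouring c'" "num c {..<n} 1 = num c' {..<n} 1 + 1" "\<forall>u<n. movable c' u \<longrightarrow> movable c u \<and> u \<noteq> v"
          using effect_move[OF h nv v ijk col c1 f, of d] unfolding e by blast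
        have "14 \<le> n" using class1_bound[OF col nonbip] colouring_balance(2)[OF col] big by linarith
        hence "tight c'" using c'(4) big by (simp add: tight_def)
        moreover have "\<not> movable c' u" if "u < Suc v" for u
        proof
          assume "movable c' u"
          hence "movable c u" "u \<noteq> v" using c'(5) that v by auto
          thus False using nm that by (simp add: less_Suc_eq)
        qed
        ultimately have "I (Suc v) c'" using c'(3) by (auto simp: I_def small_def)
        thus ?thesis using c' by blast
      qed
      show ?thesis
      proof (cases "free c (nb v 0) \<and> free c (nb v 1)")
        case T1: True
        show ?thesis by (rule moved[OF e0]) (use T1 in auto)
      next
        case F1: False
        have e1: "effect shrink s = effect (move 0 2 1 (move 1 2 0 Skip)) s"
          unfolding e0 by (rule skip) (use F1 iso in blast)
        show ?thesis
        proof (cases "free c (nb v 0) \<and> free c (nb v 2)")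
          case T2: True
          show ?thesis by (rule moved[OF e1]) (use T2 in auto)
        next
          case F2: False
          have e2: "effect shrink s = effect (move 1 2 0 Skip) s"
            unfolding e1 by (rule skip) (use F2 iso in blast)
          show ?thesis
          proof (cases "free c (nb v 1) \<and> free c (nb v 2)")
            case T3: True
            show ?thesis by (rule moved[OF e2]) (use T3 in auto)
          next
            case F3: False
            have "effect shrink s = effect Skip s" unfolding e2 by (rule skip) (use F3 iso in blast)
            hence e3: "effect shrink s = s" by simp
            have "\<not> movable c v" using F1 F2 F3 by (auto simp: movable_def N_def)
            hence "I (Suc v) c" using nm big col by (auto simp: I_def less_Suc_eq)
            thus ?thesis using e3 h nv by auto
          qed
        qed
      qed
    qed
  qed
  from runs_sweep[of I, OF this] show ?thesis
  proof (rule runs_conseq)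
    fix s assume "\<exists>c. (colouring c \<and> balanced c) \<and> holds c s"
    then obtain c where "colouring c" "balanced c" "holds c s" by blast
    moreover from this have "I 0 c" by (auto simp: I_def small_def not_less)
    ultimately show "\<exists>c. I 0 c \<and> holds c s" by blast
  next
    fix s assume "\<exists>c. I n c \<and> holds c s"
    then obtain c where c: "I n c" "holds c s" by blast
    hence "small c \<and> (balanced c \<or> tight c)" using movable_exists[of c] by (auto simp: I_def)
    thus "\<exists>c. (small c \<and> (balanced c \<or> tight c)) \<and> holds c s" using c by blast
  qed auto
qed

definition evened :: "(nat \<Rightarrow> nat) \<Rightarrow> nat \<Rightarrow> bool" where
  "evened c i \<longleftrightarrow>
     (num c {..<n} 3 + 2 \<le> num c {..<n} 2 \<longrightarrow> (\<forall>u<i. free c u \<longrightarrow> c u \<noteq> 2)) \<and>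
     (num c {..<n} 2 + 2 \<le> num c {..<n} 3 \<longrightarrow> (\<forall>u<i. free c u \<longrightarrow> c u \<noteq> 3))"

lemma num_upd:
  assumes "v < n" "c v \<noteq> j"
  shows "num (c(v := j)) {..<n} j = num c {..<n} j + 1"
    "num c {..<n} (c v) = num (c(v := j)) {..<n} (c v) + 1"
proof -
  have 1: "col_class (c(v := j)) j = insert v (col_class c j)" using assms by auto
  have 2: "v \<notin> col_class c j" using assms by auto
  show "num (c(v := j)) {..<n} j = num c {..<n} j + 1" unfolding num_def 1 using 2 by simp
  have 3: "col_class c (c v) = insert v (col_class (c(v := j)) (c v))" using assms by auto
  have 4: "v \<notin> col_class (c(v := j)) (c v)" using assms by auto
  have "card (col_class c (c v)) = card (insert v (col_class (c(v := j)) (c v)))" using 3 by (rule arg_cong)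
  also have "\<dots> = card (col_class (c(v := j)) (c v)) + 1" using 4 by simp
  finally show "num c {..<n} (c v) = num (c(v := j)) {..<n} (c v) + 1" by (simp add: num_def)
qed

text \<open>The free vertices stay the same, and \<open>v\<close> has left the larger class. The gap
  shrinks by 2 from at least 2, so no gap in the other direction arises whose condition in
  \<open>evened\<close> would have to be met.\<close>

lemma recolour:
  assumes c: "small c" "tight c" "evened c v" and v: "v < n" "free c v" "c v = i" and ij: "{i, j} = {2, 3}"
    and gap: "num c {..<n} j + 2 \<le> num c {..<n} i"
  shows "small (c(v := j)) \<and> tight (c(v := j)) \<and> evened (c(v := j)) (Suc v)"
proof -
  let ?c = "c(v := j)"
  have col: "colouring c" using c by (simp add: small_def)
  have j: "j \<in> {2, 3}" "i \<noteq> j" using ij by (auto simp: doubleton_eq_iff)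
  note cu = colouring_free_upd[OF col v(1,2) j(1)]
  have n1: "num ?c {..<n} 1 = num c {..<n} 1" using cu(2) by (simp add: num_def)
  have nu: "num ?c {..<n} j = num c {..<n} j + 1" "num c {..<n} i = num ?c {..<n} i + 1"
    using num_upd[of v c j] v j by auto
  have "evened ?c (Suc v)"
    using c(3) gap nu cu(3) v(3) ij j(2) unfolding evened_def
    by (auto simp: doubleton_eq_iff less_Suc_eq)
  thus ?thesis using c cu(1) n1 by (simp add: small_def tight_def)
qed

text \<open>In a balanced colouring neither gap reaches 2, so the sweep leaves it alone.\<close>

lemma runs_even_out:
  "runs (\<lambda>s. \<exists>c. (small c \<and> (balanced c \<or> tight c)) \<and> holds c s) (For ''v'' (Seq count even_out))
     (2 + (n + 1) * (count_time n + cost even_out + 8))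
     (\<lambda>s. \<exists>c. (small c \<and> (balanced c \<or> tight c \<and> evened c n)) \<and> holds c s)"
proof -
  define I where "I i c \<longleftrightarrow> small c \<and> (balanced c \<or> tight c \<and> evened c i)" for i c
  have "runs (\<lambda>s. nreg s ''v'' = v \<and> (\<exists>c. I v c \<and> holds c s)) (Seq count even_out) (count_time n + cost even_out)
      (\<lambda>s. nreg s ''v'' = v \<and> (\<exists>c. I (Suc v) c \<and> holds c s))" if v: "v < n" for v
  proof (rule runs_counting_straight[OF straight_bits(3)])
    fix c s assume I: "I v c" and h: "holds c s" and ct: "counted c s" and nv: "nreg s ''v'' = v"
    have m: "narr s ''machine'' = c" using h by (auto simp: holds_def)
    have a: "narr s ''cnt'' 2 = num c {..<n} 2" "narr s ''cnt'' 3 = num c {..<n} 3"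
      using ct unfolding counted_def by blast+
    have iso: "bval (isolated (NReg ''v'')) s \<longleftrightarrow> free c v" using bval_isolated[OF h, of "NReg ''v''"] v nv by simp
    consider (23) "free c v" "c v = 2" "num c {..<n} 3 + 2 \<le> num c {..<n} 2"
      | (32) "free c v" "c v = 3" "num c {..<n} 2 + 2 \<le> num c {..<n} 3"
      | (no) "\<not> (free c v \<and> c v = 2 \<and> num c {..<n} 3 + 2 \<le> num c {..<n} 2)"
        "\<not> (free c v \<and> c v = 3 \<and> num c {..<n} 2 + 2 \<le> num c {..<n} 3)" by blast
    thus "nreg (effect even_out s) ''v'' = v \<and> (\<exists>c'. I (Suc v) c' \<and> holds c' (effect even_out s))"
    proof cases
      case 23
      hence T: "small c" "tight c" "evened c v" using I by (auto simp: I_def balanced_def)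
      have "I (Suc v) (c(v := 3))" using recolour[OF T v 23(1,2) _ 23(3)] by (simp add: I_def)
      moreover have "holds (c(v := 3)) (effect even_out s)" "nreg (effect even_out s) ''v'' = v"
        using 23 iso a m nv holds_upd[OF h, of v 3] by (simp_all add: even_out_def)
      ultimately show ?thesis by blast
    next
      case 32
      hence T: "small c" "tight c" "evened c v" using I by (auto simp: I_def balanced_def)
      have "{3, 2} = {2, 3::nat}" by auto
      hence "I (Suc v) (c(v := 2))" using recolour[OF T v 32(1,2) _ 32(3)] by (simp add: I_def)
      moreover have "holds (c(v := 2)) (effect even_out s)" "nreg (effect even_out s) ''v'' = v"
        using 32 iso a m nv holds_upd[OF h, of v 2] by (simp_all add: even_out_def)
      ultimately show ?thesis by blast
    next
      case no
      have "effect even_out s = s" using no iso a m nv by (auto simp: even_out_def)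
      moreover have "I (Suc v) c" using I no by (auto simp: I_def evened_def less_Suc_eq)
      ultimately show ?thesis using h nv by auto
    qed
  qed
  from runs_sweep[of I, OF this] show ?thesis
    by (rule runs_conseq) (auto simp: I_def evened_def)
qed

text \<open>Write a, b, c for the class sizes. In the balanced case b + c \<le> 2 n / 3 and a
  difference of at most 1 give 6 b \<le> 2 n + 3, and integrality gives 3 b \<le> n + 1.\<close>

lemma evened_bounds:
  assumes sm: "small c" and bal: "balanced c \<or> tight c \<and> evened c n"
    and nonbip: "\<not> (\<exists>f :: nat \<Rightarrow> bool. \<forall>u<n. \<forall>w\<in>N u. f u \<noteq> f w)"
  shows "3 * num c {..<n} 2 \<le> n + 1" "3 * num c {..<n} 3 \<le> n + 1"
proof -
  have col: "colouring c" and a: "9 * num c {..<n} 1 \<le> 4 * n" using sm by (auto simp: small_def)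
  note tot = colouring_balance[OF col] and c1 = class1_bound[OF col nonbip]
  have n2: "2 * num c {..<n} 2 + 6 * num c {..<n} 1 \<le> 3 * n" if "evened c n" "num c {..<n} 3 + 2 \<le> num c {..<n} 2"
    by (rule unmixed_bound[OF col, of 2 3]) (use that in \<open>auto simp: evened_def\<close>)
  have n3: "2 * num c {..<n} 3 + 6 * num c {..<n} 1 \<le> 3 * n" if "evened c n" "num c {..<n} 2 + 2 \<le> num c {..<n} 3"
    by (rule unmixed_bound[OF col, of 3 2]) (use that in \<open>auto simp: evened_def\<close>)
  have "3 * num c {..<n} 2 \<le> n + 1 \<and> 3 * num c {..<n} 3 \<le> n + 1"
  proof (cases "balanced c")
    case True
    hence "6 * num c {..<n} 2 \<le> 2 * n + 3" "6 * num c {..<n} 3 \<le> 2 * n + 3"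
      using tot(2) unfolding balanced_def by linarith+
    thus ?thesis by linarith
  next
    case False
    hence t: "4 * n < 9 * num c {..<n} 1 + 9" "14 \<le> n" and e: "evened c n" using bal by (auto simp: tight_def)
    \<comment> \<open>Tightness means 9 a \<ge> 4 n - 8. If a gap of 2 persists, the larger class
      has no free vertex and \<open>unmixed_bound\<close> gives 6 b \<le> n + 16, which is at most 2
      n + 2 exactly from n = 14 on. Otherwise 2 b \<le> n - a + 1, and 18 b \<le> 5 n + 17 suffices
      as well.\<close>
    show ?thesis
    proof
      show "3 * num c {..<n} 2 \<le> n + 1"
        using n2[OF e] t tot(2) by (cases "num c {..<n} 3 + 2 \<le> num c {..<n} 2") linarith+
      show "3 * num c {..<n} 3 \<le> n + 1"
        using n3[OF e] t tot(2) by (cases "num c {..<n} 2 + 2 \<le> num c {..<n} 3") linarith+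
    qed
  qed
  thus "3 * num c {..<n} 2 \<le> n + 1" "3 * num c {..<n} 3 \<le> n + 1" by auto
qed

end

section \<open>The scheduling algorithm\<close>

definition scheduler :: com where
  "scheduler = Seq (For ''v'' place) (Seq (lead 2) (Seq (lead 3) (Seq (For ''v'' absorb)
     (Seq (For ''v'' (flip 3 2)) (Seq (For ''v'' (flip 2 3))
     (Seq (For ''v'' (Seq count shrink)) (For ''v'' (Seq count even_out))))))))"

definition scheduler_time :: "nat \<Rightarrow> nat" where
  "scheduler_time n =
     (2 + (n + 1) * (place_time n + 8)) + ((count_time n + 50 + (n + 1) * 40) +
     ((count_time n + 50 + (n + 1) * 40) + ((2 + (n + 1) * (cost absorb + 8)) +
     ((2 + (n + 1) * (count_time n + (200 + walk_time n) + 8)) +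
     ((2 + (n + 1) * (count_time n + (200 + walk_time n) + 8)) +
     ((2 + (n + 1) * (count_time n + cost shrink + 8)) + (2 + (n + 1) * (count_time n + cost even_out + 8))))))))"

text \<open>With linear work per vertex the time is in fact quadratic. The number 1446 is 134 + 1192
  + 120, from the coefficients of 1, m and m * m for m = n + 1. The factor 14 counts the twelve
  walks of \<open>place\<close> and one for each of the two flip sweeps.\<close>

lemma scheduler_time_le:
  "scheduler_time n \<le> (1446 + cost absorb + cost shrink + cost even_out + 14 * cost step) * ((n + 1) * (n + 1))"
proof -
  define m where "m = n + 1"
  define k where "k = 1192 + cost absorb + cost shrink + cost even_out"
  have "1 \<le> m" by (simp add: m_def)
  hence m: "1 \<le> m * m" "m \<le> m * m" by simp_all
  have "scheduler_time n = 134 + k * m + (120 + 14 * cost step) * (m * m)"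
    unfolding scheduler_time_def place_time_def attempt_time_def walk_time_def count_time_def k_def
      m_def[symmetric]
    by (simp add: algebra_simps)
  also have "\<dots> \<le> 134 * (m * m) + k * (m * m) + (120 + 14 * cost step) * (m * m)"
    by (intro add_mono mult_le_mono2 m order_refl) (use m(1) in simp)
  also have "\<dots> = (1446 + cost absorb + cost shrink + cost even_out + 14 * cost step) * (m * m)"
    by (simp add: k_def algebra_simps)
  finally show ?thesis by (simp add: m_def)
qed

lemma scheduler_time_cubic: "(\<lambda>n. real (scheduler_time n)) \<in> O(\<lambda>n. real n ^ 3)"
proof -
  define K where "K = 1446 + cost absorb + cost shrink + cost even_out + 14 * cost step"
  have "norm (real (scheduler_time n)) \<le> real (4 * K) * norm (real n ^ 3)" if n: "1 \<le> n" for n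
  proof -
    have "scheduler_time n \<le> K * ((n + 1) * (n + 1))" unfolding K_def by (rule scheduler_time_le)
    also have "\<dots> \<le> K * ((2 * n) * (2 * n))" by (intro mult_le_mono) (use n in auto)
    also have "\<dots> \<le> 4 * K * n ^ 3"
      using mult_le_mono2[of 1 n "n * n"] n by (simp add: power3_eq_cube)
    finally have "real (scheduler_time n) \<le> real (4 * K * n ^ 3)" by (rule of_nat_mono)
    thus ?thesis by simp
  qed
  thus ?thesis by (intro bigoI[of _ "real (4 * K)"] eventually_sequentiallyI)
qed

context cubic_lists begin

lemma runs_scheduler:
  assumes noK4: "\<And>v. v < n \<Longrightarrow> \<exists>x\<in>N v. \<exists>y\<in>N v. x \<noteq> y \<and> y \<notin> N x"
    and nonbip: "\<not> (\<exists>f :: nat \<Rightarrow> bool. \<forall>u<n. \<forall>w\<in>N u. f u \<noteq> f w)"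
  shows "runs (holds (\<lambda>_. 0)) scheduler (scheduler_time n)
    (\<lambda>s. \<exists>c. holds c s \<and> colouring c \<and> 9 * num c {..<n} 1 \<le> 4 * n \<and>
       3 * num c {..<n} 2 \<le> n + 1 \<and> 3 * num c {..<n} 3 \<le> n + 1)"
proof -
  have m: "2 \<in> {2, 3::nat}" "3 \<in> {2, 3::nat}" "{3, 2} = {2, 3::nat}" "{2, 3} = {2, 3::nat}" by auto
  have R: "runs (holds (\<lambda>_. 0)) scheduler (scheduler_time n)
    (\<lambda>s. \<exists>c. (small c \<and> (balanced c \<or> tight c \<and> evened c n)) \<and> holds c s)"
    unfolding scheduler_def scheduler_time_def
  proof (intro runs_Seq)
    show "runs (holds (\<lambda>_. 0)) (For ''v'' place) (2 + (n + 1) * (place_time n + 8)) (\<lambda>s. \<exists>c. holds c s \<and> colouring c)"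
      by (rule runs_colour[OF noK4])
    show "runs (\<lambda>s. \<exists>c. holds c s \<and> colouring c) (lead 2) (count_time n + 50 + (n + 1) * 40)
       (\<lambda>s. \<exists>c. colouring c \<and> num c {..<n} 2 \<le> num c {..<n} 1 \<and> holds c s)"
      by (rule runs_conseq[OF runs_lead[OF m(1), of False]]) auto
    show "runs (\<lambda>s. \<exists>c. colouring c \<and> num c {..<n} 2 \<le> num c {..<n} 1 \<and> holds c s) (lead 3) (count_time n + 50 + (n + 1) * 40)
       (\<lambda>s. \<exists>c. pre_balanced c \<and> holds c s)"
    proof (rule runs_conseq[OF runs_lead[OF m(2), of True]])
      fix s assume "\<exists>c. colouring c \<and> num c {..<n} 3 \<le> num c {..<n} 1 \<and>
         (True \<longrightarrow> num c {..<n} (5 - 3) \<le> num c {..<n} 1) \<and> holds c s"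
      then obtain c where c: "colouring c" "num c {..<n} 3 \<le> num c {..<n} 1"
         "num c {..<n} 2 \<le> num c {..<n} 1" "holds c s" by auto
      hence "pre_balanced c" using colouring_balance(2)[OF c(1)] unfolding pre_balanced_def by linarith
      thus "\<exists>c. pre_balanced c \<and> holds c s" using c by blast
    qed auto
    show "runs (\<lambda>s. \<exists>c. pre_balanced c \<and> holds c s) (For ''v'' absorb) (2 + (n + 1) * (cost absorb + 8))
      (\<lambda>s. \<exists>c. (pre_balanced c \<and> dominating c) \<and> holds c s)" by (rule runs_absorb)
    show "runs (\<lambda>s. \<exists>c. (pre_balanced c \<and> dominating c) \<and> holds c s) (For ''v'' (flip 3 2))
       (2 + (n + 1) * (count_time n + (200 + walk_time n) + 8))
       (\<lambda>s. \<exists>c. (pre_balanced c \<and> dominating c \<and> num c {..<n} 2 \<le> num c {..<n} 3 + 1) \<and> holds c s)"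
      by (rule runs_conseq[OF runs_flips[OF m(3), of False]]) auto
    show "runs (\<lambda>s. \<exists>c. (pre_balanced c \<and> dominating c \<and> num c {..<n} 2 \<le> num c {..<n} 3 + 1) \<and> holds c s)
       (For ''v'' (flip 2 3)) (2 + (n + 1) * (count_time n + (200 + walk_time n) + 8))
       (\<lambda>s. \<exists>c. (colouring c \<and> balanced c) \<and> holds c s)"
      by (rule runs_conseq[OF runs_flips[OF m(4), of True]]) (auto simp: pre_balanced_def balanced_def)
    show "runs (\<lambda>s. \<exists>c. (colouring c \<and> balanced c) \<and> holds c s) (For ''v'' (Seq count shrink))
       (2 + (n + 1) * (count_time n + cost shrink + 8))
       (\<lambda>s. \<exists>c. (small c \<and> (balanced c \<or> tight c)) \<and> holds c s)" by (rule runs_shrink[OF nonbip])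
  qed (rule runs_even_out)
  show ?thesis
  proof (rule runs_post[OF R])
    fix s assume "\<exists>c. (small c \<and> (balanced c \<or> tight c \<and> evened c n)) \<and> holds c s"
    then obtain c where c: "small c" "balanced c \<or> tight c \<and> evened c n" "holds c s" by blast
    show "\<exists>c. holds c s \<and> colouring c \<and> 9 * num c {..<n} 1 \<le> 4 * n \<and>
       3 * num c {..<n} 2 \<le> n + 1 \<and> 3 * num c {..<n} 3 \<le> n + 1"
      using evened_bounds[OF c(1,2) nonbip] c unfolding small_def by blast
  qed
qed

section \<open>Schedules as colourings and the approximation ratio\<close>

lemma schedule_colouring:
  assumes E: "\<And>u v. u < n \<Longrightarrow> v < n \<Longrightarrow> {u, v} \<in> E \<longleftrightarrow> u \<in> N v"
    and sch: "is_schedule {..<n} E I\<^sub>1 I\<^sub>2 I\<^sub>3"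
  obtains c where "colouring c" "col_class c 1 = I\<^sub>1" "col_class c 2 = I\<^sub>2" "col_class c 3 = I\<^sub>3"
proof -
  define c where "c u = (if u \<in> I\<^sub>1 then 1 else if u \<in> I\<^sub>2 then 2 else 3::nat)" for u
  have U: "I\<^sub>1 \<union> I\<^sub>2 \<union> I\<^sub>3 = {..<n}" and D: "I\<^sub>1 \<inter> I\<^sub>2 = {}" "I\<^sub>1 \<inter> I\<^sub>3 = {}" "I\<^sub>2 \<inter> I\<^sub>3 = {}"
    and ind: "\<forall>u\<in>I\<^sub>1. \<forall>v\<in>I\<^sub>1. {u, v} \<notin> E" "\<forall>u\<in>I\<^sub>2. \<forall>v\<in>I\<^sub>2. {u, v} \<notin> E" "\<forall>u\<in>I\<^sub>3. \<forall>v\<in>I\<^sub>3. {u, v} \<notin> E"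
    using sch unfolding is_schedule_def independent_set_def by auto
  have cl: "col_class c 1 = I\<^sub>1" "col_class c 2 = I\<^sub>2" "col_class c 3 = I\<^sub>3" using U D by (auto simp: c_def)
  have "colouring c"
    unfolding colouring_def
  proof (intro allI impI conjI)
    fix u assume u: "u < n"
    show "c u \<in> {1, 2, 3}" by (simp add: c_def)
    show "c u \<notin> c ` N u"
    proof
      assume "c u \<in> c ` N u"
      then obtain w where w: "w \<in> N u" "c w = c u" by auto
      have wn: "w < n" using N_ltD[OF u w(1)] .
      have "{w, u} \<in> E" using E[OF wn u] w by simp
      moreover have "(u \<in> I\<^sub>1 \<and> w \<in> I\<^sub>1) \<or> (u \<in> I\<^sub>2 \<and> w \<in> I\<^sub>2) \<or> (u \<in> I\<^sub>3 \<and> w \<in> I\<^sub>3)"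
        using w(2) U u wn unfolding c_def by (auto split: if_splits)
      ultimately show False using ind by blast
    qed
  qed
  thus thesis using that cl by blast
qed

lemma colouring_schedule:
  assumes E: "\<And>u v. u < n \<Longrightarrow> v < n \<Longrightarrow> {u, v} \<in> E \<longleftrightarrow> u \<in> N v"
    and col: "colouring c"
  shows "is_schedule {..<n} E (col_class c 1) (col_class c 2) (col_class c 3)"
proof -
  have "independent_set {..<n} E (col_class c i)" for i
    unfolding independent_set_def using E colouring_neq[OF col] by fastforce
  moreover have "col_class c 1 \<union> col_class c 2 \<union> col_class c 3 = {..<n}" using colouring_cases[OF col] by auto
  ultimately show ?thesis unfolding is_schedule_def by auto
qed

lemma schedule_length_less:
  assumes nonbip: "\<not> (\<exists>f :: nat \<Rightarrow> bool. \<forall>u<n. \<forall>w\<in>N u. f u \<noteq> f w)"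
    and E: "\<And>u v. u < n \<Longrightarrow> v < n \<Longrightarrow> {u, v} \<in> E \<longleftrightarrow> u \<in> N v"
    and col: "colouring c" and a: "9 * num c {..<n} 1 \<le> 4 * n"
    and b: "3 * num c {..<n} 2 \<le> n + 1" "3 * num c {..<n} 3 \<le> n + 1"
    and s: "s\<^sub>2 < s\<^sub>1" "0 < s\<^sub>2" and sch: "is_schedule {..<n} E I\<^sub>1 I\<^sub>2 I\<^sub>3"
  shows "schedule_length s\<^sub>1 s\<^sub>2 s\<^sub>2 (col_class c 1) (col_class c 2) (col_class c 3)
    < 4 / 3 * schedule_length s\<^sub>1 s\<^sub>2 s\<^sub>2 I\<^sub>1 I\<^sub>2 I\<^sub>3"
proof -
  define L where "L = schedule_length s\<^sub>1 s\<^sub>2 s\<^sub>2 I\<^sub>1 I\<^sub>2 I\<^sub>3"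
  obtain d where d: "colouring d" "col_class d 1 = I\<^sub>1" "col_class d 2 = I\<^sub>2" "col_class d 3 = I\<^sub>3"
    using schedule_colouring[OF E sch] by blast
  define x y z where "x = card I\<^sub>1" and "y = card I\<^sub>2" and "z = card I\<^sub>3"
  have num: "num d {..<n} 1 = x" "num d {..<n} 2 = y" "num d {..<n} 3 = z"
    using d by (simp_all add: num_def x_def y_def z_def)
  have xyz: "x + 2 \<le> y + z" "x + y + z = n"
    using class1_bound[OF d(1) nonbip] colouring_balance(2)[OF d(1)] num by auto
  have "real x / s\<^sub>1 \<le> L" "real y / s\<^sub>2 \<le> L" "real z / s\<^sub>2 \<le> L"
    unfolding L_def schedule_length_def x_def y_def z_def by (intro Max_ge; simp)+
  hence L: "real x \<le> L * s\<^sub>1" "real y \<le> L * s\<^sub>2" "real z \<le> L * s\<^sub>2"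
    using s by (simp_all add: pos_divide_le_eq)
  \<comment> \<open>The slow machines together get at least n / 2 + 1 jobs, hence one of them at
    least (n + 2) / 4.\<close>
  have n2: "real n + 2 \<le> 4 * (L * s\<^sub>2)" using xyz L(2,3) by linarith
  hence "0 < L * s\<^sub>2" by linarith
  hence "0 < L" using s by (simp add: zero_less_mult_iff)
  \<comment> \<open>This makes the bound for the fast machine strict; those for the slow ones are
    strict since n + 1 < n + 2.\<close>
  hence "L * s\<^sub>2 < L * s\<^sub>1" using s by simp
  moreover have "real n \<le> L * s\<^sub>1 + 2 * (L * s\<^sub>2)" using xyz L by linarith
  ultimately have "real n < 3 * (L * s\<^sub>1)" by linarith
  hence "real (num c {..<n} 1) < 4 / 3 * (L * s\<^sub>1)" using a by linarith
  moreover have "real (num c {..<n} 2) < 4 / 3 * (L * s\<^sub>2)" "real (num c {..<n} 3) < 4 / 3 * (L * s\<^sub>2)"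
    using b n2 by linarith+
  ultimately have "real (num c {..<n} 1) / s\<^sub>1 < 4 / 3 * L" "real (num c {..<n} 2) / s\<^sub>2 < 4 / 3 * L"
    "real (num c {..<n} 3) / s\<^sub>2 < 4 / 3 * L"
    using s by (simp_all add: pos_divide_less_eq algebra_simps)
  thus ?thesis unfolding L_def[symmetric] by (simp add: schedule_length_def num_def)
qed

text \<open>\<open>Min\<close> is meaningful for finite nonempty sets only: schedules are triples of
  subsets of a finite set, and the given one shows that there are some.\<close>

lemma optimal_length_attained:
  assumes "is_schedule {..<n} E J\<^sub>1 J\<^sub>2 J\<^sub>3"
  obtains I\<^sub>1 I\<^sub>2 I\<^sub>3 where "is_schedule {..<n} E I\<^sub>1 I\<^sub>2 I\<^sub>3"
    "optimal_length {..<n} E s\<^sub>1 s\<^sub>2 s\<^sub>3 = schedule_length s\<^sub>1 s\<^sub>2 s\<^sub>3 I\<^sub>1 I\<^sub>2 I\<^sub>3"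
proof -
  let ?S = "{schedule_length s\<^sub>1 s\<^sub>2 s\<^sub>3 I\<^sub>1 I\<^sub>2 I\<^sub>3 |I\<^sub>1 I\<^sub>2 I\<^sub>3. is_schedule {..<n} E I\<^sub>1 I\<^sub>2 I\<^sub>3}"
  have "?S \<subseteq> (\<lambda>(I, J, K). schedule_length s\<^sub>1 s\<^sub>2 s\<^sub>3 I J K) ` (Pow {..<n} \<times> Pow {..<n} \<times> Pow {..<n})"
  proof
    fix x assume "x \<in> ?S"
    then obtain I J K where "x = schedule_length s\<^sub>1 s\<^sub>2 s\<^sub>3 I J K" "is_schedule {..<n} E I J K" by blast
    thus "x \<in> (\<lambda>(I, J, K). schedule_length s\<^sub>1 s\<^sub>2 s\<^sub>3 I J K) ` (Pow {..<n} \<times> Pow {..<n} \<times> Pow {..<n})"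
      by (intro image_eqI[of _ _ "(I, J, K)"]) (auto simp: is_schedule_def)
  qed
  hence "finite ?S" by (rule finite_subset) auto
  moreover have "?S \<noteq> {}" using assms by blast
  ultimately have "Min ?S \<in> ?S" by (rule Min_in)
  thus thesis using that unfolding optimal_length_def by blast
qed

end

section \<open>From graphs to neighbour lists\<close>

lemma cubic_graph_lists:
  assumes cub: "cubic_graph {..<n} E" and adj: "adjacency_array n E adj"
  shows "cubic_lists n (\<lambda>v j. adj (3 * v + j))"
    and "\<And>u v. v < n \<Longrightarrow> {u, v} \<in> E \<longleftrightarrow> u \<in> nbrs (\<lambda>v j. adj (3 * v + j)) v"
proof -
  have e2: "\<And>e. e \<in> E \<Longrightarrow> e \<subseteq> {..<n} \<and> card e = 2" and deg: "\<And>v. v < n \<Longrightarrow> vertex_degree E v = 3"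
    using cub unfolding cubic_graph_def simple_graph_def by auto
  have nb: "nbrs (\<lambda>v j. adj (3 * v + j)) v = {u. {u, v} \<in> E}" if "v < n" for v
    using adj that unfolding adjacency_array_def nbrs_def by simp
  thus "\<And>u v. v < n \<Longrightarrow> {u, v} \<in> E \<longleftrightarrow> u \<in> nbrs (\<lambda>v j. adj (3 * v + j)) v" by simp
  have ne: "u \<noteq> v" if "{u, v} \<in> E" for u v using e2[OF that] by auto
  have card: "card {u. {u, v} \<in> E} = 3" if "v < n" for v
  proof -
    have "{e \<in> E. v \<in> e} = (\<lambda>u. {u, v}) ` {u. {u, v} \<in> E}"
    proof
      show "{e \<in> E. v \<in> e} \<subseteq> (\<lambda>u. {u, v}) ` {u. {u, v} \<in> E}"
      proof
        fix e assume e: "e \<in> {e \<in> E. v \<in> e}"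
        then obtain x y where "e = {x, y}" using e2[of e] by (auto simp: card_2_iff)
        hence "\<exists>u. e = {u, v}" using e by auto
        thus "e \<in> (\<lambda>u. {u, v}) ` {u. {u, v} \<in> E}" using e by auto
      qed
    qed auto
    moreover have "inj_on (\<lambda>u. {u, v}) {u. {u, v} \<in> E}"
      by (rule inj_onI) (auto simp: doubleton_eq_iff)
    ultimately have "card {e \<in> E. v \<in> e} = card {u. {u, v} \<in> E}" by (simp add: card_image)
    thus ?thesis using deg[OF that] by (simp add: vertex_degree_def)
  qed
  show "cubic_lists n (\<lambda>v j. adj (3 * v + j))"
  proof
    fix v assume v: "v < n"
    show "nbrs (\<lambda>v j. adj (3 * v + j)) v \<subseteq> {..<n}" unfolding nb[OF v] using e2 by blast
    show "card (nbrs (\<lambda>v j. adj (3 * v + j)) v) = 3" unfolding nb[OF v] using card[OF v] .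
    show "v \<notin> nbrs (\<lambda>v j. adj (3 * v + j)) v" unfolding nb[OF v] using ne by blast
  next
    fix u w assume "u < n" "w < n" "u \<in> nbrs (\<lambda>v j. adj (3 * v + j)) w"
    thus "w \<in> nbrs (\<lambda>v j. adj (3 * v + j)) u" using nb by (simp add: insert_commute)
  qed
qed

lemma chromatic_number_3:
  assumes simple: "simple_graph {..<n} E" and chi: "chromatic_number {..<n} E = 3"
  obtains c where "\<And>u. u < n \<Longrightarrow> c u < (3::nat)" "\<And>u v. {u, v} \<in> E \<Longrightarrow> c u \<noteq> c v"
    and "\<not> (\<exists>f :: nat \<Rightarrow> bool. \<forall>u v. {u, v} \<in> E \<longrightarrow> f u \<noteq> f v)"
proof -
  define P where "P k \<longleftrightarrow> (\<exists>c. c ` {..<n} \<subseteq> {..<k} \<and> proper_colouring E c)" for k :: nat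
  have L: "(LEAST k. P k) = 3" using chi unfolding chromatic_number_def P_def .
  have e2: "u \<noteq> v" if "{u, v} \<in> E" for u v
  proof
    assume "u = v"
    moreover have "card {u, v} = 2" using simple that unfolding simple_graph_def by blast
    ultimately show False by simp
  qed
  \<comment> \<open>\<open>LEAST\<close> yields a property of 3 only if some number of colours works
    at all; \<open>n\<close> colours do.\<close>
  hence "P n" unfolding P_def proper_colouring_def by (intro exI[of _ id]) auto
  hence "P 3" using LeastI[of P n] L by simp
  then obtain c where c: "c ` {..<n} \<subseteq> {..<3}" "proper_colouring E c" unfolding P_def by blast
  have "\<not> P 2" using not_less_Least[of 2 P] L by simp
  have "\<not> (\<exists>f :: nat \<Rightarrow> bool. \<forall>u v. {u, v} \<in> E \<longrightarrow> f u \<noteq> f v)"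
  proof
    assume "\<exists>f :: nat \<Rightarrow> bool. \<forall>u v. {u, v} \<in> E \<longrightarrow> f u \<noteq> f v"
    then obtain f :: "nat \<Rightarrow> bool" where f: "\<And>u v. {u, v} \<in> E \<Longrightarrow> f u \<noteq> f v" by blast
    have "P 2" unfolding P_def proper_colouring_def
      by (rule exI[of _ "\<lambda>u. if f u then 1 else 0"]) (use f in auto)
    thus False using \<open>\<not> P 2\<close> by simp
  qed
  thus thesis using that[of c] c unfolding proper_colouring_def by auto
qed

theorem theorem4:
  "\<exists>(p :: com) (T :: nat \<Rightarrow> nat).
     (\<lambda>n. real (T n)) \<in> O(\<lambda>n. real n ^ 3) \<and>
     (\<forall>(n :: nat) (E :: nat set set) (adj :: nat \<Rightarrow> nat) (s\<^sub>1 :: real) (s\<^sub>2 :: real) (s\<^sub>3 :: real).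
        cubic_graph {..<n} E \<and> connected_graph {..<n} E \<and> chromatic_number {..<n} E = 3 \<and>
        \<not> graph_isomorphic {..<n} E prism_vertices prism_edges \<and>
        adjacency_array n E adj \<and> s\<^sub>1 > s\<^sub>2 \<and> s\<^sub>2 = s\<^sub>3 \<and> s\<^sub>3 > 0 \<longrightarrow>
        (\<exists>t s'. exec p (input_state n adj s\<^sub>1 s\<^sub>2 s\<^sub>3) t s' \<and> t \<le> T n \<and>
           (let I\<^sub>1 = output_class n s' 1; I\<^sub>2 = output_class n s' 2; I\<^sub>3 = output_class n s' 3
            in is_schedule {..<n} E I\<^sub>1 I\<^sub>2 I\<^sub>3 \<and>
               schedule_length s\<^sub>1 s\<^sub>2 s\<^sub>3 I\<^sub>1 I\<^sub>2 I\<^sub>3 < 4 / 3 * optimal_length {..<n} E s\<^sub>1 s\<^sub>2 s\<^sub>3)))"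
proof (intro exI[of _ scheduler] exI[of _ scheduler_time] conjI scheduler_time_cubic allI impI)
  fix n E adj and s\<^sub>1 s\<^sub>2 s\<^sub>3 :: real
  assume asm: "cubic_graph {..<n} E \<and> connected_graph {..<n} E \<and> chromatic_number {..<n} E = 3 \<and>
        \<not> graph_isomorphic {..<n} E prism_vertices prism_edges \<and>
        adjacency_array n E adj \<and> s\<^sub>1 > s\<^sub>2 \<and> s\<^sub>2 = s\<^sub>3 \<and> s\<^sub>3 > 0"
  hence cub: "cubic_graph {..<n} E" and adj: "adjacency_array n E adj" and s: "s\<^sub>2 < s\<^sub>1" "0 < s\<^sub>2" "s\<^sub>3 = s\<^sub>2"
    and simple: "simple_graph {..<n} E" and chi: "chromatic_number {..<n} E = 3"
    by (auto simp: cubic_graph_def)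
  let ?nb = "\<lambda>v j. adj (3 * v + j)"
  interpret cubic_lists n ?nb by (rule cubic_graph_lists[OF cub adj])
  note EN = cubic_graph_lists(2)[OF cub adj]
  have lt: "u < n" "v < n" if "{u, v} \<in> E" for u v
    using simple that unfolding simple_graph_def by auto
  obtain c\<^sub>0 where c0: "\<And>u. u < n \<Longrightarrow> c\<^sub>0 u < (3::nat)" "\<And>u v. {u, v} \<in> E \<Longrightarrow> c\<^sub>0 u \<noteq> c\<^sub>0 v"
    and nb0: "\<not> (\<exists>f :: nat \<Rightarrow> bool. \<forall>u v. {u, v} \<in> E \<longrightarrow> f u \<noteq> f v)"
    using chromatic_number_3[OF simple chi] by blast
  have nonbip: "\<not> (\<exists>f :: nat \<Rightarrow> bool. \<forall>u<n. \<forall>w\<in>N u. f u \<noteq> f w)"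
  proof
    assume "\<exists>f :: nat \<Rightarrow> bool. \<forall>u<n. \<forall>w\<in>N u. f u \<noteq> f w"
    then obtain f :: "nat \<Rightarrow> bool" where f: "\<And>u w. u < n \<Longrightarrow> w \<in> N u \<Longrightarrow> f u \<noteq> f w" by blast
    have "f u \<noteq> f v" if "{u, v} \<in> E" for u v using f[of v u] EN[of v u] lt[OF that] that by metis
    thus False using nb0 by blast
  qed
  \<comment> \<open>A vertex with three pairwise adjacent neighbours would need four
    colours.\<close>
  have noK4: "\<exists>x\<in>N v. \<exists>y\<in>N v. x \<noteq> y \<and> y \<notin> N x" if v: "v < n" for v
  proof (rule ccontr)
    assume "\<not> ?thesis"
    hence adjc: "y \<in> N x" if "x \<in> N v" "y \<in> N v" "x \<noteq> y" for x y using that by blast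
    have ne: "c\<^sub>0 y \<noteq> c\<^sub>0 x" if "x < n" "y \<in> N x" for x y using EN[OF that(1)] that(2) c0(2) by blast
    have "inj_on c\<^sub>0 (insert v (N v))"
    proof (rule inj_onI, rule ccontr)
      fix x y assume xy: "x \<in> insert v (N v)" "y \<in> insert v (N v)" "c\<^sub>0 x = c\<^sub>0 y" "x \<noteq> y"
      have "x < n" "y < n" using xy v N_ltD[OF v] by auto
      moreover have "y \<in> N x \<or> x \<in> N y" using xy adjc by blast
      ultimately show False using ne xy by metis
    qed
    hence "card (c\<^sub>0 ` insert v (N v)) = 4" using N_card[OF v] N_irrefl[OF v] by (simp add: card_image)
    moreover have "c\<^sub>0 ` insert v (N v) \<subseteq> {..<3}" using c0(1) v N_ltD[OF v] by auto
    hence "card (c\<^sub>0 ` insert v (N v)) \<le> card {..<3::nat}" by (intro card_mono) auto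
    ultimately show False by simp
  qed
  have "holds (\<lambda>_. 0) (input_state n adj s\<^sub>1 s\<^sub>2 s\<^sub>3)"
    unfolding holds_def input_state_def by (auto simp: add.assoc[symmetric] mult.commute intro!: arg_cong[where f = adj])
  then obtain t s' where ex: "exec scheduler (input_state n adj s\<^sub>1 s\<^sub>2 s\<^sub>3) t s'" "t \<le> scheduler_time n"
    and "\<exists>c. holds c s' \<and> colouring c \<and> 9 * num c {..<n} 1 \<le> 4 * n \<and>
       3 * num c {..<n} 2 \<le> n + 1 \<and> 3 * num c {..<n} 3 \<le> n + 1"
    using runs_scheduler[OF noK4 nonbip] unfolding runs_def by blast
  then obtain c where c: "holds c s'" "colouring c" "9 * num c {..<n} 1 \<le> 4 * n"
    "3 * num c {..<n} 2 \<le> n + 1" "3 * num c {..<n} 3 \<le> n + 1" by blast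
  have out: "output_class n s' i = col_class c i" for i
    using c(1) by (simp add: output_class_def holds_def)
  have E: "{u, v} \<in> E \<longleftrightarrow> u \<in> N v" if "u < n" "v < n" for u v using EN that by blast
  have sch: "is_schedule {..<n} E (col_class c 1) (col_class c 2) (col_class c 3)" by (rule colouring_schedule[OF E c(2)])
  obtain I\<^sub>1 I\<^sub>2 I\<^sub>3 where I: "is_schedule {..<n} E I\<^sub>1 I\<^sub>2 I\<^sub>3"
    "optimal_length {..<n} E s\<^sub>1 s\<^sub>2 s\<^sub>3 = schedule_length s\<^sub>1 s\<^sub>2 s\<^sub>3 I\<^sub>1 I\<^sub>2 I\<^sub>3"
    by (rule optimal_length_attained[OF sch])
  have "schedule_length s\<^sub>1 s\<^sub>2 s\<^sub>3 (col_class c 1) (col_class c 2) (col_class c 3) < 4 / 3 * optimal_length {..<n} E s\<^sub>1 s\<^sub>2 s\<^sub>3"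
  proof -
    have "schedule_length s\<^sub>1 s\<^sub>2 s\<^sub>2 (col_class c 1) (col_class c 2) (col_class c 3)
        < 4 / 3 * schedule_length s\<^sub>1 s\<^sub>2 s\<^sub>2 I\<^sub>1 I\<^sub>2 I\<^sub>3"
      by (rule schedule_length_less[OF nonbip _ c(2-5) s(1,2) I(1)]) (rule E)
    thus ?thesis using I(2) s(3) by simp
  qed
  thus "\<exists>t s'. exec scheduler (input_state n adj s\<^sub>1 s\<^sub>2 s\<^sub>3) t s' \<and> t \<le> scheduler_time n \<and>
           (let I\<^sub>1 = output_class n s' 1; I\<^sub>2 = output_class n s' 2; I\<^sub>3 = output_class n s' 3
            in is_schedule {..<n} E I\<^sub>1 I\<^sub>2 I\<^sub>3 \<and>
               schedule_length s\<^sub>1 s\<^sub>2 s\<^sub>3 I\<^sub>1 I\<^sub>2 I\<^sub>3 < 4 / 3 * optimal_length {..<n} E s\<^sub>1 s\<^sub>2 s\<^sub>3)"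
    unfolding Let_def using ex sch by (intro exI[of _ t] exI[of _ s'] conjI) (simp_all only: out)
qed

end
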